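(* Let $X$ be a topological space, $A\subset\operatorname{Reg}(X)$ a Boolean subalgebra, $B$ a noise-type Boolean algebra of $\sigma$-fields on $(\Omega,\mathcal F,P)$ with spectral space $(S,\Sigma,\mathcal M)$ and spectral subsets $S_x\subset S$ ($x\in B$), and $h:A\to B$ a homomorphism of Boolean algebras. Assume: (A1) there exists a countable subset $A_0\subset A$ such that $\{\operatorname{Int}(a):a\in A_0\}$ is a base of the topology of $X$; (A2) for every $a\in A$ there exist $a_1,a_2,\dots\in A$ such that $a_n\le a_{n+1}$, $\operatorname{Cl}(a_n)$ is compact and $\operatorname{Cl}(a_n)\subset\operatorname{Int}(a)$ for all $n$, and $h(a_n')\downarrow h(a')$. Let $F$ be a map from $S$ to the set of closed subsets of $X$ such that for every $a\in A$, $S_{h(a)}=\{s\in S:F(s)\subset\operatorname{Cl}(a)\}$ up to a null set. Let $r\in\operatorname{Reg}(X)$, $r\notin A$, and define $$h_-(r)=\sup\{h(a):a\in A,\ \operatorname{Cl}(a)\subset\operatorname{Int}(r)\},\qquad h_-(r')=\sup\{h(a):a\in A,\ \operatorname{Cl}(a)\subset\operatorname{Int}(r')\}$$ (suprema in $\Lambda$), and $\operatorname{Bd}(r)=\operatorname{Cl}(r)\setminus\operatorname{Int}(r)$. Then: (a) If $h_-(r)\vee h_-(r')=1$ then $F(s)\cap\operatorname{Bd}(r)=\emptyset$ for almost all $s\in S$. (b) If $F(s)\cap\operatorname{Bd}(r)=\emptyset$ for almost all $s$, and $F(s)$ is compact for almost all $s$, and $X$ is a regular topological space, then $h_-(r)\vee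 h_-(r')=1$ (and therefore $h_-(r)$ belongs to the noise-type completion of $B$, and $(h_-(r))'=h_-(r')$).
   Context: $(\Omega,\mathcal F,P)$ is a complete probability space with $H=L_2(\Omega,\mathcal F,P)$ separable (complex scalars). $\Lambda$ denotes the set of all sub-$\sigma$-fields of $\mathcal F$ containing all $P$-null sets, ordered by inclusion; it is a complete lattice with $x\wedge y=x\cap y$, $x\vee y$ the $\sigma$-field generated by $x\cup y$, suprema being generated $\sigma$-fields and infima intersections; its least element $0$ is the $\sigma$-field of all events of probability $0$ or $1$, its greatest element is $1=\mathcal F$. A noise-type Boolean algebra is a distributive sublattice $B\subset\Lambda$ containing $0$ and $1$, in which every $x\in B$ has a complement $x'\in B$ ($x\wedge x'=0$, $x\vee x'=1$), and such that for every $x\in B$ the $\sigma$-fields $x$ and $x'$ are independent. For $x\in\Lambda$, $Q_x$ is the orthogonal projection of $H$ onto the subspace of functions measurable with respect to $x$. $\Lambda$ carries the strong operator topology: $x_n\to x$ iff $\|Q_{x_n}\psi-Q_x\psi\|\to0$ for all $\psi\in H$; $\operatorname{Cl}(B)$ is the closure of $B$ in $\Lambda$. The noise-type completion of $B$ is the greatest noise-type Boolean algebra $C$ with $B\subset C\subset\operatorname{Cl}(B)$, namely $C=\{x\in\operatorname{Cl}(B):\exists y\in\operatorname{Cl}(B)\ (x\wedge y=0,\ x\vee y=1)\}$. $h(a_n')\downarrow h(a')$ means the sequence is decreasing and converges to $h(a')$ in $\Lambda$, i.e. $\bigcap_n h(a_n')=h(a')$ as $\sigma$-fields. Spectral space: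 the projections $Q_x$, $x\in B$, commute and generate a commutative von Neumann algebra $\mathcal A$ on $H$. A measure class space $(S,\Sigma,\mathcal M)$ is a measurable space $(S,\Sigma)$ with an equivalence class $\mathcal M$ of mutually absolutely continuous finite positive measures (with separable $L_2$ spaces); null sets and "almost all" refer to $\mathcal M$. Fix such a space and an isomorphism of von Neumann algebras $\alpha:\mathcal A\to L_\infty(S,\Sigma,\mathcal M)$ (these exist). For $x\in B$, $S_x\in\Sigma$ is the set (defined up to a null set) with $\alpha(Q_x)=\mathbf 1_{S_x}$. $\operatorname{Reg}(X)$ is the set of all pairs $r=(G,F)$ of subsets of $X$ such that $G$ is the interior of $F$ and $F$ is the closure of $G$; write $\operatorname{Int}(r)=G$, $\operatorname{Cl}(r)=F$. Ordered by $r\le s\iff\operatorname{Int}(r)\subset\operatorname{Int}(s)$ ($\iff\operatorname{Cl}(r)\subset\operatorname{Cl}(s)$), it is a Boolean algebra with $\operatorname{Int}(r\wedge s)=\operatorname{Int}(r)\cap\operatorname{Int}(s)$, $\operatorname{Cl}(r\vee s)=\operatorname{Cl}(r)\cup\operatorname{Cl}(s)$, $\operatorname{Int}(r')=X\setminus\operatorname{Cl}(r)$, $\operatorname{Cl}(r')=X\setminus\operatorname{Int}(r)$. *)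

theory Defs
  imports "HOL-Probability.Probability"
begin

text \<open>
  Elements of $L_2(M)$ and of $L_\infty(N)$, and operators on $L_2(M)$, are handled through
  representatives: functions are identified when they agree almost everywhere, and operators
  when their values on every element of $L_2(M)$ agree almost everywhere (\<open>op_eq\<close>).
\<close>

definition L2 :: "'a measure \<Rightarrow> ('a \<Rightarrow> complex) set" where
  "L2 M = {f \<in> borel_measurable M. integrable M (\<lambda>w. (cmod (f w))\<^sup>2)}"

definition l2_inner :: "'a measure \<Rightarrow> ('a \<Rightarrow> complex) \<Rightarrow> ('a \<Rightarrow> complex) \<Rightarrow> complex" where
  "l2_inner M f g = (\<integral>w. f w * cnj (g w) \<partial>M)"

definition l2_norm :: "'a measure \<Rightarrow> ('a \<Rightarrow> complex) \<Rightarrow> real" where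
  "l2_norm M f = sqrt (\<integral>w. (cmod (f w))\<^sup>2 \<partial>M)"

definition separable_L2 :: "'a measure \<Rightarrow> bool" where
  "separable_L2 M \<longleftrightarrow> (\<exists>D. countable D \<and> D \<subseteq> L2 M \<and>
     (\<forall>f\<in>L2 M. \<forall>e>0. \<exists>g\<in>D. l2_norm M (\<lambda>w. f w - g w) < e))"

type_synonym 'a operator = "('a \<Rightarrow> complex) \<Rightarrow> ('a \<Rightarrow> complex)"

definition op_eq :: "'a measure \<Rightarrow> 'a operator \<Rightarrow> 'a operator \<Rightarrow> bool" where
  "op_eq M T U \<longleftrightarrow> (\<forall>f\<in>L2 M. AE w in M. T f w = U f w)"

text \<open>
  Compatibility with almost everywhere equality follows from linearity and boundedness.
\<close>

definition bounded_ops :: "'a measure \<Rightarrow> 'a operator set" where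
  "bounded_ops M = {T.
     (\<forall>f\<in>L2 M. T f \<in> L2 M) \<and>
     (\<forall>f\<in>L2 M. \<forall>g\<in>L2 M. AE w in M. T (\<lambda>v. f v + g v) w = T f w + T g w) \<and>
     (\<forall>f\<in>L2 M. \<forall>c. AE w in M. T (\<lambda>v. c * f v) w = c * T f w) \<and>
     (\<exists>K. \<forall>f\<in>L2 M. l2_norm M (T f) \<le> K * l2_norm M f)}"

definition adjoint_ops :: "'a measure \<Rightarrow> 'a operator \<Rightarrow> 'a operator \<Rightarrow> bool" where
  "adjoint_ops M T U \<longleftrightarrow>
     (\<forall>f\<in>L2 M. \<forall>g\<in>L2 M. l2_inner M (T f) g = l2_inner M f (U g))"

definition strong_op_topology :: "'a measure \<Rightarrow> 'a operator topology" where
  "strong_op_topology M = topology_generated_by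
     {{T \<in> bounded_ops M. l2_norm M (\<lambda>w. T f w - U f w) < e} | U f e.
        U \<in> bounded_ops M \<and> f \<in> L2 M \<and> e > 0}"

definition von_neumann_algebra :: "'a measure \<Rightarrow> 'a operator set \<Rightarrow> bool" where
  "von_neumann_algebra M \<A> \<longleftrightarrow>
     \<A> \<subseteq> bounded_ops M \<and>
     id \<in> \<A> \<and>
     (\<forall>T\<in>\<A>. \<forall>U\<in>\<A>. (\<lambda>f w. T f w + U f w) \<in> \<A>) \<and>
     (\<forall>T\<in>\<A>. \<forall>c. (\<lambda>f w. c * T f w) \<in> \<A>) \<and>
     (\<forall>T\<in>\<A>. \<forall>U\<in>\<A>. T \<circ> U \<in> \<A>) \<and>
     (\<forall>T\<in>\<A>. \<forall>U\<in>bounded_ops M. adjoint_ops M T U \<longrightarrow> U \<in> \<A>) \<and>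
     closedin (strong_op_topology M) \<A>"

definition vn_generated :: "'a measure \<Rightarrow> 'a operator set \<Rightarrow> 'a operator set" where
  "vn_generated M K = \<Inter>{\<A>. von_neumann_algebra M \<A> \<and> K \<subseteq> \<A>}"

definition L_infinity :: "'s measure \<Rightarrow> ('s \<Rightarrow> complex) set" where
  "L_infinity N = {f \<in> borel_measurable N. \<exists>c. AE s in N. cmod (f s) \<le> c}"

text \<open>
  A map \<open>\<alpha>\<close> on representatives that induces a $*$-isomorphism from \<open>\<A>\<close> (modulo \<open>op_eq\<close>) onto
  $L_\infty(N)$ (modulo null functions); the third clause is well-definedness and injectivity.
\<close>

definition vn_isomorphism ::
    "'a measure \<Rightarrow> 'a operator set \<Rightarrow> 's measure \<Rightarrow> ('a operator \<Rightarrow> 's \<Rightarrow> complex) \<Rightarrow> bool" where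
  "vn_isomorphism M \<A> N \<alpha> \<longleftrightarrow>
     (\<forall>T\<in>\<A>. \<alpha> T \<in> L_infinity N) \<and>
     (\<forall>f\<in>L_infinity N. \<exists>T\<in>\<A>. AE s in N. \<alpha> T s = f s) \<and>
     (\<forall>T\<in>\<A>. \<forall>U\<in>\<A>. op_eq M T U \<longleftrightarrow> (AE s in N. \<alpha> T s = \<alpha> U s)) \<and>
     (AE s in N. \<alpha> id s = 1) \<and>
     (\<forall>T\<in>\<A>. \<forall>U\<in>\<A>. AE s in N. \<alpha> (\<lambda>f w. T f w + U f w) s = \<alpha> T s + \<alpha> U s) \<and>
     (\<forall>T\<in>\<A>. \<forall>c. AE s in N. \<alpha> (\<lambda>f w. c * T f w) s = c * \<alpha> T s) \<and>
     (\<forall>T\<in>\<A>. \<forall>U\<in>\<A>. AE s in N. \<alpha> (T \<circ> U) s = \<alpha> T s * \<alpha> U s) \<and>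
     (\<forall>T\<in>\<A>. \<forall>U\<in>\<A>. adjoint_ops M T U \<longrightarrow> (AE s in N. \<alpha> U s = cnj (\<alpha> T s)))"

text \<open>
  A sub-$\sigma$-field is given by its set of events.  The order is inclusion, the meet is
  intersection, and the greatest element is \<open>sets M\<close>.
\<close>

definition subfields :: "'a measure \<Rightarrow> 'a set set set" where
  "subfields M = {x. sigma_algebra (space M) x \<and> x \<subseteq> sets M \<and> null_sets M \<subseteq> x}"

definition sf_zero :: "'a measure \<Rightarrow> 'a set set" where
  "sf_zero M = {E \<in> sets M. measure M E = 0 \<or> measure M E = 1}"

definition sf_join :: "'a measure \<Rightarrow> 'a set set \<Rightarrow> 'a set set \<Rightarrow> 'a set set" where
  "sf_join M x y = sigma_sets (space M) (x \<union> y)"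

text \<open>The null sets are added only so that the supremum of the empty family is \<open>sf_zero M\<close>.\<close>

definition sf_Sup :: "'a measure \<Rightarrow> 'a set set set \<Rightarrow> 'a set set" where
  "sf_Sup M \<X> = sigma_sets (space M) (null_sets M \<union> \<Union>\<X>)"

definition L2_sub :: "'a measure \<Rightarrow> 'a set set \<Rightarrow> ('a \<Rightarrow> complex) set" where
  "L2_sub M x = L2 M \<inter> borel_measurable (sigma (space M) x)"

text \<open>The orthogonal projection onto \<open>L2_sub M x\<close>; it is determined almost everywhere.\<close>

definition sf_proj :: "'a measure \<Rightarrow> 'a set set \<Rightarrow> 'a operator" where
  "sf_proj M x f =
     (SOME g. g \<in> L2_sub M x \<and> (\<forall>k\<in>L2_sub M x. l2_inner M (\<lambda>w. f w - g w) k = 0))"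

definition sf_topology :: "'a measure \<Rightarrow> 'a set set topology" where
  "sf_topology M = pullback_topology (subfields M) (sf_proj M) (strong_op_topology M)"

definition sf_complement :: "'a measure \<Rightarrow> 'a set set set \<Rightarrow> 'a set set \<Rightarrow> 'a set set \<Rightarrow> bool" where
  "sf_complement M C x y \<longleftrightarrow> y \<in> C \<and> x \<inter> y = sf_zero M \<and> sf_join M x y = sets M"

definition noise_boolean_algebra :: "'a measure \<Rightarrow> 'a set set set \<Rightarrow> bool" where
  "noise_boolean_algebra M B \<longleftrightarrow>
     B \<subseteq> subfields M \<and>
     sf_zero M \<in> B \<and> sets M \<in> B \<and>
     (\<forall>x\<in>B. \<forall>y\<in>B. x \<inter> y \<in> B \<and> sf_join M x y \<in> B) \<and>
     (\<forall>x\<in>B. \<forall>y\<in>B. \<forall>z\<in>B. x \<inter> sf_join M y z = sf_join M (x \<inter> y) (x \<inter> z)) \<and>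
     (\<forall>x\<in>B. \<exists>y. sf_complement M B x y \<and> prob_space.indep_set M x y)"

definition noise_completion :: "'a measure \<Rightarrow> 'a set set set \<Rightarrow> 'a set set set" where
  "noise_completion M B =
     {x \<in> sf_topology M closure_of B. \<exists>y. sf_complement M (sf_topology M closure_of B) x y}"

text \<open>
  The measure class is represented by one of its members \<open>N\<close>; everything below depends on \<open>N\<close>
  only through its null sets.  \<open>Sp x\<close> is a choice of the spectral set of \<open>x \<in> B\<close>.
\<close>

definition spectral_space :: "'a measure \<Rightarrow> 'a set set set \<Rightarrow> 's measure \<Rightarrow>
    ('a operator \<Rightarrow> 's \<Rightarrow> complex) \<Rightarrow> ('a set set \<Rightarrow> 's set) \<Rightarrow> bool" where
  "spectral_space M B N \<alpha> Sp \<longleftrightarrow>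
     finite_measure N \<and> separable_L2 N \<and>
     vn_isomorphism M (vn_generated M (sf_proj M ` B)) N \<alpha> \<and>
     (\<forall>x\<in>B. Sp x \<in> sets N \<and> (AE s in N. \<alpha> (sf_proj M x) s = indicator (Sp x) s))"

text \<open>In a pair \<open>r = (G, F)\<close>, \<open>fst r\<close> is $\mathrm{Int}(r)$ and \<open>snd r\<close> is $\mathrm{Cl}(r)$.\<close>

type_synonym 'x regpair = "'x set \<times> 'x set"

definition Reg :: "'x topology \<Rightarrow> 'x regpair set" where
  "Reg X = {(G, F). G \<subseteq> topspace X \<and> F \<subseteq> topspace X \<and>
     G = X interior_of F \<and> F = X closure_of G}"

definition reg_le :: "'x regpair \<Rightarrow> 'x regpair \<Rightarrow> bool" where
  "reg_le r s \<longleftrightarrow> fst r \<subseteq> fst s"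

definition reg_meet :: "'x topology \<Rightarrow> 'x regpair \<Rightarrow> 'x regpair \<Rightarrow> 'x regpair" where
  "reg_meet X r s = (fst r \<inter> fst s, X closure_of (fst r \<inter> fst s))"

definition reg_join :: "'x topology \<Rightarrow> 'x regpair \<Rightarrow> 'x regpair \<Rightarrow> 'x regpair" where
  "reg_join X r s = (X interior_of (snd r \<union> snd s), snd r \<union> snd s)"

definition reg_compl :: "'x topology \<Rightarrow> 'x regpair \<Rightarrow> 'x regpair" where
  "reg_compl X r = (topspace X - snd r, topspace X - fst r)"

definition reg_zero :: "'x regpair" where
  "reg_zero = ({}, {})"

definition reg_one :: "'x topology \<Rightarrow> 'x regpair" where
  "reg_one X = (topspace X, topspace X)"

definition reg_bd :: "'x regpair \<Rightarrow> 'x set" where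
  "reg_bd r = snd r - fst r"

definition reg_subalgebra :: "'x topology \<Rightarrow> 'x regpair set \<Rightarrow> bool" where
  "reg_subalgebra X A \<longleftrightarrow>
     A \<subseteq> Reg X \<and> reg_zero \<in> A \<and> reg_one X \<in> A \<and>
     (\<forall>a\<in>A. reg_compl X a \<in> A) \<and>
     (\<forall>a\<in>A. \<forall>b\<in>A. reg_meet X a b \<in> A \<and> reg_join X a b \<in> A)"

text \<open>Preservation of complements follows, since complements in \<open>B\<close> are unique.\<close>

definition boolean_hom :: "'x topology \<Rightarrow> 'x regpair set \<Rightarrow> 'a measure \<Rightarrow> 'a set set set \<Rightarrow>
    ('x regpair \<Rightarrow> 'a set set) \<Rightarrow> bool" where
  "boolean_hom X A M B h \<longleftrightarrow>
     (\<forall>a\<in>A. h a \<in> B) \<and> h reg_zero = sf_zero M \<and> h (reg_one X) = sets M \<and>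
     (\<forall>a\<in>A. \<forall>b\<in>A. h (reg_meet X a b) = h a \<inter> h b \<and>
        h (reg_join X a b) = sf_join M (h a) (h b))"

definition h_minus :: "'a measure \<Rightarrow> 'x regpair set \<Rightarrow> ('x regpair \<Rightarrow> 'a set set) \<Rightarrow>
    'x regpair \<Rightarrow> 'a set set" where
  "h_minus M A h r = sf_Sup M {h a | a. a \<in> A \<and> snd a \<subseteq> fst r}"

end

theory Submission
  imports Defs
begin

text \<open>
  Since \<open>\<alpha>\<close> maps $Q_x$ to the indicator of $S_x$ and the closure of $B$ consists of projections in
  the generated algebra, a directed family in $B$ has supremum $1$ iff countably many of
  its spectral sets cover $S$ up to a null set.  Apply this to the family of all $h(a \vee b)$ with
  $\mathrm{Cl}(a) \subset \mathrm{Int}(r)$ and $\mathrm{Cl}(b) \subset \mathrm{Int}(r')$, whose supremum is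
  $h_-(r) \vee h_-(r')$ and whose spectral sets are $\{s : F(s) \subset \mathrm{Cl}(a) \cup \mathrm{Cl}(b)\}$.
  Such a cover avoids $\mathrm{Bd}(r)$, which gives (a); for (b), regularity and a countable base let
  the compact set $F(s)$ be covered by countably many sets $\mathrm{Cl}(a) \cup \mathrm{Cl}(b)$ in total.

  Distributivity in $B$ survives in the closure just far enough to show that an element $y$ of
  the closure with $y \wedge h(a) = 0$ lies below $h(a')$.  Any complement of $h_-(r)$ is therefore below
  $w = \bigcap_a h(a')$, which is independent of $h_-(r)$, and this forces it to equal $w$.
\<close>

section \<open>Square integrable functions\<close>

text \<open>Two obstacles shape the proof. First, \<open>F\<close> is tied to
  \<open>Sp (h a)\<close> only outside a null set depending on \<open>a\<close>, while
  \<open>h_minus\<close> is a supremum over a possibly uncountable family. For (a) the cover is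
  thinned out to a countable one by maximizing the measure of spectral sets; for (b) the candidates
  are countable by construction, being joins over finite subsets of the countable base. Second, only
  the meet is visible in the projections: if \<open>Q_u\<close> and \<open>Q_z\<close> commute,
  their product is the projection for \<open>u \<inter> z\<close>, but the join has no such formula.
  So writing \<open>z\<close> as the join of \<open>z \<inter> u\<close> and
  \<open>z \<inter> v\<close> yields no operator identity to carry from \<open>B\<close> to its
  closure. What is carried over is a scalar identity: for \<open>E \<in> u\<close> and
  \<open>D \<in> v\<close>, the function \<open>(1_E - Q_z 1_E) * 1_D\<close> is orthogonal to
  \<open>Q_z 1_C\<close>, and here both projections can be replaced by strong limits. Commutation is
  not extracted from independence: it is read off from \<alpha>, whose target is commutative, and
  independence in the closure is then derived from it.\<close>

lemma L2_measurable [measurable_dest]: "f \<in> L2 M \<Longrightarrow> f \<in> borel_measurable M"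
  by (simp add: L2_def)

lemma L2_integrable_square: "f \<in> L2 M \<Longrightarrow> integrable M (\<lambda>w. (cmod (f w))\<^sup>2)"
  by (simp add: L2_def)

lemma cmod_add_square_le: "(cmod (a + b))\<^sup>2 \<le> 2 * (cmod a)\<^sup>2 + 2 * (cmod b)\<^sup>2"
proof -
  have "(cmod (a + b))\<^sup>2 \<le> (cmod a + cmod b)\<^sup>2"
    by (intro power_mono norm_triangle_ineq) auto
  also have "\<dots> \<le> 2 * (cmod a)\<^sup>2 + 2 * (cmod b)\<^sup>2"
    using sum_squares_bound[of "cmod a" "cmod b"] by (simp add: power2_sum)
  finally show ?thesis .
qed

lemma L2_dominated:
  assumes "f \<in> borel_measurable M" "integrable M v" "AE w in M. (cmod (f w))\<^sup>2 \<le> v w"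
  shows "f \<in> L2 M"
proof -
  have "integrable M (\<lambda>w. (cmod (f w))\<^sup>2)"
    using assms by (intro Bochner_Integration.integrable_bound[OF assms(2)]) auto
  then show ?thesis using assms(1) by (simp add: L2_def)
qed

lemma L2_add:
  assumes "f \<in> L2 M" "g \<in> L2 M"
  shows "(\<lambda>w. f w + g w) \<in> L2 M"
proof (rule L2_dominated)
  show "(\<lambda>w. f w + g w) \<in> borel_measurable M"
    using assms by measurable
  show "integrable M (\<lambda>w. 2 * (cmod (f w))\<^sup>2 + 2 * (cmod (g w))\<^sup>2)"
    using assms by (intro Bochner_Integration.integrable_add integrable_mult_right L2_integrable_square)
qed (simp add: cmod_add_square_le)

lemma L2_scale:
  assumes "f \<in> L2 M"
  shows "(\<lambda>w. c * f w) \<in> L2 M"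
proof (rule L2_dominated)
  show "(\<lambda>w. c * f w) \<in> borel_measurable M"
    using assms by measurable
  show "integrable M (\<lambda>w. (cmod c)\<^sup>2 * (cmod (f w))\<^sup>2)"
    using assms by (intro integrable_mult_right L2_integrable_square)
qed (simp add: norm_mult power_mult_distrib)

lemma L2_diff: "f \<in> L2 M \<Longrightarrow> g \<in> L2 M \<Longrightarrow> (\<lambda>w. f w - g w) \<in> L2 M"
  using L2_add[OF _ L2_scale[of g M "-1"], of f] by simp

lemma L2_mult_indicator:
  assumes "f \<in> L2 M" "D \<in> sets M"
  shows "(\<lambda>w. f w * indicator D w) \<in> L2 M"
proof (rule L2_dominated)
  show "(\<lambda>w. f w * indicator D w) \<in> borel_measurable M"
    using assms by measurable
  show "integrable M (\<lambda>w. (cmod (f w))\<^sup>2)"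
    using assms(1) by (rule L2_integrable_square)
qed (auto simp: indicator_def)

lemma L2_cong_AE:
  "f \<in> L2 M \<Longrightarrow> g \<in> borel_measurable M \<Longrightarrow> AE w in M. f w = g w \<Longrightarrow> g \<in> L2 M"
  by (rule L2_dominated[OF _ L2_integrable_square]) auto

lemma integrable_L2_mult:
  assumes "f \<in> L2 M" "g \<in> L2 M"
  shows "integrable M (\<lambda>w. f w * g w)"
proof (rule Bochner_Integration.integrable_bound)
  show "integrable M (\<lambda>w. (cmod (f w))\<^sup>2 + (cmod (g w))\<^sup>2)"
    using assms by (intro Bochner_Integration.integrable_add L2_integrable_square)
  show "(\<lambda>w. f w * g w) \<in> borel_measurable M"
    using assms by measurable
  have "cmod a * cmod b \<le> (cmod a)\<^sup>2 + (cmod b)\<^sup>2" for a b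
  proof -
    have "2 * (cmod a * cmod b) \<le> (cmod a)\<^sup>2 + (cmod b)\<^sup>2"
      using sum_squares_bound[of "cmod a" "cmod b"] by (simp add: mult.assoc)
    moreover have "0 \<le> cmod a * cmod b" by simp
    ultimately show ?thesis by linarith
  qed
  then show "AE w in M. norm (f w * g w) \<le> norm ((cmod (f w))\<^sup>2 + (cmod (g w))\<^sup>2)"
    by (simp add: norm_mult)
qed

lemma borel_measurable_cnj [measurable]: "cnj \<in> borel_measurable borel"
  by (intro borel_measurable_continuous_onI continuous_intros)

lemma L2_cnj: "f \<in> L2 M \<Longrightarrow> (\<lambda>w. cnj (f w)) \<in> L2 M"
  by (auto simp: L2_def)

lemma integrable_L2_inner:
  "f \<in> L2 M \<Longrightarrow> g \<in> L2 M \<Longrightarrow> integrable M (\<lambda>w. f w * cnj (g w))"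
  by (intro integrable_L2_mult L2_cnj)

lemma l2_inner_add_left:
  "f \<in> L2 M \<Longrightarrow> g \<in> L2 M \<Longrightarrow> k \<in> L2 M \<Longrightarrow>
    l2_inner M (\<lambda>w. f w + g w) k = l2_inner M f k + l2_inner M g k"
  by (simp add: l2_inner_def algebra_simps integrable_L2_inner)

lemma l2_inner_diff_left:
  "f \<in> L2 M \<Longrightarrow> g \<in> L2 M \<Longrightarrow> k \<in> L2 M \<Longrightarrow>
    l2_inner M (\<lambda>w. f w - g w) k = l2_inner M f k - l2_inner M g k"
  by (simp add: l2_inner_def algebra_simps integrable_L2_inner)

lemma l2_inner_scale_left: "l2_inner M (\<lambda>w. c * f w) k = c * l2_inner M f k"
  by (simp add: l2_inner_def mult.assoc)

lemma l2_inner_commute: "l2_inner M f g = cnj (l2_inner M g f)"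
proof -
  have "cnj (l2_inner M g f) = (\<integral>w. cnj (g w * cnj (f w)) \<partial>M)"
    unfolding l2_inner_def by (simp del: complex_cnj_mult)
  then show ?thesis by (simp add: l2_inner_def mult.commute)
qed

lemma l2_inner_add_right:
  "f \<in> L2 M \<Longrightarrow> g \<in> L2 M \<Longrightarrow> k \<in> L2 M \<Longrightarrow>
    l2_inner M k (\<lambda>w. f w + g w) = l2_inner M k f + l2_inner M k g"
  by (simp add: l2_inner_def algebra_simps integrable_L2_inner)

lemma l2_inner_diff_right:
  "f \<in> L2 M \<Longrightarrow> g \<in> L2 M \<Longrightarrow> k \<in> L2 M \<Longrightarrow>
    l2_inner M k (\<lambda>w. f w - g w) = l2_inner M k f - l2_inner M k g"
  by (simp add: l2_inner_def algebra_simps integrable_L2_inner)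

lemma l2_inner_scale_right: "l2_inner M k (\<lambda>w. c * f w) = cnj c * l2_inner M k f"
  by (simp add: l2_inner_def algebra_simps)

lemma l2_inner_self: "l2_inner M f f = of_real ((l2_norm M f)\<^sup>2)"
proof -
  have "l2_inner M f f = (\<integral>w. complex_of_real ((cmod (f w))\<^sup>2) \<partial>M)"
    unfolding l2_inner_def by (simp add: complex_norm_square del: of_real_power)
  then show ?thesis by (simp add: l2_norm_def del: of_real_power)
qed

lemma l2_norm_nonneg [simp]: "0 \<le> l2_norm M f"
  by (simp add: l2_norm_def)

lemma l2_norm_cong_AE:
  "f \<in> borel_measurable M \<Longrightarrow> g \<in> borel_measurable M \<Longrightarrow> AE w in M. f w = g w \<Longrightarrow>
    l2_norm M f = l2_norm M g"
  unfolding l2_norm_def by (intro arg_cong[of _ _ sqrt] integral_cong_AE) auto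

lemma l2_inner_cong_AE:
  assumes "f \<in> borel_measurable M" "g \<in> borel_measurable M" "AE w in M. f w = g w"
    "k \<in> borel_measurable M"
  shows "l2_inner M f k = l2_inner M g k"
  using assms unfolding l2_inner_def by (intro integral_cong_AE) auto

lemma l2_norm_scale: "l2_norm M (\<lambda>w. c * f w) = cmod c * l2_norm M f"
  by (simp add: l2_norm_def norm_mult power_mult_distrib real_sqrt_mult)

lemma l2_norm_minus_commute: "l2_norm M (\<lambda>w. f w - g w) = l2_norm M (\<lambda>w. g w - f w)"
  by (simp add: l2_norm_def norm_minus_commute)

lemma l2_norm_mono:
  assumes "f \<in> borel_measurable M" "g \<in> L2 M" "AE w in M. cmod (f w) \<le> cmod (g w)"
  shows "l2_norm M f \<le> l2_norm M g"
proof -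
  have "AE w in M. (cmod (f w))\<^sup>2 \<le> (cmod (g w))\<^sup>2"
    using assms(3) by eventually_elim (simp add: power_mono)
  moreover from this have "f \<in> L2 M"
    by (intro L2_dominated[OF assms(1) L2_integrable_square[OF assms(2)]])
  ultimately show ?thesis
    unfolding l2_norm_def using assms
    by (intro real_sqrt_le_mono integral_mono_AE L2_integrable_square)
qed

lemma l2_norm_eq_0_iff:
  "f \<in> L2 M \<Longrightarrow> l2_norm M f = 0 \<longleftrightarrow> (AE w in M. f w = 0)"
  unfolding l2_norm_def
  by (simp add: integral_nonneg_eq_0_iff_AE L2_integrable_square)

lemma l2_Cauchy_Schwarz:
  assumes "f \<in> L2 M" "g \<in> L2 M"
  shows "cmod (l2_inner M f g) \<le> l2_norm M f * l2_norm M g"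
proof -
  define c where "c = l2_inner M f g"
  have *: "0 \<le> (l2_norm M f)\<^sup>2 - 2 * t * (cmod c)\<^sup>2 + t\<^sup>2 * (cmod c)\<^sup>2 * (l2_norm M g)\<^sup>2" for t :: real
  proof -
    \<comment> \<open>Scaling by \<open>t * c\<close> with \<open>t\<close> real makes both cross
      terms equal to the real number \<open>t * |c|^2\<close>, so a real quadratic in
      \<open>t\<close> is enough.\<close>
    let ?d = "complex_of_real t * c"
    have g: "(\<lambda>w. ?d * g w) \<in> L2 M" using assms(2) by (rule L2_scale)
    have "complex_of_real ((l2_norm M (\<lambda>w. f w - ?d * g w))\<^sup>2)
        = l2_inner M f f - l2_inner M f (\<lambda>w. ?d * g w) - l2_inner M (\<lambda>w. ?d * g w) f
          + l2_inner M (\<lambda>w. ?d * g w) (\<lambda>w. ?d * g w)"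
      using assms g L2_diff[OF assms(1) g]
      by (simp add: l2_inner_self[symmetric] l2_inner_diff_left l2_inner_diff_right
          algebra_simps del: of_real_power)
    also have "\<dots> = of_real ((l2_norm M f)\<^sup>2) - cnj ?d * c - ?d * cnj c
        + ?d * cnj ?d * of_real ((l2_norm M g)\<^sup>2)"
      using l2_inner_commute[of M g f]
      by (simp add: l2_inner_scale_left l2_inner_scale_right l2_inner_self c_def mult.assoc)
    also have "\<dots> = of_real ((l2_norm M f)\<^sup>2 - 2 * t * (cmod c)\<^sup>2
        + t\<^sup>2 * (cmod c)\<^sup>2 * (l2_norm M g)\<^sup>2)"
    proof -
      have "c * cnj c = of_real ((cmod c)\<^sup>2)" by (simp add: complex_norm_square del: of_real_power)
      moreover have "cnj ?d * c = of_real t * (c * cnj c)" "?d * cnj c = of_real t * (c * cnj c)"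
        "?d * cnj ?d = of_real (t\<^sup>2) * (c * cnj c)" by (simp_all add: power2_eq_square)
      ultimately show ?thesis by simp
    qed
    finally have "(l2_norm M (\<lambda>w. f w - ?d * g w))\<^sup>2 = (l2_norm M f)\<^sup>2 - 2 * t * (cmod c)\<^sup>2
        + t\<^sup>2 * (cmod c)\<^sup>2 * (l2_norm M g)\<^sup>2"
      using of_real_eq_iff by blast
    then show ?thesis by (metis zero_le_power2)
  qed
  have "(cmod c)\<^sup>2 \<le> (l2_norm M f * l2_norm M g)\<^sup>2"
  proof (cases "l2_norm M g = 0")
    case True
    then have "AE w in M. g w = 0" using assms(2) by (simp add: l2_norm_eq_0_iff)
    then have "c = 0" unfolding c_def l2_inner_def
      by (intro integral_eq_zero_AE) auto
    then show ?thesis by simp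
  next
    case False
    let ?n = "(l2_norm M g)\<^sup>2"
    from False have pos: "0 < ?n" by simp
    \<comment> \<open>The value \<open>t = 1 / ?n\<close> minimizes the quadratic, and the outer
      factor \<open>?n\<close> clears the denominator.\<close>
    have "0 \<le> ?n * ((l2_norm M f)\<^sup>2 - 2 * (1 / ?n) * (cmod c)\<^sup>2 + (1 / ?n)\<^sup>2 * (cmod c)\<^sup>2 * ?n)"
      using *[of "1 / ?n"] pos by (intro mult_nonneg_nonneg) auto
    also have "\<dots> = (l2_norm M f)\<^sup>2 * ?n - (cmod c)\<^sup>2"
      using False by (simp add: field_simps power2_eq_square)
    finally show ?thesis by (simp add: power_mult_distrib)
  qed
  then show ?thesis unfolding c_def by (rule power2_le_imp_le) simp
qed

lemma l2_norm_add_square: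
  assumes "f \<in> L2 M" "g \<in> L2 M"
  shows "(l2_norm M (\<lambda>w. f w + g w))\<^sup>2
    = (l2_norm M f)\<^sup>2 + 2 * Re (l2_inner M f g) + (l2_norm M g)\<^sup>2"
proof -
  have "complex_of_real ((l2_norm M (\<lambda>w. f w + g w))\<^sup>2)
      = l2_inner M f f + (l2_inner M f g + cnj (l2_inner M f g)) + l2_inner M g g"
    using assms l2_inner_commute[of M g f] L2_add[OF assms]
    by (simp add: l2_inner_self[symmetric] l2_inner_add_left l2_inner_add_right
        algebra_simps del: of_real_power)
  also have "\<dots> = of_real ((l2_norm M f)\<^sup>2 + 2 * Re (l2_inner M f g) + (l2_norm M g)\<^sup>2)"
    by (simp add: l2_inner_self complex_add_cnj)
  finally show ?thesis using of_real_eq_iff by blast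
qed

lemma l2_norm_triangle:
  assumes "f \<in> L2 M" "g \<in> L2 M"
  shows "l2_norm M (\<lambda>w. f w + g w) \<le> l2_norm M f + l2_norm M g"
proof (rule power2_le_imp_le)
  have "Re (l2_inner M f g) \<le> l2_norm M f * l2_norm M g"
    using complex_Re_le_cmod l2_Cauchy_Schwarz[OF assms] by (rule order_trans)
  then show "(l2_norm M (\<lambda>w. f w + g w))\<^sup>2 \<le> (l2_norm M f + l2_norm M g)\<^sup>2"
    by (simp add: l2_norm_add_square[OF assms] power2_sum)
qed simp

lemma l2_norm_triangle_diff:
  assumes "f \<in> L2 M" "g \<in> L2 M" "k \<in> L2 M"
  shows "l2_norm M (\<lambda>w. f w - k w) \<le> l2_norm M (\<lambda>w. f w - g w) + l2_norm M (\<lambda>w. g w - k w)"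
  using l2_norm_triangle[OF L2_diff[OF assms(1,2)] L2_diff[OF assms(2,3)]] by simp

lemma (in finite_measure) L2_const: "(\<lambda>w. c) \<in> L2 M"
  by (simp add: L2_def)

lemma (in finite_measure) L2_indicator: "C \<in> sets M \<Longrightarrow> indicator C \<in> L2 M"
  using L2_mult_indicator[OF L2_const[of 1], of C] by simp

lemma (in prob_space) l2_norm_indicator_le: "C \<in> sets M \<Longrightarrow> l2_norm M (indicator C) \<le> 1"
proof -
  assume C: "C \<in> sets M"
  have "l2_norm M (indicator C) \<le> l2_norm M (\<lambda>w. 1)"
    using C by (intro l2_norm_mono L2_const) (auto simp: indicator_def)
  then show ?thesis by (simp add: l2_norm_def prob_space)
qed

text \<open>The square of \<open>|s i - f|\<close> is dominated by \<open>2 |v|^2 + 2 |f|^2\<close>.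
  The density principle below uses this for partial sums of disjoint indicators and for simple
  approximations.\<close>

lemma l2_dominated_convergence:
  assumes f: "f \<in> L2 M" and s: "\<And>i. s i \<in> borel_measurable M"
    and lim: "AE w in M. (\<lambda>i. s i w) \<longlonglongrightarrow> f w"
    and v: "v \<in> L2 M" and dom: "\<And>i. AE w in M. cmod (s i w) \<le> cmod (v w)"
  shows "(\<lambda>i. l2_norm M (\<lambda>w. s i w - f w)) \<longlonglongrightarrow> 0"
proof -
  have "(\<lambda>i. \<integral>w. (cmod (s i w - f w))\<^sup>2 \<partial>M) \<longlonglongrightarrow> (\<integral>w. 0 \<partial>M)"
  proof (rule integral_dominated_convergence)
    show "integrable M (\<lambda>w. 2 * (cmod (v w))\<^sup>2 + 2 * (cmod (f w))\<^sup>2)"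
      using f v by (intro Bochner_Integration.integrable_add integrable_mult_right L2_integrable_square)
    show "AE w in M. (\<lambda>i. (cmod (s i w - f w))\<^sup>2) \<longlonglongrightarrow> 0"
      using lim
    proof eventually_elim
      case (elim w)
      have "(\<lambda>i. (cmod (s i w - f w))\<^sup>2) \<longlonglongrightarrow> (cmod (f w - f w))\<^sup>2"
        by (intro tendsto_intros elim)
      then show ?case by simp
    qed
    show "AE w in M. norm ((cmod (s i w - f w))\<^sup>2) \<le> 2 * (cmod (v w))\<^sup>2 + 2 * (cmod (f w))\<^sup>2" for i
      using dom[of i]
    proof eventually_elim
      case (elim w)
      have "(cmod (s i w - f w))\<^sup>2 \<le> 2 * (cmod (s i w))\<^sup>2 + 2 * (cmod (f w))\<^sup>2"
        using cmod_add_square_le[of "s i w" "- f w"] by simp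
      moreover have "(cmod (s i w))\<^sup>2 \<le> (cmod (v w))\<^sup>2"
        using elim by (simp add: power_mono)
      ultimately show ?case unfolding real_norm_def abs_power2 by linarith
    qed
  qed (use f s in measurable)
  then have "(\<lambda>i. sqrt (\<integral>w. (cmod (s i w - f w))\<^sup>2 \<partial>M)) \<longlonglongrightarrow> sqrt 0"
    by (intro tendsto_real_sqrt) simp
  then show ?thesis by (simp add: l2_norm_def)
qed

section \<open>Sub-\<open>\<sigma>\<close>-fields and a density principle\<close>

lemma subfieldsD:
  assumes "x \<in> subfields M"
  shows "sigma_algebra (space M) x" "x \<subseteq> sets M" "null_sets M \<subseteq> x"
    "sets (sigma (space M) x) = x" "space (sigma (space M) x) = space M"
    "subalgebra M (sigma (space M) x)" "{} \<in> x" "space M \<in> x"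
proof -
  show *: "sigma_algebra (space M) x" "x \<subseteq> sets M" "null_sets M \<subseteq> x"
    using assms by (auto simp: subfields_def)
  interpret sigma_algebra "space M" x by fact
  show s: "sets (sigma (space M) x) = x" "space (sigma (space M) x) = space M"
    by (simp_all add: sets_measure_of_eq space_measure_of_conv)
  show "subalgebra M (sigma (space M) x)"
    using s *(2) by (simp add: subalgebra_def)
  show "{} \<in> x" "space M \<in> x" by auto
qed

lemma subfields_sets: "sets M \<in> subfields M"
  by (auto simp: subfields_def sets.sigma_algebra_axioms)

lemma sigma_sets_in_subfields:
  assumes "G \<subseteq> sets M" "null_sets M \<subseteq> sigma_sets (space M) G"
  shows "sigma_sets (space M) G \<in> subfields M"
  using assms sets.sigma_sets_subset[OF assms(1)] sets.space_closed[of M]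
  by (simp add: subfields_def sigma_algebra_sigma_sets)

lemma L2_subD:
  assumes "f \<in> L2_sub M x"
  shows "f \<in> L2 M" "f \<in> borel_measurable (sigma (space M) x)"
  using assms by (auto simp: L2_sub_def)

lemma L2_sub_add: "f \<in> L2_sub M x \<Longrightarrow> g \<in> L2_sub M x \<Longrightarrow> (\<lambda>w. f w + g w) \<in> L2_sub M x"
  by (auto simp: L2_sub_def L2_add)

lemma L2_sub_diff: "f \<in> L2_sub M x \<Longrightarrow> g \<in> L2_sub M x \<Longrightarrow> (\<lambda>w. f w - g w) \<in> L2_sub M x"
  by (auto simp: L2_sub_def L2_diff)

lemma L2_sub_scale: "f \<in> L2_sub M x \<Longrightarrow> (\<lambda>w. c * f w) \<in> L2_sub M x"
  by (auto simp: L2_sub_def L2_scale)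

lemma measurable_subfield_iff:
  assumes "x \<in> subfields M"
  shows "f \<in> borel_measurable (sigma (space M) x) \<longleftrightarrow>
    (\<forall>U\<in>sets borel. f -` U \<inter> space M \<in> x)"
  by (simp add: measurable_def subfieldsD[OF assms])

lemma L2_sub_mono:
  assumes "x \<in> subfields M" "y \<in> subfields M" "x \<subseteq> y"
  shows "L2_sub M x \<subseteq> L2_sub M y"
  using assms by (auto simp: L2_sub_def measurable_subfield_iff) blast

lemma L2_sub_sets [simp]: "L2_sub M (sets M) = L2 M"
  by (auto simp: L2_sub_def L2_def measurable_def space_measure_of_conv)

lemma (in finite_measure) L2_sub_indicator:
  assumes "x \<in> subfields M" "C \<in> x"
  shows "indicator C \<in> L2_sub M x"
  using assms subfieldsD[OF assms(1)] L2_indicator[of C]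
  by (auto simp: L2_sub_def intro!: borel_measurable_indicator)

lemma (in finite_measure) L2_sub_const: "x \<in> subfields M \<Longrightarrow> (\<lambda>w. c) \<in> L2_sub M x"
  by (auto simp: L2_sub_def L2_const)

text \<open>Members of \<open>subfields M\<close> contain all null sets, so an event may be altered
  on the null sets \<open>S - T\<close> and \<open>T - S\<close>. This is what makes measurability
  in a subfield independent of the chosen representative.\<close>

lemma null_modification_in_subfield:
  assumes x: "x \<in> subfields M" and S: "S \<in> x" and T: "T \<in> sets M"
    and AE: "AE w in M. w \<in> S \<longleftrightarrow> w \<in> T"
  shows "T \<in> x"
proof -
  note xD = subfieldsD[OF x]
  interpret sigma_algebra "space M" x by (rule xD)
  have SM: "S \<in> sets M" using S xD by auto
  have "AE w in M. w \<notin> S - T" "AE w in M. w \<notin> T - S"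
    using AE by (eventually_elim, blast)+
  then have "S - T \<in> null_sets M" "T - S \<in> null_sets M"
    using SM T by (simp_all add: AE_iff_null_sets)
  then have "S - T \<in> x" "T - S \<in> x" using xD by auto
  moreover have "T = (S - (S - T)) \<union> (T - S)" by auto
  ultimately show ?thesis using S by (metis Diff Un)
qed

lemma L2_sub_cong_AE:
  assumes x: "x \<in> subfields M" and f: "f \<in> L2_sub M x" and g: "g \<in> borel_measurable M"
    and AE: "AE w in M. f w = g w"
  shows "g \<in> L2_sub M x"
proof -
  have "g -` U \<inter> space M \<in> x" if U: "U \<in> sets borel" for U
  proof (rule null_modification_in_subfield[OF x])
    show "f -` U \<inter> space M \<in> x"
      using L2_subD(2)[OF f] U by (simp add: measurable_subfield_iff[OF x])
    show "g -` U \<inter> space M \<in> sets M" using g U by (rule measurable_sets)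
    show "AE w in M. w \<in> f -` U \<inter> space M \<longleftrightarrow> w \<in> g -` U \<inter> space M"
      using AE by eventually_elim auto
  qed
  then have "g \<in> borel_measurable (sigma (space M) x)"
    by (simp add: measurable_subfield_iff[OF x])
  then show ?thesis
    using L2_cong_AE[OF L2_subD(1)[OF f] g AE] by (simp add: L2_sub_def)
qed

text \<open>The passage from square integrable functions back to events: \<open>C\<close> is
  recovered as the set where its indicator equals 1. Inclusions between fields are deduced from
  projections in this way.\<close>

lemma (in finite_measure) event_in_subfield:
  assumes x: "x \<in> subfields M" and C: "C \<in> sets M" and g: "g \<in> L2_sub M x"
    and AE: "AE w in M. g w = indicator C w"
  shows "C \<in> x"
proof -
  have "indicator C \<in> L2_sub M x"
    using C AE by (intro L2_sub_cong_AE[OF x g]) auto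
  then have "(indicator C :: _ \<Rightarrow> complex) -` {1} \<inter> space M \<in> x"
    by (auto dest: L2_subD simp: measurable_subfield_iff[OF x])
  moreover have "(indicator C :: _ \<Rightarrow> complex) -` {1} \<inter> space M = C"
    using sets.sets_into_space[OF C] by (auto simp: indicator_def)
  ultimately show ?thesis by simp
qed

text \<open>The span of 1 and of the indicators of an intersection-stable generator is dense in
  \<open>L2_sub M z\<close>; this is phrased as an induction. Dynkin's argument reaches all
  indicators, and dominated simple functions do the rest. The constant 1 is asked for separately
  because \<open>G\<close> need not contain the whole space.\<close>

lemma (in finite_measure) L2_sub_closed_subspace_induct:
  assumes z: "z \<in> subfields M" "z = sigma_sets (space M) G"
    and G: "Int_stable G" "G \<subseteq> Pow (space M)"
    and f: "f \<in> L2_sub M z"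
    and V_const: "V (\<lambda>_. 1)"
    and V_indicator: "\<And>C. C \<in> G \<Longrightarrow> V (indicator C)"
    and V_add: "\<And>f g. f \<in> L2_sub M z \<Longrightarrow> g \<in> L2_sub M z \<Longrightarrow> V f \<Longrightarrow> V g \<Longrightarrow> V (\<lambda>w. f w + g w)"
    and V_scale: "\<And>c f. f \<in> L2_sub M z \<Longrightarrow> V f \<Longrightarrow> V (\<lambda>w. c * f w)"
    and V_limit: "\<And>f s. f \<in> L2_sub M z \<Longrightarrow> (\<And>i::nat. s i \<in> L2_sub M z) \<Longrightarrow> (\<And>i. V (s i)) \<Longrightarrow>
       (\<lambda>i. l2_norm M (\<lambda>w. s i w - f w)) \<longlonglongrightarrow> 0 \<Longrightarrow> V f"
  shows "V f"
proof -
  note zD = subfieldsD[OF z(1)]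
  have sub: "subset_class (space M) G" using G by (simp add: subset_class_def)
  \<comment> \<open>\<open>V\<close> is a predicate on functions on the whole type and could depend
    on values outside \<open>space M\<close>; the limit clause for a constant sequence rules this
    out.\<close>
  have V_cong: "V g" if "f \<in> L2_sub M z" "g \<in> L2_sub M z" "V f" "\<And>w. w \<in> space M \<Longrightarrow> f w = g w" for f g
  proof (rule V_limit[of g "\<lambda>_. f"])
    have "l2_norm M (\<lambda>w. f w - g w) = l2_norm M (\<lambda>w. 0)"
      using that L2_measurable[OF L2_subD(1)]
      by (intro l2_norm_cong_AE borel_measurable_diff) (auto intro!: AE_I2)
    then show "(\<lambda>i. l2_norm M (\<lambda>w. f w - g w)) \<longlonglongrightarrow> 0"
      by (simp add: l2_norm_def)
  qed (use that in auto)
  have V0: "V (\<lambda>w. 0)" using V_scale[of "\<lambda>_. 1" 0] V_const L2_sub_const[OF z(1)] by simp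
  have V_sum: "V (\<lambda>w. \<Sum>i\<in>I. g i w) \<and> (\<lambda>w. \<Sum>i\<in>I. g i w) \<in> L2_sub M z"
    if "finite I" "\<And>i. i \<in> I \<Longrightarrow> V (g i)" "\<And>i. i \<in> I \<Longrightarrow> g i \<in> L2_sub M z" for I :: "'i set" and g
    using that by (induction I) (auto simp: V0 L2_sub_const[OF z(1)] intro!: V_add L2_sub_add)
  have ind: "V (indicator C)" if C: "C \<in> z" for C
    using G C[unfolded z(2)]
  proof (induction rule: sigma_sets_induct_disjoint)
    case (basic A) then show ?case by (rule V_indicator)
  next
    case empty show ?case using V0 by (simp add: indicator_def)
  next
    case (compl A)
    have A: "A \<in> z" "space M - A \<in> z"
      using compl(1) z(2) by (auto intro: sigma_sets.Compl)
    have i: "indicator A \<in> L2_sub M z" using A(1) by (rule L2_sub_indicator[OF z(1)])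
    \<comment> \<open>This function agrees with the indicator of the complement on
      \<open>space M\<close> only, hence the appeal to \<open>V_cong\<close>.\<close>
    have "V (\<lambda>w. 1 + (- 1) * indicator A w)"
      using i compl by (intro V_add V_scale V_const L2_sub_const[OF z(1)] L2_sub_scale)
    then show ?case
    proof (rule V_cong[rotated 2])
      show "(\<lambda>w. 1 + (- 1) * indicator A w) \<in> L2_sub M z"
        using i by (intro L2_sub_add L2_sub_const[OF z(1)] L2_sub_scale)
      show "indicator (space M - A) \<in> L2_sub M z"
        using A(2) by (rule L2_sub_indicator[OF z(1)])
    qed (auto simp: indicator_def)
  next
    case (union A)
    have A: "A i \<in> z" for i using union(2) z(2) by auto
    have U: "(\<Union>i. A i) \<in> z" using union(2) z(2) by (auto intro!: sigma_sets.Union)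
    have i: "indicator (A i) \<in> L2_sub M z" for i using A by (rule L2_sub_indicator[OF z(1)])
    have Ui: "indicator (\<Union>i. A i) \<in> L2_sub M z" using U by (rule L2_sub_indicator[OF z(1)])
    let ?s = "\<lambda>n w. \<Sum>i\<in>{..<n}. (indicator (A i) w :: complex)"
    have s: "V (?s n) \<and> ?s n \<in> L2_sub M z" for n
      by (intro V_sum) (auto simp: union i)
    have eq: "?s n w = indicator (\<Union>i<n. A i) w" for n w
      using union(1) by (intro indicator_UN_disjoint[symmetric])
        (auto simp: disjoint_family_on_def)
    show ?case
    proof (rule V_limit[OF Ui])
      show "(\<lambda>n. l2_norm M (\<lambda>w. ?s n w - indicator (\<Union>i. A i) w)) \<longlonglongrightarrow> 0"
      proof (rule l2_dominated_convergence)
        show "indicator (\<Union>i. A i) \<in> L2 M" "indicator (\<Union>i. A i) \<in> L2 M"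
          using Ui by (auto dest: L2_subD)
        show "?s n \<in> borel_measurable M" for n using s by (blast dest: L2_subD L2_measurable)
        show "AE w in M. (\<lambda>n. ?s n w) \<longlonglongrightarrow> indicator (\<Union>i. A i) w"
          unfolding eq by (intro AE_I2 LIMSEQ_indicator_UN)
        show "AE w in M. cmod (?s n w) \<le> cmod (indicator (\<Union>i. A i) w)" for n
          unfolding eq by (auto simp: indicator_def)
      qed
    qed (use s in auto)
  qed
  have fz: "f \<in> borel_measurable (sigma (space M) z)" and f2: "f \<in> L2 M" using f by (auto dest: L2_subD)
  \<comment> \<open>The factor 2 is that of the approximation theorem with base point 0; it makes
    \<open>2 * f\<close> the dominating function.\<close>
  obtain s where s: "\<And>i. simple_function (sigma (space M) z) (s i)"
    "\<And>w. w \<in> space M \<Longrightarrow> (\<lambda>i. s i w) \<longlonglongrightarrow> f w"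
    "\<And>i w. w \<in> space M \<Longrightarrow> cmod (s i w) \<le> 2 * cmod (f w)"
    using borel_measurable_implies_sequence_metric[OF fz, of 0] zD(5) by simp metis
  have sM: "s i \<in> borel_measurable M" for i
    using borel_measurable_simple_function[OF s(1)] zD(6) by (rule measurable_from_subalg[rotated])
  have v: "(\<lambda>w. 2 * f w) \<in> L2 M" using f2 by (rule L2_scale)
  have dom: "AE w in M. cmod (s i w) \<le> cmod (2 * f w)" for i
    using s(3) by (intro AE_I2) (simp add: norm_mult)
  have sL: "s i \<in> L2_sub M z" for i
  proof -
    have "AE w in M. (cmod (s i w))\<^sup>2 \<le> (cmod (2 * f w))\<^sup>2"
      using dom[of i] by eventually_elim (intro power_mono norm_ge_zero)
    then have "s i \<in> L2 M" by (rule L2_dominated[OF sM L2_integrable_square[OF v]])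
    then show ?thesis using borel_measurable_simple_function[OF s(1)] by (simp add: L2_sub_def)
  qed
  have Vs: "V (s i)" for i
  proof -
    let ?I = "s i ` space M" let ?C = "\<lambda>c. s i -` {c} \<inter> space M"
    let ?t = "\<lambda>w. \<Sum>c\<in>?I. c * indicator (?C c) w"
    have fin: "finite ?I" and C: "\<And>c. c \<in> ?I \<Longrightarrow> ?C c \<in> z"
      using s(1)[of i] zD by (auto simp: simple_function_def)
    have t: "V ?t \<and> ?t \<in> L2_sub M z"
      using fin C by (intro V_sum V_scale L2_sub_scale L2_sub_indicator[OF z(1)] ind)
    show ?thesis
    proof (rule V_cong)
      show "?t w = s i w" if w: "w \<in> space M" for w
      proof -
        have "?t w = (\<Sum>c\<in>?I. if c = s i w then c else 0)"
          using w by (intro sum.cong) (auto simp: indicator_def)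
        then show ?thesis using fin w by simp
      qed
    qed (use t sL in auto)
  qed
  show "V f"
    using f sL Vs l2_dominated_convergence[OF f2 sM AE_I2[OF s(2)] v dom]
    by (rule V_limit)
qed

section \<open>Lattice operations on sub-sigma-fields and their intersection-stable
  generators\<close>

lemma subfields_Int: "x \<in> subfields M \<Longrightarrow> y \<in> subfields M \<Longrightarrow> x \<inter> y \<in> subfields M"
  by (auto simp: subfields_def sigma_algebra_iff2)

lemma sf_join_subfields:
  assumes "x \<in> subfields M" "y \<in> subfields M"
  shows "sf_join M x y \<in> subfields M"
  unfolding sf_join_def using subfieldsD[OF assms(1)] subfieldsD[OF assms(2)]
  by (intro sigma_sets_in_subfields) (auto intro: sigma_sets.Basic)

lemma sf_join_upper: "x \<subseteq> sf_join M x y" "y \<subseteq> sf_join M x y"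
  by (auto simp: sf_join_def intro: sigma_sets.Basic)

lemma sf_join_least:
  assumes "z \<in> subfields M" "x \<subseteq> z" "y \<subseteq> z"
  shows "sf_join M x y \<subseteq> z"
  unfolding sf_join_def using subfieldsD(1)[OF assms(1)] assms
  by (intro sigma_algebra.sigma_sets_subset) auto

lemma sf_join_commute: "sf_join M x y = sf_join M y x"
  by (simp add: sf_join_def Un_commute)

lemma sf_Sup_subfields:
  assumes "\<And>x. x \<in> \<X> \<Longrightarrow> x \<in> subfields M"
  shows "sf_Sup M \<X> \<in> subfields M"
  unfolding sf_Sup_def using assms subfieldsD(2)
  by (intro sigma_sets_in_subfields) (auto intro: sigma_sets.Basic)

lemma sf_Sup_upper: "x \<in> \<X> \<Longrightarrow> x \<subseteq> sf_Sup M \<X>"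
  by (auto simp: sf_Sup_def intro: sigma_sets.Basic)

lemma sf_Sup_least:
  assumes "z \<in> subfields M" "\<And>x. x \<in> \<X> \<Longrightarrow> x \<subseteq> z"
  shows "sf_Sup M \<X> \<subseteq> z"
  unfolding sf_Sup_def using subfieldsD(1,3)[OF assms(1)] assms(2)
  by (intro sigma_algebra.sigma_sets_subset) auto

lemma sf_Sup_nonempty:
  assumes "\<X> \<noteq> {}" "\<And>x. x \<in> \<X> \<Longrightarrow> x \<in> subfields M"
  shows "sf_Sup M \<X> = sigma_sets (space M) (\<Union>\<X>)"
proof -
  have "null_sets M \<subseteq> \<Union>\<X>" using assms subfieldsD(3) by blast
  then show ?thesis by (simp add: sf_Sup_def Un_absorb1)
qed

text \<open>Two events of the union lie in a common member by directedness. The union need not be a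
  sigma-field, but an intersection-stable generator is all that the density principle asks
  for.\<close>

lemma Int_stable_directed_Union:
  assumes "\<And>x. x \<in> \<X> \<Longrightarrow> x \<in> subfields M"
    and "\<And>x y. x \<in> \<X> \<Longrightarrow> y \<in> \<X> \<Longrightarrow> \<exists>z\<in>\<X>. x \<subseteq> z \<and> y \<subseteq> z"
  shows "Int_stable (\<Union>\<X>)"
proof (rule Int_stableI)
  fix a b assume "a \<in> \<Union>\<X>" "b \<in> \<Union>\<X>"
  then obtain z where z: "z \<in> \<X>" "a \<in> z" "b \<in> z" using assms(2) by blast
  interpret sigma_algebra "space M" z using assms(1)[OF z(1)] by (rule subfieldsD)
  show "a \<inter> b \<in> \<Union>\<X>" using z by blast
qed

text \<open>The union of \<open>x\<close> and \<open>y\<close> generates the join but need not be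
  stable under intersection. The products \<open>C \<inter> D\<close> are stable, and taking the
  whole space as one factor shows that they include both fields.\<close>

lemma sf_join_Int_generator:
  assumes x: "x \<in> subfields M" and y: "y \<in> subfields M"
  shows "sf_join M x y = sigma_sets (space M) {C \<inter> D | C D. C \<in> x \<and> D \<in> y}" (is "_ = sigma_sets _ ?G")
    and "Int_stable {C \<inter> D | C D. C \<in> x \<and> D \<in> y}"
    and "{C \<inter> D | C D. C \<in> x \<and> D \<in> y} \<subseteq> Pow (space M)"
proof -
  interpret x: sigma_algebra "space M" x using x by (rule subfieldsD)
  interpret y: sigma_algebra "space M" y using y by (rule subfieldsD)
  show "Int_stable ?G"
  proof (rule Int_stableI)
    fix a b assume "a \<in> ?G" "b \<in> ?G"
    then obtain C D C' D' where "a = C \<inter> D" "b = C' \<inter> D'" "C \<in> x" "C' \<in> x" "D \<in> y" "D' \<in> y"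
      by blast
    then have "a \<inter> b = (C \<inter> C') \<inter> (D \<inter> D')" "C \<inter> C' \<in> x" "D \<inter> D' \<in> y"
      by (simp_all add: x.Int y.Int Int_ac)
    then show "a \<inter> b \<in> ?G" by blast
  qed
  show G: "?G \<subseteq> Pow (space M)" using x.space_closed by auto
  have "x \<subseteq> ?G" "y \<subseteq> ?G"
  proof safe
    fix C assume "C \<in> x"
    then have "C = C \<inter> space M" using x.sets_into_space by blast
    then show "\<exists>C' D. C = C' \<inter> D \<and> C' \<in> x \<and> D \<in> y" using \<open>C \<in> x\<close> y.top by blast
  next
    fix D assume "D \<in> y"
    then have "D = space M \<inter> D" using y.sets_into_space by blast
    then show "\<exists>C D'. D = C \<inter> D' \<and> C \<in> x \<and> D' \<in> y" using \<open>D \<in> y\<close> x.top by blast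
  qed
  then have "sf_join M x y \<subseteq> sigma_sets (space M) ?G"
    unfolding sf_join_def
    by (intro sigma_sets_mono order_trans[OF _ sigma_sets_superset_generator]) blast
  moreover have "?G \<subseteq> sf_join M x y"
  proof -
    interpret j: sigma_algebra "space M" "sf_join M x y"
      using sf_join_subfields[OF x y] by (rule subfieldsD)
    show ?thesis using sf_join_upper(1)[of x M y] sf_join_upper(2)[of y M x] by auto
  qed
  then have "sigma_sets (space M) ?G \<subseteq> sf_join M x y"
    unfolding sf_join_def by (rule sigma_sets_mono)
  ultimately show "sf_join M x y = sigma_sets (space M) ?G" by blast
qed

context prob_space
begin

lemma sf_zero_subfields: "sf_zero M \<in> subfields M"
proof -
  have "sigma_algebra (space M) (sf_zero M)"
  proof (subst sigma_algebra_iff2, intro conjI ballI allI impI)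
    show "space M - S \<in> sf_zero M" if "S \<in> sf_zero M" for S
      using that by (auto simp: sf_zero_def prob_compl)
    show "(\<Union>i. A i) \<in> sf_zero M" if A: "range A \<subseteq> sf_zero M" for A :: "nat \<Rightarrow> _"
    proof (cases "\<exists>i. prob (A i) = 1")
      case True
      then obtain i where i: "prob (A i) = 1" by blast
      have "(\<Union>i. A i) \<in> events" using A by (auto simp: sf_zero_def)
      moreover from this have "prob (A i) \<le> prob (\<Union>i. A i)"
        by (intro finite_measure_mono) auto
      ultimately show ?thesis using i by (auto simp: sf_zero_def intro: antisym)
    next
      case False
      then have "A i \<in> null_sets M" for i
        using A by (auto simp: sf_zero_def null_sets_def emeasure_eq_measure)
      then have "(\<Union>i. A i) \<in> null_sets M" by (rule null_sets_UN)
      then show ?thesis by (auto simp: sf_zero_def null_sets_def emeasure_eq_measure)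
    qed
  qed (auto simp: sf_zero_def dest: sets.sets_into_space)
  then show ?thesis by (auto simp: subfields_def sf_zero_def null_sets_def emeasure_eq_measure)
qed

lemma sf_zero_least:
  assumes "x \<in> subfields M"
  shows "sf_zero M \<subseteq> x"
proof
  fix C assume C: "C \<in> sf_zero M"
  interpret x: sigma_algebra "space M" x using assms by (rule subfieldsD)
  have null: "N \<in> x" if "N \<in> events" "prob N = 0" for N
    using that subfieldsD(3)[OF assms] by (auto simp: null_sets_def emeasure_eq_measure)
  show "C \<in> x"
  proof (cases "prob C = 0")
    case False
    then have "space M - C \<in> x" using C by (intro null) (auto simp: sf_zero_def prob_compl)
    then have "space M - (space M - C) \<in> x" by blast
    moreover have "space M - (space M - C) = C"
      using C sets.sets_into_space by (auto simp: sf_zero_def)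
    ultimately show ?thesis by simp
  qed (use C null in \<open>auto simp: sf_zero_def\<close>)
qed

section \<open>Conditional expectations as orthogonal projections\<close>

text \<open>The functions orthogonal to \<open>j\<close> form a subspace that is closed by
  Cauchy-Schwarz, so the density principle reduces orthogonality to a generator.\<close>

lemma orthogonal_to_L2_subI:
  assumes z: "z \<in> subfields M" "z = sigma_sets (space M) G"
    and G: "Int_stable G" "G \<subseteq> Pow (space M)"
    and j: "j \<in> L2 M" and j1: "l2_inner M j (\<lambda>_. 1) = 0"
    and jC: "\<And>C. C \<in> G \<Longrightarrow> l2_inner M j (indicator C) = 0"
    and k: "k \<in> L2_sub M z"
  shows "l2_inner M j k = 0"
proof (rule L2_sub_closed_subspace_induct[where V = "\<lambda>k. l2_inner M j k = 0", OF z G k])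
  fix f g assume "f \<in> L2_sub M z" "g \<in> L2_sub M z" "l2_inner M j f = 0" "l2_inner M j g = 0"
  then show "l2_inner M j (\<lambda>w. f w + g w) = 0"
    using j by (simp add: l2_inner_add_right L2_subD(1))
next
  fix f and s :: "nat \<Rightarrow> 'a \<Rightarrow> complex"
  assume f: "f \<in> L2_sub M z" and s: "\<And>i. s i \<in> L2_sub M z" and js: "\<And>i. l2_inner M j (s i) = 0"
    and lim: "(\<lambda>i. l2_norm M (\<lambda>w. s i w - f w)) \<longlonglongrightarrow> 0"
  note fs = L2_subD(1)[OF f] L2_subD(1)[OF s]
  have "cmod (l2_inner M j f) \<le> l2_norm M j * l2_norm M (\<lambda>w. s i w - f w)" for i
  proof -
    have "l2_inner M j (\<lambda>w. s i w - f w) = - l2_inner M j f"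
      using js[of i] fs j by (simp add: l2_inner_diff_right)
    then show ?thesis
      using l2_Cauchy_Schwarz[OF j L2_diff[OF fs(2) fs(1)], of i] by simp
  qed
  moreover have "(\<lambda>i. l2_norm M j * l2_norm M (\<lambda>w. s i w - f w)) \<longlonglongrightarrow> l2_norm M j * 0"
    using lim by (rule tendsto_mult_left)
  ultimately have "cmod (l2_inner M j f) \<le> l2_norm M j * 0"
    by (intro LIMSEQ_le_const) auto
  then show "l2_inner M j f = 0" by simp
qed (use j1 jC in \<open>auto simp: l2_inner_scale_right\<close>)

lemma orthogonal_to_L2_sub_if_indicators:
  assumes z: "z \<in> subfields M" and j: "j \<in> L2 M"
    and jC: "\<And>C. C \<in> z \<Longrightarrow> l2_inner M j (indicator C) = 0"
    and k: "k \<in> L2_sub M z"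
  shows "l2_inner M j k = 0"
proof -
  note zD = subfieldsD[OF z]
  interpret z: sigma_algebra "space M" z by (rule zD)
  have "l2_inner M j (\<lambda>_. 1) = l2_inner M j (indicator (space M))"
    unfolding l2_inner_def by (intro Bochner_Integration.integral_cong) auto
  then have "l2_inner M j (\<lambda>_. 1) = 0" using jC zD(8) by simp
  moreover have "Int_stable z" by (rule Int_stableI) (rule z.Int)
  ultimately show ?thesis
    using orthogonal_to_L2_subI[OF z z.sigma_sets_eq[symmetric] _ z.space_closed j _ jC k] by blast
qed

lemma orthogonal_to_join:
  assumes x: "x \<in> subfields M" and y: "y \<in> subfields M" and j: "j \<in> L2 M"
    and jCD: "\<And>C D. C \<in> x \<Longrightarrow> D \<in> y \<Longrightarrow> l2_inner M j (indicator (C \<inter> D)) = 0"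
    and k: "k \<in> L2_sub M (sf_join M x y)"
  shows "l2_inner M j k = 0"
proof -
  have "l2_inner M j (\<lambda>_. 1) = l2_inner M j (indicator (space M \<inter> space M))"
    unfolding l2_inner_def by (intro Bochner_Integration.integral_cong) auto
  then have "l2_inner M j (\<lambda>_. 1) = 0"
    using jCD[OF subfieldsD(8)[OF x] subfieldsD(8)[OF y]] by simp
  moreover have "l2_inner M j (indicator A) = 0" if "A \<in> {C \<inter> D | C D. C \<in> x \<and> D \<in> y}" for A
    using that jCD by blast
  ultimately show ?thesis
    using orthogonal_to_L2_subI[OF sf_join_subfields[OF x y] sf_join_Int_generator[OF x y] j _ _ k]
    by blast
qed

text \<open>The projection is the conditional expectation, taken separately for the real and the
  imaginary part. Jensen's inequality for the square keeps it square integrable.\<close>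

lemma sf_proj_exists:
  assumes x: "x \<in> subfields M" and f: "f \<in> L2 M"
  shows "\<exists>g\<in>L2_sub M x. \<forall>k\<in>L2_sub M x. l2_inner M (\<lambda>w. f w - g w) k = 0"
proof -
  let ?F = "sigma (space M) x"
  note xD = subfieldsD[OF x]
  interpret finite_measure_subalgebra M ?F using xD(6) by unfold_locales
  define u v where "u = (\<lambda>w. Re (f w))" and "v = (\<lambda>w. Im (f w))"
  have [measurable]: "f \<in> borel_measurable M" using f by (rule L2_measurable)
  have uv [measurable]: "u \<in> borel_measurable M" "v \<in> borel_measurable M"
    unfolding u_def v_def by measurable
  have sq: "integrable M (\<lambda>w. (u w)\<^sup>2)" "integrable M (\<lambda>w. (v w)\<^sup>2)"
    by (rule Bochner_Integration.integrable_bound[OF L2_integrable_square[OF f]];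
        simp add: u_def v_def cmod_power2)+
  have int: "integrable M u" "integrable M v"
    using sq by (auto intro: square_integrable_imp_integrable)
  define g where "g = (\<lambda>w. complex_of_real (real_cond_exp M ?F u w) + \<i> * complex_of_real (real_cond_exp M ?F v w))"
  have gF: "g \<in> borel_measurable ?F" unfolding g_def by measurable
  have "integrable M (\<lambda>w. (real_cond_exp M ?F u w)\<^sup>2)" "integrable M (\<lambda>w. (real_cond_exp M ?F v w)\<^sup>2)"
    using int sq by (auto intro!: integrable_convex_cond_exp[where I=UNIV] convex_power2)
  then have "integrable M (\<lambda>w. (real_cond_exp M ?F u w)\<^sup>2 + (real_cond_exp M ?F v w)\<^sup>2)"
    by (rule Bochner_Integration.integrable_add)
  then have "g \<in> L2 M"
    using measurable_from_subalg[OF xD(6) gF] by (intro L2_dominated) (auto simp: g_def cmod_power2)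
  with gF have g: "g \<in> L2_sub M x" by (simp add: L2_sub_def)
  have eq: "l2_inner M (\<lambda>w. f w - g w) (indicator C) = 0" if C: "C \<in> x" for C
  proof -
    have CM [measurable]: "C \<in> sets M" and CF: "C \<in> sets ?F" using C xD by auto
    have ii: "integrable M (\<lambda>w. indicator C w * h w)" if "integrable M h" for h :: "_ \<Rightarrow> real"
      using integrable_mult_indicator[OF CM that] by simp
    let ?d = "\<lambda>u w. indicator C w * u w - indicator C w * real_cond_exp M ?F u w"
    have d: "integrable M (?d u)" "(\<integral>w. ?d u w \<partial>M) = 0" if "integrable M u" for u
      using real_cond_exp_intA[OF that CF] ii[OF that] ii[OF real_cond_exp_int(1)[OF that]]
      by (auto simp: set_lebesgue_integral_def)
    have "l2_inner M (\<lambda>w. f w - g w) (indicator C)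
        = (\<integral>w. complex_of_real (?d u w) + \<i> * complex_of_real (?d v w) \<partial>M)"
      unfolding l2_inner_def
      by (intro Bochner_Integration.integral_cong)
        (auto simp: complex_eq_iff g_def u_def v_def indicator_def)
    also have "\<dots> = of_real (\<integral>w. ?d u w \<partial>M) + \<i> * of_real (\<integral>w. ?d v w \<partial>M)"
      using d(1)[OF int(1)] d(1)[OF int(2)]
      by (subst Bochner_Integration.integral_add) (auto intro!: integrable_of_real simp del: of_real_diff of_real_mult)
    finally show ?thesis using int by (simp add: d)
  qed
  show ?thesis
    using g orthogonal_to_L2_sub_if_indicators[OF x L2_diff[OF f L2_subD(1)[OF g]] eq] by blast
qed

lemma
  assumes "x \<in> subfields M" "f \<in> L2 M"
  shows sf_proj_in_L2_sub: "sf_proj M x f \<in> L2_sub M x"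
    and sf_proj_orthogonal: "k \<in> L2_sub M x \<Longrightarrow> l2_inner M (\<lambda>w. f w - sf_proj M x f w) k = 0"
  using someI_ex[of "\<lambda>g. g \<in> L2_sub M x \<and> (\<forall>k\<in>L2_sub M x. l2_inner M (\<lambda>w. f w - g w) k = 0)"]
    sf_proj_exists[OF assms]
  unfolding sf_proj_def by blast+

lemma sf_proj_L2: "x \<in> subfields M \<Longrightarrow> f \<in> L2 M \<Longrightarrow> sf_proj M x f \<in> L2 M"
  using sf_proj_in_L2_sub L2_subD by blast

lemma sf_proj_inner:
  "x \<in> subfields M \<Longrightarrow> f \<in> L2 M \<Longrightarrow> k \<in> L2_sub M x \<Longrightarrow>
    l2_inner M (sf_proj M x f) k = l2_inner M f k"
  using sf_proj_orthogonal[of x f k] sf_proj_L2[of x f] L2_subD(1)[of k M x]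
  by (simp add: l2_inner_diff_left)

text \<open>\<open>sf_proj\<close> is a choice and thus fixed only almost everywhere; identities
  between projections are proved by matching inner products with indicators. The difference of two
  candidates lies in \<open>L2_sub M x\<close> and is orthogonal to all of it, hence to
  itself.\<close>

lemma sf_proj_unique:
  assumes x: "x \<in> subfields M" and f: "f \<in> L2 M" and g: "g \<in> L2_sub M x"
    and gC: "\<And>C. C \<in> x \<Longrightarrow> l2_inner M g (indicator C) = l2_inner M f (indicator C)"
  shows "AE w in M. sf_proj M x f w = g w"
proof -
  let ?d = "\<lambda>w. sf_proj M x f w - g w"
  have Q: "sf_proj M x f \<in> L2_sub M x" using x f by (rule sf_proj_in_L2_sub)
  have d: "?d \<in> L2_sub M x" using Q g by (rule L2_sub_diff)
  have "l2_inner M ?d ?d = 0"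
  proof (rule orthogonal_to_L2_sub_if_indicators[OF x L2_subD(1)[OF d] _ d])
    fix C assume C: "C \<in> x"
    then have "indicator C \<in> L2_sub M x" by (rule L2_sub_indicator[OF x])
    then show "l2_inner M ?d (indicator C) = 0"
      using sf_proj_inner[OF x f] gC[OF C] L2_subD(1)[OF Q] L2_subD(1)[OF g]
      by (simp add: l2_inner_diff_left L2_subD(1))
  qed
  then have "l2_norm M ?d = 0" by (simp add: l2_inner_self)
  then show ?thesis using l2_norm_eq_0_iff[OF L2_subD(1)[OF d]] by simp
qed

lemma sf_proj_cong_AE:
  assumes x: "x \<in> subfields M" and f: "f \<in> L2 M" and g: "g \<in> L2 M" and fg: "AE w in M. f w = g w"
  shows "AE w in M. sf_proj M x f w = sf_proj M x g w"
proof (rule sf_proj_unique[OF x f sf_proj_in_L2_sub[OF x g]])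
  fix C assume "C \<in> x"
  then have i: "indicator C \<in> L2_sub M x" by (rule L2_sub_indicator[OF x])
  show "l2_inner M (sf_proj M x g) (indicator C) = l2_inner M f (indicator C)"
    using sf_proj_inner[OF x g i] l2_inner_cong_AE[OF _ _ fg] f g i
    by (simp add: L2_measurable L2_subD(1))
qed

lemma sf_proj_id: "x \<in> subfields M \<Longrightarrow> f \<in> L2_sub M x \<Longrightarrow> AE w in M. sf_proj M x f w = f w"
  by (rule sf_proj_unique) (auto dest: L2_subD)

lemma sf_proj_add:
  assumes x: "x \<in> subfields M" and f: "f \<in> L2 M" and g: "g \<in> L2 M"
  shows "AE w in M. sf_proj M x (\<lambda>w. f w + g w) w = sf_proj M x f w + sf_proj M x g w"
proof (rule sf_proj_unique[OF x L2_add[OF f g]])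
  show "(\<lambda>w. sf_proj M x f w + sf_proj M x g w) \<in> L2_sub M x"
    using x f g by (intro L2_sub_add sf_proj_in_L2_sub)
  fix C assume "C \<in> x"
  then have i: "indicator C \<in> L2_sub M x" by (rule L2_sub_indicator[OF x])
  show "l2_inner M (\<lambda>w. sf_proj M x f w + sf_proj M x g w) (indicator C)
      = l2_inner M (\<lambda>w. f w + g w) (indicator C)"
    using x f g i L2_subD(1)[OF i]
    by (simp add: l2_inner_add_left sf_proj_L2 sf_proj_inner)
qed

lemma sf_proj_scale:
  assumes x: "x \<in> subfields M" and f: "f \<in> L2 M"
  shows "AE w in M. sf_proj M x (\<lambda>w. c * f w) w = c * sf_proj M x f w"
proof (rule sf_proj_unique[OF x L2_scale[OF f]])
  show "(\<lambda>w. c * sf_proj M x f w) \<in> L2_sub M x"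
    using x f by (intro L2_sub_scale sf_proj_in_L2_sub)
  fix C assume "C \<in> x"
  then have "indicator C \<in> L2_sub M x" by (rule L2_sub_indicator[OF x])
  then show "l2_inner M (\<lambda>w. c * sf_proj M x f w) (indicator C)
      = l2_inner M (\<lambda>w. c * f w) (indicator C)"
    using x f by (simp add: l2_inner_scale_left sf_proj_inner)
qed

lemma sf_proj_pythagoras:
  assumes x: "x \<in> subfields M" and f: "f \<in> L2 M" and k: "k \<in> L2_sub M x"
  shows "(l2_norm M (\<lambda>w. f w - k w))\<^sup>2
    = (l2_norm M (\<lambda>w. f w - sf_proj M x f w))\<^sup>2 + (l2_norm M (\<lambda>w. sf_proj M x f w - k w))\<^sup>2"
proof -
  have Q: "sf_proj M x f \<in> L2_sub M x" using x f by (rule sf_proj_in_L2_sub)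
  have d: "(\<lambda>w. sf_proj M x f w - k w) \<in> L2_sub M x" using Q k by (rule L2_sub_diff)
  show ?thesis
    using l2_norm_add_square[OF L2_diff[OF f L2_subD(1)[OF Q]] L2_subD(1)[OF d]]
      sf_proj_orthogonal[OF x f d] by simp
qed

lemma sf_proj_best:
  assumes "x \<in> subfields M" "f \<in> L2 M" "k \<in> L2_sub M x"
  shows "l2_norm M (\<lambda>w. f w - sf_proj M x f w) \<le> l2_norm M (\<lambda>w. f w - k w)"
proof (rule power2_le_imp_le)
  show "(l2_norm M (\<lambda>w. f w - sf_proj M x f w))\<^sup>2 \<le> (l2_norm M (\<lambda>w. f w - k w))\<^sup>2"
    unfolding sf_proj_pythagoras[OF assms] by simp
qed simp

lemma sf_proj_contraction:
  assumes "x \<in> subfields M" "f \<in> L2 M"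
  shows "l2_norm M (sf_proj M x f) \<le> l2_norm M f"
proof (rule power2_le_imp_le)
  have "(l2_norm M f)\<^sup>2 = (l2_norm M (\<lambda>w. f w - sf_proj M x f w))\<^sup>2 + (l2_norm M (sf_proj M x f))\<^sup>2"
    using sf_proj_pythagoras[OF assms L2_sub_const[OF assms(1), of 0]] by (simp only: diff_zero)
  then show "(l2_norm M (sf_proj M x f))\<^sup>2 \<le> (l2_norm M f)\<^sup>2" by (metis le_add_same_cancel2 zero_le_power2)
qed simp

lemma sf_proj_bounded_ops: "x \<in> subfields M \<Longrightarrow> sf_proj M x \<in> bounded_ops M"
  unfolding bounded_ops_def
  by (auto simp: sf_proj_L2 sf_proj_add sf_proj_scale intro!: exI[of _ 1] sf_proj_contraction)

lemma sf_proj_tower: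
  assumes "x \<in> subfields M" "y \<in> subfields M" "x \<subseteq> y" "f \<in> L2 M"
  shows "AE w in M. sf_proj M y (sf_proj M x f) w = sf_proj M x f w"
  using sf_proj_in_L2_sub[OF assms(1,4)] L2_sub_mono[OF assms(1-3)]
  by (intro sf_proj_id[OF assms(2)]) auto

text \<open>The common value lies in the ranges of both projections, so it is measurable in the
  intersection. Against an event of both fields the two projections drop out one after the other.
  Commutation is required at the single function \<open>f\<close> only.\<close>

lemma sf_proj_commute_Int:
  assumes x: "x \<in> subfields M" and y: "y \<in> subfields M" and f: "f \<in> L2 M"
    and comm: "AE w in M. sf_proj M x (sf_proj M y f) w = sf_proj M y (sf_proj M x f) w"
  shows "AE w in M. sf_proj M (x \<inter> y) f w = sf_proj M x (sf_proj M y f) w"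
proof (rule sf_proj_unique[OF subfields_Int[OF x y] f])
  let ?g = "sf_proj M x (sf_proj M y f)"
  have g: "?g \<in> L2_sub M x" using x y f by (intro sf_proj_in_L2_sub sf_proj_L2)
  have "AE w in M. sf_proj M y (sf_proj M x f) w = ?g w" using comm by eventually_elim simp
  then have "?g \<in> L2_sub M y"
    using L2_measurable[OF L2_subD(1)[OF g]] x y f
    by (intro L2_sub_cong_AE[OF y sf_proj_in_L2_sub[OF y sf_proj_L2[OF x f]]]) auto
  then show "?g \<in> L2_sub M (x \<inter> y)"
    using g by (auto simp: L2_sub_def measurable_subfield_iff x y subfields_Int)
  fix C assume C: "C \<in> x \<inter> y"
  then show "l2_inner M ?g (indicator C) = l2_inner M f (indicator C)"
    using L2_sub_indicator[OF x, of C] L2_sub_indicator[OF y, of C] x y f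
    by (simp add: sf_proj_inner sf_proj_L2)
qed

lemma sf_proj_zero:
  assumes f: "f \<in> L2 M"
  shows "AE w in M. sf_proj M (sf_zero M) f w = integral\<^sup>L M f"
proof (rule sf_proj_unique[OF sf_zero_subfields f L2_sub_const[OF sf_zero_subfields]])
  fix C assume C: "C \<in> sf_zero M"
  then have [measurable]: "C \<in> events" by (simp add: sf_zero_def)
  have [measurable]: "f \<in> borel_measurable M" using f by (rule L2_measurable)
  show "l2_inner M (\<lambda>_. integral\<^sup>L M f) (indicator C) = l2_inner M f (indicator C)"
  proof (cases "prob C = 0")
    case True
    then have "AE w in M. w \<notin> C" using AE_iff_null_sets[of C M]
      by (auto simp: null_sets_def emeasure_eq_measure)
    then have "l2_inner M h (indicator C) = 0" for h
      unfolding l2_inner_def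
      by (intro integral_eq_zero_AE) (auto elim!: eventually_mono)
    then show ?thesis by simp
  next
    case False
    then have "prob C = 1" using C by (simp add: sf_zero_def)
    then have C1: "AE w in M. w \<in> C" by (simp add: prob_eq_1)
    have "l2_inner M h (indicator C) = integral\<^sup>L M h" if [measurable]: "h \<in> borel_measurable M" for h
      unfolding l2_inner_def
    proof (rule integral_cong_AE)
      show "AE w in M. h w * cnj (indicator C w) = h w" using C1 by eventually_elim simp
    qed measurable
    then show ?thesis by (simp add: prob_space)
  qed
qed

lemma subfield_eq_sets_if_proj_id:
  assumes x: "x \<in> subfields M" and id: "\<And>f. f \<in> L2 M \<Longrightarrow> AE w in M. sf_proj M x f w = f w"
  shows "x = sets M"
proof
  show "x \<subseteq> sets M" using x by (rule subfieldsD)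
  show "sets M \<subseteq> x"
  proof
    fix C assume C: "C \<in> sets M"
    then have i: "indicator C \<in> L2 M" by (rule L2_indicator)
    show "C \<in> x"
      using id[OF i] by (rule event_in_subfield[OF x C sf_proj_in_L2_sub[OF x i]])
  qed
qed

end

section \<open>Operators and closures\<close>

lemma bounded_opsD:
  assumes "T \<in> bounded_ops M"
  shows "f \<in> L2 M \<Longrightarrow> T f \<in> L2 M"
    and "f \<in> L2 M \<Longrightarrow> g \<in> L2 M \<Longrightarrow> AE w in M. T (\<lambda>v. f v + g v) w = T f w + T g w"
    and "f \<in> L2 M \<Longrightarrow> AE w in M. T (\<lambda>v. c * f v) w = c * T f w"
    and "\<exists>K\<ge>0. \<forall>f\<in>L2 M. l2_norm M (T f) \<le> K * l2_norm M f"
proof -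
  obtain K where K: "\<forall>f\<in>L2 M. l2_norm M (T f) \<le> K * l2_norm M f"
    using assms by (auto simp: bounded_ops_def)
  have "l2_norm M (T f) \<le> \<bar>K\<bar> * l2_norm M f" if "f \<in> L2 M" for f
    using K that mult_right_mono[OF abs_ge_self[of K] l2_norm_nonneg[of M f]] by fastforce
  then show "\<exists>K\<ge>0. \<forall>f\<in>L2 M. l2_norm M (T f) \<le> K * l2_norm M f"
    by (intro exI[of _ "\<bar>K\<bar>"]) auto
qed (use assms in \<open>auto simp: bounded_ops_def\<close>)

text \<open>Elements of \<open>bounded_ops\<close> act on functions and not on classes. Respect for
  almost everywhere equality is regained from additivity, since \<open>T (f - g)\<close> has norm
  0.\<close>

lemma bounded_ops_cong_AE:
  assumes T: "T \<in> bounded_ops M" and f: "f \<in> L2 M" and g: "g \<in> L2 M" and fg: "AE w in M. f w = g w"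
  shows "AE w in M. T f w = T g w"
proof -
  let ?d = "\<lambda>w. f w - g w"
  have d: "?d \<in> L2 M" using f g by (rule L2_diff)
  obtain K where K: "\<forall>f\<in>L2 M. l2_norm M (T f) \<le> K * l2_norm M f"
    using bounded_opsD(4)[OF T] by blast
  have "l2_norm M ?d = 0" using d fg by (simp add: l2_norm_eq_0_iff)
  moreover have "l2_norm M (T ?d) \<le> K * l2_norm M ?d" using K d by blast
  ultimately have "l2_norm M (T ?d) = 0" using l2_norm_nonneg[of M "T ?d"] by simp
  then have "AE w in M. T ?d w = 0" using l2_norm_eq_0_iff[OF bounded_opsD(1)[OF T d]] by simp
  moreover have "AE w in M. T f w = T g w + T ?d w"
    using bounded_opsD(2)[OF T g d] by simp
  ultimately show ?thesis by eventually_elim simp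
qed

lemma bounded_ops_id: "id \<in> bounded_ops M"
  by (auto simp: bounded_ops_def intro!: exI[of _ 1])

lemma bounded_ops_add:
  assumes T: "T \<in> bounded_ops M" and U: "U \<in> bounded_ops M"
  shows "(\<lambda>f w. T f w + U f w) \<in> bounded_ops M"
proof -
  obtain K L where K: "\<forall>f\<in>L2 M. l2_norm M (T f) \<le> K * l2_norm M f"
    and L: "\<forall>f\<in>L2 M. l2_norm M (U f) \<le> L * l2_norm M f"
    using bounded_opsD(4)[OF T] bounded_opsD(4)[OF U] by blast
  have "l2_norm M (\<lambda>w. T f w + U f w) \<le> (K + L) * l2_norm M f" if f: "f \<in> L2 M" for f
    using l2_norm_triangle[OF bounded_opsD(1)[OF T f] bounded_opsD(1)[OF U f]] K L f
    by (fastforce simp: distrib_right)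
  moreover have "AE w in M. T (\<lambda>v. f v + g v) w + U (\<lambda>v. f v + g v) w = T f w + U f w + (T g w + U g w)"
    if f: "f \<in> L2 M" and g: "g \<in> L2 M" for f g
    using bounded_opsD(2)[OF T f g] bounded_opsD(2)[OF U f g] by eventually_elim simp
  moreover have "AE w in M. T (\<lambda>v. c * f v) w + U (\<lambda>v. c * f v) w = c * (T f w + U f w)"
    if f: "f \<in> L2 M" for f c
    using bounded_opsD(3)[OF T f, of c] bounded_opsD(3)[OF U f, of c] by eventually_elim (simp add: distrib_left)
  ultimately show ?thesis
    using bounded_opsD(1)[OF T] bounded_opsD(1)[OF U] by (auto simp: bounded_ops_def L2_add)
qed

lemma bounded_ops_scale:
  assumes T: "T \<in> bounded_ops M"
  shows "(\<lambda>f w. c * T f w) \<in> bounded_ops M"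
proof -
  obtain K where K: "\<forall>f\<in>L2 M. l2_norm M (T f) \<le> K * l2_norm M f"
    using bounded_opsD(4)[OF T] by blast
  have "l2_norm M (\<lambda>w. c * T f w) \<le> (cmod c * K) * l2_norm M f" if f: "f \<in> L2 M" for f
    using K f by (simp add: l2_norm_scale mult.assoc mult_left_mono)
  moreover have "AE w in M. c * T (\<lambda>v. f v + g v) w = c * T f w + c * T g w"
    if f: "f \<in> L2 M" and g: "g \<in> L2 M" for f g
    using bounded_opsD(2)[OF T f g] by eventually_elim (simp add: distrib_left)
  moreover have "AE w in M. c * T (\<lambda>v. d * f v) w = d * (c * T f w)"
    if f: "f \<in> L2 M" for f d
    using bounded_opsD(3)[OF T f, of d] by eventually_elim simp
  ultimately show ?thesis
    using bounded_opsD(1)[OF T] by (auto simp: bounded_ops_def L2_scale)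
qed

lemma bounded_ops_comp:
  assumes T: "T \<in> bounded_ops M" and U: "U \<in> bounded_ops M"
  shows "T \<circ> U \<in> bounded_ops M"
proof -
  note TD = bounded_opsD[OF T] and UD = bounded_opsD[OF U]
  obtain K L where K: "K \<ge> 0" "\<forall>f\<in>L2 M. l2_norm M (T f) \<le> K * l2_norm M f"
    and L: "\<forall>f\<in>L2 M. l2_norm M (U f) \<le> L * l2_norm M f"
    using TD(4) UD(4) by blast
  have "l2_norm M (T (U f)) \<le> (K * L) * l2_norm M f" if f: "f \<in> L2 M" for f
  proof -
    have "l2_norm M (T (U f)) \<le> K * l2_norm M (U f)" using K UD(1)[OF f] by blast
    also have "\<dots> \<le> K * (L * l2_norm M f)" using K(1) L f by (intro mult_left_mono) auto
    finally show ?thesis by (simp add: mult.assoc)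
  qed
  moreover have "AE w in M. T (U (\<lambda>v. f v + g v)) w = T (U f) w + T (U g) w"
    if f: "f \<in> L2 M" and g: "g \<in> L2 M" for f g
  proof -
    have "AE w in M. T (U (\<lambda>v. f v + g v)) w = T (\<lambda>v. U f v + U g v) w"
      using f g by (intro bounded_ops_cong_AE[OF T] UD L2_add)
    then show ?thesis using TD(2)[OF UD(1)[OF f] UD(1)[OF g]] by eventually_elim simp
  qed
  moreover have "AE w in M. T (U (\<lambda>v. c * f v)) w = c * T (U f) w" if f: "f \<in> L2 M" for f c
  proof -
    have "AE w in M. T (U (\<lambda>v. c * f v)) w = T (\<lambda>v. c * U f v) w"
      using f by (intro bounded_ops_cong_AE[OF T] UD L2_scale)
    then show ?thesis using TD(3)[OF UD(1)[OF f], of c] by eventually_elim simp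
  qed
  ultimately show ?thesis using TD(1) UD(1) by (auto simp: bounded_ops_def)
qed

section \<open>The strong operator topology and generated von Neumann algebras\<close>

lemma topspace_strong_op_topology: "topspace (strong_op_topology M) = bounded_ops M"
proof
  show "topspace (strong_op_topology M) \<subseteq> bounded_ops M"
    by (auto simp: strong_op_topology_def)
  show "bounded_ops M \<subseteq> topspace (strong_op_topology M)"
  proof
    fix T assume T: "T \<in> bounded_ops M"
    \<comment> \<open>Any element of \<open>L2 M\<close> would serve as test function and any
      positive number as radius; the zero function belongs to \<open>L2 M\<close> for every
      \<open>M\<close>.\<close>
    let ?O = "{U \<in> bounded_ops M. l2_norm M (\<lambda>w. U (\<lambda>_. 0) w - T (\<lambda>_. 0) w) < 1}"
    have "(\<lambda>_. 0) \<in> L2 M" by (simp add: L2_def)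
    then have "?O \<in> {{T \<in> bounded_ops M. l2_norm M (\<lambda>w. T f w - U f w) < e} | U f e.
        U \<in> bounded_ops M \<and> f \<in> L2 M \<and> e > 0}"
      using T zero_less_one by blast
    moreover have "T \<in> ?O" using T by (simp add: l2_norm_def)
    ultimately show "T \<in> topspace (strong_op_topology M)"
      unfolding strong_op_topology_def topology_generated_by_topspace by (rule UnionI)
  qed
qed

text \<open>Supplies a member of the family intersected in \<open>vn_generated\<close>; the
  intersection of an empty family would be \<open>UNIV\<close>.\<close>

lemma von_neumann_algebra_bounded_ops: "von_neumann_algebra M (bounded_ops M)"
  unfolding von_neumann_algebra_def
  using closedin_topspace[of "strong_op_topology M"]
  by (auto simp: bounded_ops_id bounded_ops_add bounded_ops_scale bounded_ops_comp
      topspace_strong_op_topology)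

lemma von_neumann_algebraD:
  assumes "von_neumann_algebra M \<A>"
  shows "\<A> \<subseteq> bounded_ops M" "id \<in> \<A>"
    "T \<in> \<A> \<Longrightarrow> U \<in> \<A> \<Longrightarrow> (\<lambda>f w. T f w + U f w) \<in> \<A>"
    "T \<in> \<A> \<Longrightarrow> (\<lambda>f w. c * T f w) \<in> \<A>"
    "T \<in> \<A> \<Longrightarrow> U \<in> \<A> \<Longrightarrow> T \<circ> U \<in> \<A>"
    "T \<in> \<A> \<Longrightarrow> U \<in> bounded_ops M \<Longrightarrow> adjoint_ops M T U \<Longrightarrow> U \<in> \<A>"
    "closedin (strong_op_topology M) \<A>"
  using assms unfolding von_neumann_algebra_def by blast+

lemma von_neumann_algebra_vn_generated:
  assumes "K \<subseteq> bounded_ops M"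
  shows "von_neumann_algebra M (vn_generated M K)"
proof -
  let ?S = "{\<A>. von_neumann_algebra M \<A> \<and> K \<subseteq> \<A>}"
  have ne: "bounded_ops M \<in> ?S" using assms von_neumann_algebra_bounded_ops by blast
  show ?thesis
    unfolding vn_generated_def von_neumann_algebra_def[of M "\<Inter>?S"]
  proof (intro conjI ballI allI impI)
    show "closedin (strong_op_topology M) (\<Inter>?S)"
      using ne von_neumann_algebraD(7) by (intro closedin_Inter) auto
    show "\<Inter>?S \<subseteq> bounded_ops M" using ne by (rule Inter_lower)
  qed (blast intro: von_neumann_algebraD(2-6))+
qed

lemma subset_vn_generated: "K \<subseteq> vn_generated M K"
  by (auto simp: vn_generated_def)

text \<open>Commutativity is inherited from pointwise multiplication through the injectivity of
  \<alpha>. The commutation of projections belonging to the closure of \<open>B\<close> comes from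
  here.\<close>

lemma vn_isomorphism_commute:
  assumes iso: "vn_isomorphism M \<A> N \<alpha>" and vn: "von_neumann_algebra M \<A>"
    and T: "T \<in> \<A>" and U: "U \<in> \<A>"
  shows "op_eq M (T \<circ> U) (U \<circ> T)"
proof -
  have "AE s in N. \<alpha> (T \<circ> U) s = \<alpha> T s * \<alpha> U s" "AE s in N. \<alpha> (U \<circ> T) s = \<alpha> U s * \<alpha> T s"
    using iso T U by (auto simp: vn_isomorphism_def)
  then have "AE s in N. \<alpha> (T \<circ> U) s = \<alpha> (U \<circ> T) s" by eventually_elim simp
  moreover have "T \<circ> U \<in> \<A>" "U \<circ> T \<in> \<A>" using vn T U by (auto simp: von_neumann_algebra_def)
  ultimately show ?thesis using iso by (auto simp: vn_isomorphism_def)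
qed

text \<open>The subbasic balls are not centred at \<open>T\<close>. Induction over the generated
  topology recentres them and collects finitely many test functions with a single radius.\<close>

lemma openin_strong_op_topology_nbhd:
  assumes "openin (strong_op_topology M) O'" "T \<in> O'" "T \<in> bounded_ops M"
  shows "\<exists>\<F> e. finite \<F> \<and> \<F> \<subseteq> L2 M \<and> e > 0 \<and>
    (\<forall>U\<in>bounded_ops M. (\<forall>f\<in>\<F>. l2_norm M (\<lambda>w. U f w - T f w) < e) \<longrightarrow> U \<in> O')"
proof -
  let ?P = "\<lambda>O' \<F> e. finite \<F> \<and> \<F> \<subseteq> L2 M \<and> e > 0 \<and>
    (\<forall>U\<in>bounded_ops M. (\<forall>f\<in>\<F>. l2_norm M (\<lambda>w. U f w - T f w) < e) \<longrightarrow> U \<in> O')"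
  have "generate_topology_on {{T \<in> bounded_ops M. l2_norm M (\<lambda>w. T f w - U f w) < e} | U f e.
        U \<in> bounded_ops M \<and> f \<in> L2 M \<and> e > 0} O'"
    using assms(1) unfolding strong_op_topology_def by (rule openin_topology_generated_by)
  then have "T \<in> O' \<longrightarrow> (\<exists>\<F> e. ?P O' \<F> e)"
  proof induction
    case (Int a b)
    show ?case
    proof
      assume "T \<in> a \<inter> b"
      then obtain \<F> e \<F>' e' where "?P a \<F> e" "?P b \<F>' e'" using Int.IH by auto
      then have "?P (a \<inter> b) (\<F> \<union> \<F>') (min e e')" by auto
      then show "\<exists>\<F> e. ?P (a \<inter> b) \<F> e" by (intro exI)
    qed
  next
    case (UN K)
    show ?case
    proof
      assume "T \<in> \<Union>K"
      then obtain k where k: "k \<in> K" "T \<in> k" by blast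
      then obtain \<F> e where P: "?P k \<F> e" using UN.IH[OF k(1)] by auto
      have "k \<subseteq> \<Union>K" using k(1) by (rule Union_upper)
      with P have "?P (\<Union>K) \<F> e" by (meson subsetD)
      then show "\<exists>\<F> e. ?P (\<Union>K) \<F> e" by (intro exI)
    qed
  next
    case (Basis s)
    then obtain U f e where s: "s = {T \<in> bounded_ops M. l2_norm M (\<lambda>w. T f w - U f w) < e}"
      and U: "U \<in> bounded_ops M" and f: "f \<in> L2 M" by blast
    show ?case
    proof
      assume "T \<in> s"
      then have T: "l2_norm M (\<lambda>w. T f w - U f w) < e" by (simp add: s)
      \<comment> \<open>The slack left by the triangle inequality for moving from \<open>T f\<close>
        to \<open>V f\<close> inside the ball around \<open>U f\<close>.\<close>
      let ?e = "e - l2_norm M (\<lambda>w. T f w - U f w)"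
      have "V \<in> s" if V: "V \<in> bounded_ops M" and d: "l2_norm M (\<lambda>w. V f w - T f w) < ?e" for V
        using l2_norm_triangle_diff[of "V f" M "T f" "U f"] V d U assms(3) f
        by (simp add: s bounded_opsD(1))
      then have "?P s {f} ?e" using T f by simp
      then show "\<exists>\<F> e. ?P s \<F> e" by (intro exI)
    qed
  qed simp
  then show ?thesis using assms(2) by blast
qed

context prob_space
begin

section \<open>Strong closures of families of sub-sigma-fields\<close>

lemma topspace_sf_topology: "topspace (sf_topology M) = subfields M"
  using sf_proj_bounded_ops
  by (auto simp: sf_topology_def topspace_pullback_topology topspace_strong_op_topology)

lemma closure_of_sf_topologyI:
  assumes y: "y \<in> subfields M" and B: "B \<subseteq> subfields M"
    and approx: "\<And>\<F> e. finite \<F> \<Longrightarrow> \<F> \<subseteq> L2 M \<Longrightarrow> e > 0 \<Longrightarrow>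
      \<exists>x\<in>B. \<forall>f\<in>\<F>. l2_norm M (\<lambda>w. sf_proj M x f w - sf_proj M y f w) < e"
  shows "y \<in> sf_topology M closure_of B"
  unfolding in_closure_of topspace_sf_topology
proof (intro conjI allI impI)
  fix O' assume O': "y \<in> O' \<and> openin (sf_topology M) O'"
  then obtain U where U: "openin (strong_op_topology M) U" "O' = sf_proj M -` U \<inter> subfields M"
    by (auto simp: sf_topology_def openin_pullback_topology)
  then obtain \<F> e where \<F>: "finite \<F>" "\<F> \<subseteq> L2 M" "e > 0"
    "\<forall>V\<in>bounded_ops M. (\<forall>f\<in>\<F>. l2_norm M (\<lambda>w. V f w - sf_proj M y f w) < e) \<longrightarrow> V \<in> U"
    using openin_strong_op_topology_nbhd[of M U "sf_proj M y"] O' sf_proj_bounded_ops[OF y] by auto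
  obtain x where x: "x \<in> B" "\<forall>f\<in>\<F>. l2_norm M (\<lambda>w. sf_proj M x f w - sf_proj M y f w) < e"
    using approx[OF \<F>(1-3)] by blast
  then have "x \<in> O'" using \<F>(4) B sf_proj_bounded_ops U(2) by blast
  then show "\<exists>x. x \<in> B \<and> x \<in> O'" using x(1) by blast
qed (use y in simp)

lemma closure_of_sf_topology_subfields: "y \<in> sf_topology M closure_of B \<Longrightarrow> y \<in> subfields M"
  by (simp add: in_closure_of topspace_sf_topology)

lemma closure_of_meets_open:
  "y \<in> X closure_of B \<Longrightarrow> openin X O' \<Longrightarrow> y \<in> O' \<Longrightarrow> \<exists>x\<in>B. x \<in> O'"
  by (meson in_closure_of)

text \<open>There are two test functions because a single \<open>z \<in> B\<close> must later
  approximate two projected indicators at once.\<close>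

lemma closure_of_sf_topologyD:
  assumes y: "y \<in> sf_topology M closure_of B" and f: "f \<in> L2 M" and g: "g \<in> L2 M" and e: "e > 0"
  shows "\<exists>x\<in>B. l2_norm M (\<lambda>w. sf_proj M x f w - sf_proj M y f w) < e \<and>
    l2_norm M (\<lambda>w. sf_proj M x g w - sf_proj M y g w) < e"
proof -
  have yT: "y \<in> subfields M" using y by (rule closure_of_sf_topology_subfields)
  let ?O = "\<lambda>f. {T \<in> bounded_ops M. l2_norm M (\<lambda>w. T f w - sf_proj M y f w) < e}"
  have O1: "openin (strong_op_topology M) (?O f)" if "f \<in> L2 M" for f
    unfolding strong_op_topology_def
    by (rule topology_generated_by_Basis) (use that e sf_proj_bounded_ops[OF yT] in blast)
  have "openin (sf_topology M) (sf_proj M -` (?O f \<inter> ?O g) \<inter> subfields M)"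
    unfolding sf_topology_def openin_pullback_topology using O1[OF f] O1[OF g] by blast
  moreover have "y \<in> sf_proj M -` (?O f \<inter> ?O g) \<inter> subfields M"
    using yT sf_proj_bounded_ops[OF yT] e by (simp add: l2_norm_def)
  ultimately have "\<exists>x\<in>B. x \<in> sf_proj M -` (?O f \<inter> ?O g) \<inter> subfields M"
    by (rule closure_of_meets_open[OF y])
  then show ?thesis by auto
qed

text \<open>The generated algebra is strongly closed and contains the projections of
  \<open>B\<close>, so its preimage under \<open>sf_proj M\<close> is closed in the pulled back
  topology and contains \<open>B\<close>.\<close>

lemma sf_proj_closure_in_vn_generated:
  assumes y: "y \<in> sf_topology M closure_of B" and B: "B \<subseteq> subfields M"
  shows "sf_proj M y \<in> vn_generated M (sf_proj M ` B)"
proof (rule ccontr)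
  let ?A = "vn_generated M (sf_proj M ` B)" and ?X = "strong_op_topology M"
  assume not: "sf_proj M y \<notin> ?A"
  have yT: "y \<in> subfields M" using y by (rule closure_of_sf_topology_subfields)
  have "sf_proj M ` B \<subseteq> bounded_ops M" using B sf_proj_bounded_ops by blast
  then have "closedin ?X ?A"
    using von_neumann_algebra_vn_generated by (auto simp: von_neumann_algebra_def)
  then have "openin ?X (topspace ?X - ?A)" by blast
  then have "openin (sf_topology M) (sf_proj M -` (topspace ?X - ?A) \<inter> subfields M)"
    unfolding sf_topology_def openin_pullback_topology by blast
  moreover have "y \<in> sf_proj M -` (topspace ?X - ?A) \<inter> subfields M"
    using not yT sf_proj_bounded_ops by (simp add: topspace_strong_op_topology)
  ultimately have "\<exists>x\<in>B. x \<in> sf_proj M -` (topspace ?X - ?A) \<inter> subfields M"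
    by (rule closure_of_meets_open[OF y])
  then show False using subset_vn_generated[of "sf_proj M ` B" M] by auto
qed

section \<open>Suprema of directed families\<close>

text \<open>The functions that can be approximated from members of \<open>D\<close> form a closed
  subspace containing the indicators of a generator. Directedness enters for sums, where two
  approximants need a common member.\<close>

lemma directed_Sup_dense:
  assumes D: "D \<noteq> {}" "\<And>x. x \<in> D \<Longrightarrow> x \<in> subfields M"
    and dir: "\<And>x y. x \<in> D \<Longrightarrow> y \<in> D \<Longrightarrow> \<exists>z\<in>D. x \<subseteq> z \<and> y \<subseteq> z"
    and f: "f \<in> L2_sub M (sf_Sup M D)" and e: "e > 0"
  shows "\<exists>x\<in>D. \<exists>k\<in>L2_sub M x. l2_norm M (\<lambda>w. f w - k w) < e"
proof -
  let ?z = "sf_Sup M D"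
  define V where "V f \<longleftrightarrow> (\<forall>e>0. \<exists>x\<in>D. \<exists>k\<in>L2_sub M x. l2_norm M (\<lambda>w. f w - k w) < e)" for f
  have z: "?z \<in> subfields M" using D by (intro sf_Sup_subfields)
  have gen: "?z = sigma_sets (space M) (\<Union>D)" using D by (rule sf_Sup_nonempty)
  have st: "Int_stable (\<Union>D)" by (rule Int_stable_directed_Union) (use D dir in auto)
  have Pow: "\<Union>D \<subseteq> Pow (space M)" using D(2) subfieldsD(2) sets.space_closed by blast
  have V_L2_sub: "V k" if "x \<in> D" "k \<in> L2_sub M x" for x k
  proof -
    have "l2_norm M (\<lambda>w. k w - k w) = 0" by (simp add: l2_norm_def)
    then show ?thesis using that unfolding V_def by metis
  qed
  have "V f"
  proof (rule L2_sub_closed_subspace_induct[OF z gen st Pow f])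
    obtain x where "x \<in> D" using D(1) by blast
    then show "V (\<lambda>_. 1)" using D(2) by (intro V_L2_sub L2_sub_const)
  next
    fix C assume "C \<in> \<Union>D"
    then obtain x where "x \<in> D" "C \<in> x" by blast
    then show "V (indicator C)" using D(2) by (intro V_L2_sub L2_sub_indicator)
  next
    fix f g assume fg: "f \<in> L2_sub M ?z" "g \<in> L2_sub M ?z" "V f" "V g"
    show "V (\<lambda>w. f w + g w)" unfolding V_def
    proof (intro allI impI)
      fix e :: real assume "e > 0"
      then have "e / 2 > 0" by simp
      then obtain x k y l where x: "x \<in> D" "k \<in> L2_sub M x" "l2_norm M (\<lambda>w. f w - k w) < e / 2"
        and y: "y \<in> D" "l \<in> L2_sub M y" "l2_norm M (\<lambda>w. g w - l w) < e / 2"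
        using fg(3,4) unfolding V_def by meson
      obtain z where z: "z \<in> D" "x \<subseteq> z" "y \<subseteq> z" using dir x(1) y(1) by blast
      have "(\<lambda>w. k w + l w) \<in> L2_sub M z"
        using subsetD[OF L2_sub_mono[OF D(2)[OF x(1)] D(2)[OF z(1)] z(2)] x(2)]
          subsetD[OF L2_sub_mono[OF D(2)[OF y(1)] D(2)[OF z(1)] z(3)] y(2)]
        by (rule L2_sub_add)
      moreover have "l2_norm M (\<lambda>w. f w + g w - (k w + l w))
          \<le> l2_norm M (\<lambda>w. f w - k w) + l2_norm M (\<lambda>w. g w - l w)"
        using l2_norm_triangle[OF L2_diff[OF L2_subD(1)[OF fg(1)] L2_subD(1)[OF x(2)]]
            L2_diff[OF L2_subD(1)[OF fg(2)] L2_subD(1)[OF y(2)]]]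
        by (simp only: add_diff_add)
      then have "l2_norm M (\<lambda>w. f w + g w - (k w + l w)) < e" using x y by simp
      ultimately show "\<exists>x\<in>D. \<exists>k\<in>L2_sub M x. l2_norm M (\<lambda>w. f w + g w - k w) < e"
        by (intro bexI[OF _ z(1)] bexI[of _ "\<lambda>w. k w + l w"])
    qed
  next
    fix c f assume f: "f \<in> L2_sub M ?z" "V f"
    show "V (\<lambda>w. c * f w)" unfolding V_def
    proof (intro allI impI)
      fix e :: real assume e: "e > 0"
      \<comment> \<open>Adding 1 covers the case \<open>c = 0\<close> and makes the final inequality
        strict.\<close>
      let ?e = "e / (cmod c + 1)"
      have c: "cmod c + 1 > 0" by (simp add: add_nonneg_pos)
      then have "?e > 0" using e by simp
      then obtain x k where x: "x \<in> D" "k \<in> L2_sub M x" "l2_norm M (\<lambda>w. f w - k w) < ?e"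
        using f(2) unfolding V_def by meson
      have "l2_norm M (\<lambda>w. c * f w - c * k w) = cmod c * l2_norm M (\<lambda>w. f w - k w)"
        by (simp flip: l2_norm_scale right_diff_distrib)
      also have "\<dots> \<le> cmod c * ?e" using x(3) by (intro mult_left_mono) auto
      also have "\<dots> < e" using e c by (simp add: field_simps)
      finally show "\<exists>x\<in>D. \<exists>k\<in>L2_sub M x. l2_norm M (\<lambda>w. c * f w - k w) < e"
        by (intro bexI[OF _ x(1)] bexI[OF _ L2_sub_scale[OF x(2)]])
    qed
  next
    fix f and s :: "nat \<Rightarrow> 'a \<Rightarrow> complex"
    assume f: "f \<in> L2_sub M ?z" and s: "\<And>i. s i \<in> L2_sub M ?z" "\<And>i. V (s i)"
      and lim: "(\<lambda>i. l2_norm M (\<lambda>w. s i w - f w)) \<longlonglongrightarrow> 0"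
    show "V f" unfolding V_def
    proof (intro allI impI)
      fix e :: real assume "e > 0"
      then have e: "e / 2 > 0" by simp
      obtain i where i: "l2_norm M (\<lambda>w. s i w - f w) < e / 2"
        using order_tendstoD(2)[OF lim e] by (auto simp: eventually_sequentially)
      obtain x k where x: "x \<in> D" "k \<in> L2_sub M x" "l2_norm M (\<lambda>w. s i w - k w) < e / 2"
        using s(2) e unfolding V_def by meson
      have "l2_norm M (\<lambda>w. f w - k w) < e"
        using l2_norm_triangle_diff[of f M "s i" k] f s(1)[of i] x i l2_norm_minus_commute[of M f "s i"]
        by (simp add: L2_subD(1))
      then show "\<exists>x\<in>D. \<exists>k\<in>L2_sub M x. l2_norm M (\<lambda>w. f w - k w) < e" using x by blast
    qed
  qed
  then show ?thesis using e unfolding V_def by blast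
qed

lemma sf_proj_comp_mono:
  assumes x: "x \<in> subfields M" and z: "z \<in> subfields M" and xz: "x \<subseteq> z" and f: "f \<in> L2 M"
  shows "AE w in M. sf_proj M x f w = sf_proj M x (sf_proj M z f) w"
proof (rule sf_proj_unique[OF x f sf_proj_in_L2_sub[OF x sf_proj_L2[OF z f]]])
  fix C assume "C \<in> x"
  then have "indicator C \<in> L2_sub M x" "indicator C \<in> L2_sub M z"
    using x z xz by (auto intro: L2_sub_indicator)
  then show "l2_inner M (sf_proj M x (sf_proj M z f)) (indicator C) = l2_inner M f (indicator C)"
    using x z f by (simp add: sf_proj_inner sf_proj_L2)
qed

text \<open>Strong convergence of the net of projections. It is stated as smallness from some
  \<open>x\<close> onwards, so that the induction over the test functions can pass to a common upper
  bound.\<close>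

lemma directed_Sup_sf_proj_limit:
  assumes D: "D \<noteq> {}" "\<And>x. x \<in> D \<Longrightarrow> x \<in> subfields M"
    and dir: "\<And>x y. x \<in> D \<Longrightarrow> y \<in> D \<Longrightarrow> \<exists>z\<in>D. x \<subseteq> z \<and> y \<subseteq> z"
    and \<F>: "finite \<F>" "\<F> \<subseteq> L2 M" and e: "e > 0"
  shows "\<exists>x\<in>D. \<forall>x'\<in>D. x \<subseteq> x' \<longrightarrow>
    (\<forall>f\<in>\<F>. l2_norm M (\<lambda>w. sf_proj M x' f w - sf_proj M (sf_Sup M D) f w) < e)"
  using \<F>
proof (induction \<F>)
  case empty
  then show ?case using D(1) by blast
next
  case (insert f \<F>)
  let ?z = "sf_Sup M D"
  have z: "?z \<in> subfields M" using D by (intro sf_Sup_subfields)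
  have f: "f \<in> L2 M" using insert.prems by simp
  obtain x where x: "x \<in> D" "\<forall>x'\<in>D. x \<subseteq> x' \<longrightarrow>
      (\<forall>f\<in>\<F>. l2_norm M (\<lambda>w. sf_proj M x' f w - sf_proj M ?z f w) < e)"
    using insert by auto
  obtain y k where y: "y \<in> D" "k \<in> L2_sub M y" "l2_norm M (\<lambda>w. sf_proj M ?z f w - k w) < e"
    using directed_Sup_dense[OF D dir sf_proj_in_L2_sub[OF z f] e] by blast
  obtain v where v: "v \<in> D" "x \<subseteq> v" "y \<subseteq> v" using dir x(1) y(1) by blast
  have "l2_norm M (\<lambda>w. sf_proj M x' f w - sf_proj M ?z f w) < e" if x': "x' \<in> D" "v \<subseteq> x'" for x'
  proof -
    have x'T: "x' \<in> subfields M" and x'z: "x' \<subseteq> ?z" using D(2)[OF x'(1)] sf_Sup_upper[OF x'(1)] by auto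
    have k: "k \<in> L2_sub M x'"
      using subsetD[OF L2_sub_mono[OF D(2)[OF y(1)] x'T order_trans[OF v(3) x'(2)]] y(2)] .
    note zf = sf_proj_L2[OF z f]
    have "l2_norm M (\<lambda>w. sf_proj M x' f w - sf_proj M ?z f w)
        = l2_norm M (\<lambda>w. sf_proj M ?z f w - sf_proj M x' f w)"
      by (rule l2_norm_minus_commute)
    \<comment> \<open>Once \<open>f\<close> is replaced by its projection onto the supremum,
      projecting onto \<open>x'\<close> gives the best approximation of that function. It beats
      \<open>k\<close> for every \<open>x'\<close> above \<open>v\<close>, so one \<open>k\<close>
      controls them all.\<close>
    also have "\<dots> = l2_norm M (\<lambda>w. sf_proj M ?z f w - sf_proj M x' (sf_proj M ?z f) w)"
    proof (rule l2_norm_cong_AE)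
      show "AE w in M. sf_proj M ?z f w - sf_proj M x' f w
          = sf_proj M ?z f w - sf_proj M x' (sf_proj M ?z f) w"
        using sf_proj_comp_mono[OF x'T z x'z f] by eventually_elim simp
    qed (use f zf sf_proj_L2[OF x'T] L2_measurable in \<open>auto intro!: borel_measurable_diff\<close>)
    also have "\<dots> \<le> l2_norm M (\<lambda>w. sf_proj M ?z f w - k w)"
      using sf_proj_best[OF x'T zf k] .
    finally show ?thesis using y(3) by simp
  qed
  note f_bound = this
  show ?case
  proof (intro bexI[OF _ v(1)] ballI impI)
    fix x' g assume x': "x' \<in> D" "v \<subseteq> x'" and g: "g \<in> insert f \<F>"
    then show "l2_norm M (\<lambda>w. sf_proj M x' g w - sf_proj M ?z g w) < e"
      using f_bound[OF x'] x(2) x'(1) order_trans[OF v(2) x'(2)] by (cases "g = f") simp_all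
  qed
qed

lemma directed_Sup_in_closure:
  assumes B: "B \<subseteq> subfields M" and D: "D \<noteq> {}" "D \<subseteq> B"
    and dir: "\<And>x y. x \<in> D \<Longrightarrow> y \<in> D \<Longrightarrow> \<exists>z\<in>D. x \<subseteq> z \<and> y \<subseteq> z"
  shows "sf_Sup M D \<in> sf_topology M closure_of B"
proof (rule closure_of_sf_topologyI[OF _ B])
  have DT: "x \<in> subfields M" if "x \<in> D" for x using that D B by blast
  then show "sf_Sup M D \<in> subfields M" by (rule sf_Sup_subfields)
  fix \<F> :: "('a \<Rightarrow> complex) set" and e :: real
  assume "finite \<F>" "\<F> \<subseteq> L2 M" "e > 0"
  then show "\<exists>x\<in>B. \<forall>f\<in>\<F>. l2_norm M (\<lambda>w. sf_proj M x f w - sf_proj M (sf_Sup M D) f w) < e"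
    using directed_Sup_sf_proj_limit[OF D(1) DT dir, where \<F> = \<F> and e = e] D(2)
    by (meson subsetD subset_refl)
qed

section \<open>Independence and complements\<close>

lemma l2_inner_indicators:
  assumes "C \<in> events" "D \<in> events"
  shows "l2_inner M (indicator C) (indicator D) = of_real (prob (C \<inter> D))"
proof -
  have "l2_inner M (indicator C) (indicator D) = (\<integral>w. complex_of_real (indicator (C \<inter> D) w) \<partial>M)"
    unfolding l2_inner_def by (intro Bochner_Integration.integral_cong) (auto simp: indicator_def)
  then show ?thesis using assms by (simp only: integral_complex_of_real) simp
qed

lemma l2_inner_const_indicator:
  assumes "D \<in> events"
  shows "l2_inner M (\<lambda>_. c) (indicator D) = c * of_real (prob D)"
proof -
  have "l2_inner M (\<lambda>_. c) (indicator D) = l2_inner M (\<lambda>w. c * indicator (space M) w) (indicator D)"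
    unfolding l2_inner_def by (intro Bochner_Integration.integral_cong) auto
  then show ?thesis
    using assms sets.sets_into_space[OF assms]
    by (simp add: l2_inner_scale_left l2_inner_indicators Int_absorb1)
qed

lemma l2_inner_indicator_Int:
  "l2_inner M f (indicator (E \<inter> D)) = l2_inner M (\<lambda>w. f w * indicator D w) (indicator E)"
  unfolding l2_inner_def
  by (intro Bochner_Integration.integral_cong) (auto simp: indicator_def)

lemma integral_eq_l2_inner: "integral\<^sup>L M (\<lambda>w. f w * indicator D w) = l2_inner M f (indicator D)"
  unfolding l2_inner_def
  by (intro Bochner_Integration.integral_cong) (auto simp: indicator_def)

lemma integral_complex_indicator:
  "D \<in> events \<Longrightarrow> (\<integral>w. (indicator D w :: complex) \<partial>M) = of_real (prob D)"
  using integral_eq_l2_inner[of "\<lambda>_. 1" D] by (simp add: l2_inner_const_indicator)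

lemma indep_set_commute: "indep_set x y \<Longrightarrow> indep_set y x"
  unfolding indep_sets2_eq by (metis Int_commute mult.commute)

lemma L2_sub_mult_indicator:
  assumes x: "x \<in> subfields M" and f: "f \<in> L2_sub M x" and D: "D \<in> x"
  shows "(\<lambda>w. f w * indicator D w) \<in> L2_sub M x"
proof -
  have "f \<in> borel_measurable (sigma (space M) x)"
    "(indicator D :: 'a \<Rightarrow> complex) \<in> borel_measurable (sigma (space M) x)"
    using L2_subD(2)[OF f] L2_subD(2)[OF L2_sub_indicator[OF x D]] by auto
  then have "(\<lambda>w. f w * indicator D w) \<in> borel_measurable (sigma (space M) x)"
    by (rule borel_measurable_times)
  then show ?thesis
    using L2_mult_indicator[OF L2_subD(1)[OF f]] D subfieldsD(2)[OF x] by (auto simp: L2_sub_def)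
qed

lemma L2_AE_zero_if_orthogonal_to_join:
  assumes x: "x \<in> subfields M" and y: "y \<in> subfields M" and join: "sf_join M x y = sets M"
    and j: "j \<in> L2 M" and jCD: "\<And>C D. C \<in> x \<Longrightarrow> D \<in> y \<Longrightarrow> l2_inner M j (indicator (C \<inter> D)) = 0"
  shows "AE w in M. j w = 0"
proof -
  have "j \<in> L2_sub M (sf_join M x y)" using j join by simp
  then have "l2_inner M j j = 0" by (rule orthogonal_to_join[OF x y j, rotated]) (rule jCD)
  then show ?thesis using l2_norm_eq_0_iff[OF j] by (simp add: l2_inner_self)
qed

lemma in_subfield_if_proj_residual_zero:
  assumes x: "x \<in> subfields M" and C: "C \<in> events"
    and res: "AE w in M. indicator C w - sf_proj M x (indicator C) w = 0"
  shows "C \<in> x"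
proof (rule event_in_subfield[OF x C sf_proj_in_L2_sub[OF x L2_indicator[OF C]]])
  show "AE w in M. sf_proj M x (indicator C) w = indicator C w"
    using res by eventually_elim simp
qed

text \<open>Commuting projections multiply to the projection of the meet, which here is the
  expectation. Hence \<open>P(D \<inter> E) = <Q_y 1_D, 1_E> = <Q_x Q_y 1_D, 1_E> = P(D)
  P(E)\<close>.\<close>

lemma indep_set_if_commute:
  assumes x: "x \<in> subfields M" and y: "y \<in> subfields M" and xy: "x \<inter> y = sf_zero M"
    and comm: "op_eq M (sf_proj M x \<circ> sf_proj M y) (sf_proj M y \<circ> sf_proj M x)"
  shows "indep_set x y"
proof (rule indep_setI)
  show "x \<subseteq> events" "y \<subseteq> events" using x y by (auto dest: subfieldsD(2))
  fix E D assume E: "E \<in> x" and D: "D \<in> y"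
  have ED [measurable]: "E \<in> events" "D \<in> events" using E D x y by (auto dest: subfieldsD(2))
  let ?d = "indicator D :: 'a \<Rightarrow> complex"
  have d: "?d \<in> L2 M" using ED(2) by (rule L2_indicator)
  have e: "indicator E \<in> L2_sub M x" using E by (rule L2_sub_indicator[OF x])
  have "AE w in M. sf_proj M x (sf_proj M y ?d) w = sf_proj M y (sf_proj M x ?d) w"
    using comm d by (simp add: op_eq_def)
  from sf_proj_commute_Int[OF x y d this] sf_proj_zero[OF d]
  have const: "AE w in M. sf_proj M x (sf_proj M y ?d) w = of_real (prob D)"
    unfolding xy by eventually_elim (simp add: integral_complex_indicator[OF ED(2)])
  have "complex_of_real (prob (D \<inter> E)) = l2_inner M ?d (indicator E)"
    using ED by (simp add: l2_inner_indicators)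
  also have "\<dots> = l2_inner M (sf_proj M y ?d) (indicator E)"
  proof (rule l2_inner_cong_AE)
    show "AE w in M. ?d w = sf_proj M y ?d w"
      using sf_proj_id[OF y L2_sub_indicator[OF y D]] by eventually_elim simp
  qed (use L2_measurable[OF sf_proj_L2[OF y d]] in auto)
  also have "\<dots> = l2_inner M (sf_proj M x (sf_proj M y ?d)) (indicator E)"
    using x y d e by (simp add: sf_proj_inner sf_proj_L2)
  also have "\<dots> = l2_inner M (\<lambda>_. of_real (prob D)) (indicator E)"
    using const L2_measurable[OF sf_proj_L2[OF x sf_proj_L2[OF y d]]]
    by (intro l2_inner_cong_AE) auto
  also have "\<dots> = of_real (prob D * prob E)" by (simp add: l2_inner_const_indicator)
  finally have "prob (D \<inter> E) = prob D * prob E" using of_real_eq_iff by blast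
  then show "prob (E \<inter> D) = prob E * prob D" by (simp add: Int_commute mult.commute)
qed

text \<open>By independence the centred indicator \<open>1_D - P(D)\<close> is orthogonal to the
  indicators of \<open>x\<close>, hence to all of \<open>L2_sub M x\<close>.\<close>

lemma indep_set_l2_inner_indicator:
  assumes ind: "indep_set x y" and x: "x \<in> subfields M"
    and f: "f \<in> L2_sub M x" and D: "D \<in> y"
  shows "l2_inner M f (indicator D) = integral\<^sup>L M f * of_real (prob D)"
proof -
  have DM: "D \<in> events" using ind D indep_setD_ev2 by blast
  let ?j = "\<lambda>w. indicator D w - complex_of_real (prob D)"
  have d: "indicator D \<in> L2 M" using DM by (rule L2_indicator)
  have j: "?j \<in> L2 M" using d L2_const by (rule L2_diff)
  have "l2_inner M ?j f = 0"
  proof (rule orthogonal_to_L2_sub_if_indicators[OF x j _ f])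
    fix C assume C: "C \<in> x"
    then have CM: "C \<in> events" using x by (auto dest: subfieldsD(2))
    show "l2_inner M ?j (indicator C) = 0"
      using indep_setD[OF ind C D] L2_indicator[OF CM] d CM DM
      by (simp add: l2_inner_diff_left L2_const l2_inner_indicators l2_inner_const_indicator
          Int_commute mult.commute)
  qed
  then have "l2_inner M (indicator D) f = l2_inner M (\<lambda>_. of_real (prob D)) f"
    using d L2_subD(1)[OF f] by (simp add: l2_inner_diff_left L2_const)
  then have "l2_inner M f (indicator D) = l2_inner M f (\<lambda>_. of_real (prob D))"
    using l2_inner_commute by metis
  then show ?thesis by (simp add: l2_inner_def)
qed

text \<open>A residual \<open>1_C - Q_t 1_C\<close> is orthogonal to products of \<open>t\<close>-events with \<open>x\<close>-events,
  and these products generate everything.\<close>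

lemma subfield_eq_if_join_indep:
  assumes x: "x \<in> subfields M" and t: "t \<in> subfields M" and w: "w \<in> subfields M"
    and tw: "t \<subseteq> w" and ind: "indep_set x w" and join: "sf_join M x t = sets M"
  shows "w = t"
proof
  show "w \<subseteq> t"
  proof
    fix C assume C: "C \<in> w"
    then have CM: "C \<in> events" using w by (auto dest: subfieldsD(2))
    let ?c = "indicator C :: 'a \<Rightarrow> complex" let ?k = "\<lambda>w. ?c w - sf_proj M t ?c w"
    have c: "?c \<in> L2_sub M w" using C by (rule L2_sub_indicator[OF w])
    have Qc: "sf_proj M t ?c \<in> L2_sub M t" using L2_indicator[OF CM] by (rule sf_proj_in_L2_sub[OF t])
    have k: "?k \<in> L2_sub M w" using c Qc L2_sub_mono[OF t w tw] by (intro L2_sub_diff) auto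
    have ind': "indep_set w x"
      using ind by (rule indep_set_commute)
    have "AE v in M. ?k v = 0"
    proof (rule L2_AE_zero_if_orthogonal_to_join[OF x t join L2_subD(1)[OF k]])
      fix E D assume E: "E \<in> x" and D: "D \<in> t"
      have "l2_inner M ?k (indicator (E \<inter> D)) = l2_inner M (\<lambda>v. ?k v * indicator D v) (indicator E)"
        by (rule l2_inner_indicator_Int)
      \<comment> \<open>Since \<open>t \<subseteq> w\<close>, the product \<open>?k * 1_D\<close> is
        still measurable in \<open>w\<close>. Independence from \<open>x\<close> therefore splits
        off \<open>E\<close> and leaves an inner product with an event of \<open>t\<close>.\<close>
      also have "\<dots> = l2_inner M ?k (indicator D) * of_real (prob E)"
        using indep_set_l2_inner_indicator[OF ind' w L2_sub_mult_indicator[OF w k] E] D tw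
        by (auto simp: integral_eq_l2_inner)
      also have "l2_inner M ?k (indicator D) = 0"
        using D by (intro sf_proj_orthogonal[OF t L2_indicator[OF CM]] L2_sub_indicator[OF t])
      finally show "l2_inner M ?k (indicator (E \<inter> D)) = 0" by simp
    qed
    then show "C \<in> t" by (rule in_subfield_if_proj_residual_zero[OF t CM])
  qed
qed (rule tw)

text \<open>For \<open>z \<in> B\<close> the projection \<open>Q_z\<close> acts on products of \<open>u\<close>- and \<open>v\<close>-measurable functions
  factorwise; this is the part of that statement which survives in the strong closure.\<close>

lemma distributive_proj_product:
  assumes u: "u \<in> subfields M" and v: "v \<in> subfields M" and z: "z \<in> subfields M"
    and ind: "indep_set u v" and dist: "z = sf_join M (z \<inter> u) (z \<inter> v)"
    and comm: "op_eq M (sf_proj M z \<circ> sf_proj M u) (sf_proj M u \<circ> sf_proj M z)"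
    and E: "E \<in> u" and D: "D \<in> v" and k: "k \<in> L2_sub M z"
  shows "l2_inner M (\<lambda>w. (indicator E w - sf_proj M z (indicator E) w) * indicator D w) k = 0"
proof -
  have [measurable]: "E \<in> events" "D \<in> events" using E D u v by (auto dest: subfieldsD(2))
  let ?e = "indicator E :: 'a \<Rightarrow> complex"
  have e: "?e \<in> L2 M" by (rule L2_indicator) measurable
  have zu: "z \<inter> u \<in> subfields M" and zv: "z \<inter> v \<in> subfields M"
    using z u v by (auto intro: subfields_Int)
  let ?g = "sf_proj M (z \<inter> u) ?e"
  have g: "?g \<in> L2_sub M (z \<inter> u)" using e by (rule sf_proj_in_L2_sub[OF zu])
  \<comment> \<open>Commutation identifies \<open>Q_z 1_E\<close> with the projection of
    \<open>1_E\<close> onto \<open>z \<inter> u\<close>, which is measurable in \<open>u\<close>.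
    Only then does independence of \<open>u\<close> and \<open>v\<close> apply.\<close>
  have "AE w in M. ?g w = sf_proj M z (sf_proj M u ?e) w"
    using comm e by (intro sf_proj_commute_Int[OF z u e]) (simp add: op_eq_def)
  moreover have "AE w in M. sf_proj M z (sf_proj M u ?e) w = sf_proj M z ?e w"
    using sf_proj_id[OF u L2_sub_indicator[OF u E]] e u
    by (intro sf_proj_cong_AE[OF z]) (auto intro: sf_proj_L2)
  ultimately have g_eq: "AE w in M. sf_proj M z ?e w = ?g w" by eventually_elim simp
  let ?h = "\<lambda>w. ?e w - ?g w" and ?j = "\<lambda>w. (?e w - ?g w) * indicator D w"
  have h: "?h \<in> L2_sub M u"
    using g L2_sub_mono[OF zu u] L2_sub_indicator[OF u E] by (intro L2_sub_diff) auto
  have j: "?j \<in> L2 M" using L2_subD(1)[OF h] by (rule L2_mult_indicator) measurable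
  have "l2_inner M ?j k = 0"
  proof (rule orthogonal_to_join[OF zu zv j])
    show "k \<in> L2_sub M (sf_join M (z \<inter> u) (z \<inter> v))" using k dist by simp
    fix C C' assume C: "C \<in> z \<inter> u" and C': "C' \<in> z \<inter> v"
    interpret v: sigma_algebra "space M" v using v by (rule subfieldsD)
    have DC: "D \<inter> C' \<in> v" using D C' by (intro v.Int) auto
    \<comment> \<open>Distributivity has reduced the test functions to products
      \<open>C \<inter> C'\<close>; regrouping now puts all factors from \<open>u\<close> on one
      side and all factors from \<open>v\<close> on the other.\<close>
    have "l2_inner M ?j (indicator (C \<inter> C')) = l2_inner M (\<lambda>w. ?h w * indicator C w) (indicator (D \<inter> C'))"
      unfolding l2_inner_def
      by (intro Bochner_Integration.integral_cong) (auto simp: indicator_def)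
    also have "\<dots> = l2_inner M ?h (indicator C) * of_real (prob (D \<inter> C'))"
      using indep_set_l2_inner_indicator[OF ind u L2_sub_mult_indicator[OF u h] DC] C
      by (auto simp: integral_eq_l2_inner)
    also have "l2_inner M ?h (indicator C) = 0"
      using C by (intro sf_proj_orthogonal[OF zu e] L2_sub_indicator[OF zu])
    finally show "l2_inner M ?j (indicator (C \<inter> C')) = 0" by simp
  qed
  moreover have "l2_inner M (\<lambda>w. (?e w - sf_proj M z ?e w) * indicator D w) k = l2_inner M ?j k"
  proof (rule l2_inner_cong_AE)
    show "AE w in M. (?e w - sf_proj M z ?e w) * indicator D w = ?j w"
      using g_eq by eventually_elim simp
    show "(\<lambda>w. (?e w - sf_proj M z ?e w) * indicator D w) \<in> borel_measurable M"
      using L2_measurable[OF sf_proj_L2[OF z e]] by measurable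
  qed (use L2_measurable[OF j] L2_measurable[OF L2_subD(1)[OF k]] in auto)
  ultimately show ?thesis by simp
qed

text \<open>For \<open>y\<close> in \<open>B\<close>, distributivity alone gives
  \<open>y = y \<inter> v\<close>. A closure element is not known to satisfy it, so elements
  \<open>z\<close> of \<open>B\<close> near \<open>y\<close> are used: \<open>Q_z 1_E\<close> is
  near \<open>Q_y 1_E = P(E)\<close>, and \<open>Q_z 1_C\<close> is near \<open>1_C\<close>. In the
  limit \<open>distributive_proj_product\<close> yields
  \<open>P(E \<inter> D \<inter> C) = P(E) P(D \<inter> C)\<close>, which says that
  \<open>1_C\<close> and \<open>Q_v 1_C\<close> have the same inner product with every
  \<open>E \<inter> D\<close>.\<close>

lemma closure_element_le_complement:
  assumes B: "B \<subseteq> subfields M" and u: "u \<in> B" and v: "v \<in> B" and y: "y \<in> sf_topology M closure_of B"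
    and ind: "indep_set u v" and join: "sf_join M u v = sets M"
    and dist: "\<And>z. z \<in> B \<Longrightarrow> z = sf_join M (z \<inter> u) (z \<inter> v)"
    and comm: "\<And>z. z \<in> sf_topology M closure_of B \<Longrightarrow>
      op_eq M (sf_proj M z \<circ> sf_proj M u) (sf_proj M u \<circ> sf_proj M z)"
    and disj: "y \<inter> u = sf_zero M"
  shows "y \<subseteq> v"
proof -
  have uT: "u \<in> subfields M" and vT: "v \<in> subfields M" using B u v by auto
  have yT: "y \<in> subfields M" using y by (rule closure_of_sf_topology_subfields)
  have BT: "z \<in> subfields M" and BC: "z \<in> sf_topology M closure_of B" if "z \<in> B" for z
    using that B closure_of_subset[of B "sf_topology M"] by (auto simp: topspace_sf_topology)
  have prod: "prob (E \<inter> D \<inter> C) = prob E * prob (D \<inter> C)" if E: "E \<in> u" and D: "D \<in> v" and C: "C \<in> y" for E D C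
  proof -
    have EM [measurable]: "E \<in> events" "D \<in> events" "C \<in> events"
      using E D C uT vT yT by (auto dest: subfieldsD(2))
    let ?e = "indicator E :: 'a \<Rightarrow> complex" and ?c = "indicator C :: 'a \<Rightarrow> complex"
    let ?d = "indicator D :: 'a \<Rightarrow> complex" and ?p = "complex_of_real (prob E)"
    have e: "?e \<in> L2 M" and c: "?c \<in> L2 M" by (rule L2_indicator; measurable)+
    have cn: "l2_norm M ?c \<le> 1" and en: "l2_norm M ?e \<le> 1"
      using EM by (auto intro: l2_norm_indicator_le)
    \<comment> \<open>As \<open>y\<close> and \<open>u\<close> have trivial meet, commutation makes
      \<open>Q_y Q_u\<close> the expectation; \<open>Q_u\<close> fixes \<open>1_E\<close>, so
      \<open>Q_y 1_E\<close> is the constant \<open>P(E)\<close>.\<close>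
    have "AE w in M. sf_proj M y (sf_proj M u ?e) w = sf_proj M u (sf_proj M y ?e) w"
      using comm[OF y] e by (simp add: op_eq_def)
    from sf_proj_commute_Int[OF yT uT e this]
    have "AE w in M. sf_proj M (sf_zero M) ?e w = sf_proj M y (sf_proj M u ?e) w"
      unfolding disj .
    moreover have "AE w in M. sf_proj M y (sf_proj M u ?e) w = sf_proj M y ?e w"
      using sf_proj_id[OF uT L2_sub_indicator[OF uT E]] e uT
      by (intro sf_proj_cong_AE[OF yT]) (auto intro: sf_proj_L2)
    ultimately have ye: "AE w in M. sf_proj M y ?e w = ?p"
      using sf_proj_zero[OF e] by eventually_elim (simp add: integral_complex_indicator[OF EM(1)])
    have yc: "AE w in M. sf_proj M y ?c w = ?c w"
      using L2_sub_indicator[OF yT C] by (rule sf_proj_id[OF yT])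
    let ?r = "l2_inner M (\<lambda>w. (?e w - ?p) * ?d w) ?c"
    have bound: "cmod ?r \<le> 0 + \<epsilon>" if \<epsilon>: "\<epsilon> > 0" for \<epsilon> :: real
    proof -
      from \<epsilon> have "\<epsilon> / 2 > 0" by simp
      from closure_of_sf_topologyD[OF y e c this] obtain z where z: "z \<in> B"
        and ze': "l2_norm M (\<lambda>w. sf_proj M z ?e w - sf_proj M y ?e w) < \<epsilon> / 2"
        and zc': "l2_norm M (\<lambda>w. sf_proj M z ?c w - sf_proj M y ?c w) < \<epsilon> / 2" by blast
      have zT: "z \<in> subfields M" using z by (rule BT)
      let ?ze = "sf_proj M z ?e" and ?zc = "sf_proj M z ?c"
      have zeL: "?ze \<in> L2 M" and zcL: "?zc \<in> L2 M" and yeL: "sf_proj M y ?e \<in> L2 M"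
        and ycL: "sf_proj M y ?c \<in> L2 M"
        using e c zT yT by (auto intro: sf_proj_L2)
      note [measurable] = zeL zcL yeL ycL
      have ze: "l2_norm M (\<lambda>w. ?ze w - ?p) < \<epsilon> / 2"
      proof -
        have "l2_norm M (\<lambda>w. ?ze w - ?p) = l2_norm M (\<lambda>w. ?ze w - sf_proj M y ?e w)"
        proof (rule l2_norm_cong_AE)
          show "AE w in M. ?ze w - ?p = ?ze w - sf_proj M y ?e w" using ye by eventually_elim simp
        qed measurable
        then show ?thesis using ze' by simp
      qed
      have zc: "l2_norm M (\<lambda>w. ?c w - ?zc w) < \<epsilon> / 2"
      proof -
        have "l2_norm M (\<lambda>w. ?c w - ?zc w) = l2_norm M (\<lambda>w. sf_proj M y ?c w - ?zc w)"
        proof (rule l2_norm_cong_AE)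
          show "AE w in M. ?c w - ?zc w = sf_proj M y ?c w - ?zc w" using yc by eventually_elim simp
        qed measurable
        then show ?thesis using zc' l2_norm_minus_commute[of M ?zc "sf_proj M y ?c"] by simp
      qed
      \<comment> \<open>The function \<open>1_E - P(E)\<close> is split at \<open>Q_z 1_E\<close>.
        The first part is orthogonal to \<open>Q_z 1_C\<close> and sees only the small remainder of
        \<open>1_C\<close>; the second part is small itself. Each contributes at most half of
        \<epsilon>.\<close>
      let ?j = "\<lambda>w. (?e w - ?ze w) * ?d w" and ?q = "\<lambda>w. (?ze w - ?p) * ?d w"
      have d1: "(\<lambda>w. ?e w - ?ze w) \<in> L2 M" and d2: "(\<lambda>w. ?ze w - ?p) \<in> L2 M"
        using e zeL L2_const by (auto intro: L2_diff)
      have j: "?j \<in> L2 M" and q: "?q \<in> L2 M"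
        using d1 d2 EM by (auto intro: L2_mult_indicator)
      have "l2_norm M ?j \<le> l2_norm M (\<lambda>w. ?e w - ?ze w)"
        using L2_measurable[OF j] d1 by (intro l2_norm_mono) (auto simp: indicator_def)
      also have "\<dots> \<le> l2_norm M (\<lambda>w. ?e w - 0)"
        by (rule sf_proj_best[OF zT e L2_sub_const[OF zT]])
      finally have jn: "l2_norm M ?j \<le> 1" using en by simp
      have "l2_norm M ?q \<le> l2_norm M (\<lambda>w. ?ze w - ?p)"
        using L2_measurable[OF q] d2 by (intro l2_norm_mono) (auto simp: indicator_def)
      then have qn: "l2_norm M ?q \<le> \<epsilon> / 2" using ze by simp
      have "l2_inner M ?j ?zc = 0"
        using distributive_proj_product[OF uT vT zT ind dist[OF z] comm[OF BC[OF z]] E D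
            sf_proj_in_L2_sub[OF zT c]] .
      then have "l2_inner M ?j ?c = l2_inner M ?j (\<lambda>w. ?c w - ?zc w)"
        using j c zcL by (simp add: l2_inner_diff_right)
      then have "cmod (l2_inner M ?j ?c) \<le> l2_norm M ?j * l2_norm M (\<lambda>w. ?c w - ?zc w)"
        using l2_Cauchy_Schwarz[OF j L2_diff[OF c zcL]] by simp
      also have "\<dots> \<le> 1 * (\<epsilon> / 2)" using jn zc by (intro mult_mono) auto
      finally have 1: "cmod (l2_inner M ?j ?c) \<le> \<epsilon> / 2" by simp
      have "cmod (l2_inner M ?q ?c) \<le> l2_norm M ?q * l2_norm M ?c"
        using q c by (rule l2_Cauchy_Schwarz)
      also have "\<dots> \<le> (\<epsilon> / 2) * 1" using qn cn \<epsilon> by (intro mult_mono) auto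
      finally have 2: "cmod (l2_inner M ?q ?c) \<le> \<epsilon> / 2" by simp
      have "?r = l2_inner M (\<lambda>w. ?j w + ?q w) ?c" by (simp add: algebra_simps)
      also have "\<dots> = l2_inner M ?j ?c + l2_inner M ?q ?c" using j q c by (rule l2_inner_add_left)
      finally show ?thesis using 1 2 norm_triangle_ineq[of "l2_inner M ?j ?c" "l2_inner M ?q ?c"] by simp
    qed
    have "cmod ?r \<le> 0" using bound by (rule field_le_epsilon)
    then have r0: "?r = 0" by simp
    have "?r = l2_inner M (\<lambda>w. indicator (E \<inter> D) w - ?p * ?d w) ?c"
      by (intro arg_cong2[where f = "l2_inner M"] ext) (auto simp: indicator_def)
    also have "\<dots> = of_real (prob (E \<inter> D \<inter> C)) - ?p * of_real (prob (D \<inter> C))"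
      using EM c L2_indicator
      by (simp add: l2_inner_diff_left L2_scale l2_inner_scale_left l2_inner_indicators sets.Int)
    finally have "complex_of_real (prob (E \<inter> D \<inter> C)) = of_real (prob E * prob (D \<inter> C))"
      using r0 by simp
    then show ?thesis using of_real_eq_iff by blast
  qed
  show ?thesis
  proof
    fix C assume C: "C \<in> y"
    then have CM: "C \<in> events" using yT by (auto dest: subfieldsD(2))
    let ?c = "indicator C :: 'a \<Rightarrow> complex"
    have c: "?c \<in> L2 M" using CM by (rule L2_indicator)
    let ?Qc = "sf_proj M v ?c"
    have Qc: "?Qc \<in> L2_sub M v" using c by (rule sf_proj_in_L2_sub[OF vT])
    have ind': "indep_set v u"
      using ind by (rule indep_set_commute)
    have "AE w in M. ?c w - ?Qc w = 0"
    proof (rule L2_AE_zero_if_orthogonal_to_join[OF uT vT join L2_diff[OF c L2_subD(1)[OF Qc]]])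
      fix E D assume E: "E \<in> u" and D: "D \<in> v"
      have EM: "E \<in> events" "D \<in> events" using E D uT vT by (auto dest: subfieldsD(2))
      then have ED: "E \<inter> D \<in> events" by blast
      \<comment> \<open>Independence of \<open>v\<close> and \<open>u\<close> extracts
        \<open>P(E)\<close>, and \<open>Q_v\<close> drops out against \<open>D\<close>. By
        \<open>prod\<close> the result is the inner product of \<open>1_C\<close> itself with
        \<open>1_(E \<inter> D)\<close>.\<close>
      have "l2_inner M ?Qc (indicator (E \<inter> D)) = l2_inner M ?Qc (indicator D) * of_real (prob E)"
        using indep_set_l2_inner_indicator[OF ind' vT L2_sub_mult_indicator[OF vT Qc D] E]
        by (simp add: l2_inner_indicator_Int integral_eq_l2_inner)
      also have "l2_inner M ?Qc (indicator D) = l2_inner M ?c (indicator D)"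
        using D by (intro sf_proj_inner[OF vT c] L2_sub_indicator[OF vT])
      also have "\<dots> = of_real (prob (C \<inter> D))" using CM EM by (simp add: l2_inner_indicators)
      finally have "l2_inner M ?Qc (indicator (E \<inter> D)) = of_real (prob (E \<inter> D \<inter> C))"
        using prod[OF E D C] by (simp add: Int_commute mult.commute)
      moreover have "l2_inner M ?c (indicator (E \<inter> D)) = of_real (prob (E \<inter> D \<inter> C))"
        using CM ED by (simp add: l2_inner_indicators Int_commute)
      ultimately show "l2_inner M (\<lambda>w. ?c w - ?Qc w) (indicator (E \<inter> D)) = 0"
        using c L2_subD(1)[OF Qc] L2_indicator[OF ED] by (simp add: l2_inner_diff_left)
    qed
    then show "C \<in> v" by (rule in_subfield_if_proj_residual_zero[OF vT CM])
  qed
qed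

end

section \<open>Intersections of sub-sigma-fields and joins of suprema\<close>

lemma subfields_Inter:
  assumes "\<X> \<noteq> {}" "\<And>x. x \<in> \<X> \<Longrightarrow> x \<in> subfields M"
  shows "\<Inter>\<X> \<in> subfields M"
proof -
  obtain x where "x \<in> \<X>" using assms(1) by blast
  then have "\<Inter>\<X> \<subseteq> sets M" using assms(2) subfieldsD(2) by blast
  moreover have "null_sets M \<subseteq> \<Inter>\<X>" using assms(2) subfieldsD(3) by blast
  moreover have "sigma_algebra (space M) (\<Inter>\<X>)"
  proof (subst sigma_algebra_iff2, intro conjI ballI allI impI InterI)
    show "\<Inter>\<X> \<subseteq> Pow (space M)" using calculation(1) sets.space_closed by blast
    fix x assume x: "x \<in> \<X>"
    interpret sigma_algebra "space M" x using assms(2)[OF x] by (rule subfieldsD)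
    show "{} \<in> x" by blast
    show "space M - S \<in> x" if "S \<in> \<Inter>\<X>" for S using that x by blast
    show "\<Union>(range E) \<in> x" if "range E \<subseteq> \<Inter>\<X>" for E :: "nat \<Rightarrow> _"
      using that x by (intro countable_UN) blast
  qed
  ultimately show ?thesis by (simp add: subfields_def)
qed

lemma sf_join_mono: "x \<subseteq> x' \<Longrightarrow> y \<subseteq> y' \<Longrightarrow> sf_join M x y \<subseteq> sf_join M x' y'"
  unfolding sf_join_def by (rule sigma_sets_mono') blast

text \<open>Turns a join of two suprema into the supremum of one family, so that the spectral
  criteria for directed families in \<open>B\<close> apply to it.\<close>

lemma sf_join_sf_Sup:
  assumes S: "S \<noteq> {}" "\<And>x. x \<in> S \<Longrightarrow> x \<in> subfields M"
    and T: "T \<noteq> {}" "\<And>y. y \<in> T \<Longrightarrow> y \<in> subfields M"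
  shows "sf_join M (sf_Sup M S) (sf_Sup M T) = sf_Sup M ((\<lambda>(x, y). sf_join M x y) ` (S \<times> T))"
    (is "_ = sf_Sup M ?D")
proof
  have J: "z \<in> subfields M" if z: "z \<in> ?D" for z
  proof -
    obtain x y where "z = sf_join M x y" "x \<in> S" "y \<in> T" using z by auto
    then show ?thesis using sf_join_subfields[OF S(2) T(2)] by simp
  qed
  have D: "sf_Sup M ?D \<in> subfields M" using J by (rule sf_Sup_subfields)
  have "x \<subseteq> sf_Sup M ?D" "y \<subseteq> sf_Sup M ?D" if "x \<in> S" "y \<in> T" for x y
  proof -
    have "sf_join M x y \<subseteq> sf_Sup M ?D" using that by (intro sf_Sup_upper) auto
    then show "x \<subseteq> sf_Sup M ?D" "y \<subseteq> sf_Sup M ?D" using sf_join_upper by blast+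
  qed
  then show "sf_join M (sf_Sup M S) (sf_Sup M T) \<subseteq> sf_Sup M ?D"
    using S(1) T(1) by (intro sf_join_least sf_Sup_least D) blast+
  have st: "sf_Sup M S \<in> subfields M" "sf_Sup M T \<in> subfields M"
    using S(2) T(2) by (auto intro: sf_Sup_subfields)
  show "sf_Sup M ?D \<subseteq> sf_join M (sf_Sup M S) (sf_Sup M T)"
  proof (rule sf_Sup_least[OF sf_join_subfields[OF st]])
    fix z assume "z \<in> ?D"
    then obtain x y where "x \<in> S" "y \<in> T" "z = sf_join M x y" by auto
    then show "z \<subseteq> sf_join M (sf_Sup M S) (sf_Sup M T)"
      using sf_Sup_upper[of x S M] sf_Sup_upper[of y T M] sf_join_mono by simp
  qed
qed

section \<open>Spectral sets\<close>

locale spectral_noise_algebra = prob_space M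
  for M :: "'a measure" +
  fixes B :: "'a set set set" and N :: "'s measure"
    and \<alpha> :: "'a operator \<Rightarrow> 's \<Rightarrow> complex" and Sp :: "'a set set \<Rightarrow> 's set"
  assumes noise: "noise_boolean_algebra M B" and spectral: "spectral_space M B N \<alpha> Sp"
begin

abbreviation "\<A> \<equiv> vn_generated M (sf_proj M ` B)"
abbreviation "ClB \<equiv> sf_topology M closure_of B"

lemma B_subfields: "B \<subseteq> subfields M"
  using noise by (simp add: noise_boolean_algebra_def)

lemma B_subset_ClB: "B \<subseteq> ClB"
  using B_subfields by (intro closure_of_subset) (simp add: topspace_sf_topology)

lemma vn_\<A>: "von_neumann_algebra M \<A>"
  using B_subfields sf_proj_bounded_ops by (intro von_neumann_algebra_vn_generated) blast

lemma iso: "vn_isomorphism M \<A> N \<alpha>"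
  using spectral by (simp add: spectral_space_def)

lemma
  shows alpha_op_eq: "T \<in> \<A> \<Longrightarrow> U \<in> \<A> \<Longrightarrow> op_eq M T U \<longleftrightarrow> (AE s in N. \<alpha> T s = \<alpha> U s)"
    and alpha_id: "AE s in N. \<alpha> id s = 1"
    and alpha_scale: "T \<in> \<A> \<Longrightarrow> AE s in N. \<alpha> (\<lambda>f w. c * T f w) s = c * \<alpha> T s"
    and alpha_comp: "T \<in> \<A> \<Longrightarrow> U \<in> \<A> \<Longrightarrow> AE s in N. \<alpha> (T \<circ> U) s = \<alpha> T s * \<alpha> U s"
    and alpha_surj: "g \<in> L_infinity N \<Longrightarrow> \<exists>T\<in>\<A>. AE s in N. \<alpha> T s = g s"
  using iso unfolding vn_isomorphism_def by blast+

lemma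
  assumes "x \<in> B"
  shows Sp_sets: "Sp x \<in> sets N"
    and alpha_proj: "AE s in N. \<alpha> (sf_proj M x) s = indicator (Sp x) s"
  using spectral assms by (auto simp: spectral_space_def)

lemma ClB_proj_in_\<A>: "y \<in> ClB \<Longrightarrow> sf_proj M y \<in> \<A>"
  using B_subfields by (rule sf_proj_closure_in_vn_generated[rotated])

lemma ClB_commute:
  "x \<in> ClB \<Longrightarrow> y \<in> ClB \<Longrightarrow> op_eq M (sf_proj M x \<circ> sf_proj M y) (sf_proj M y \<circ> sf_proj M x)"
  by (intro vn_isomorphism_commute[OF iso vn_\<A>] ClB_proj_in_\<A>)

text \<open>The definition of \<open>B\<close> provides independence only from some complement
  within \<open>B\<close>. In the closure independence is a consequence of commutation and trivial
  meet.\<close>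

lemma ClB_indep:
  "x \<in> ClB \<Longrightarrow> y \<in> ClB \<Longrightarrow> x \<inter> y = sf_zero M \<Longrightarrow> indep_set x y"
  by (intro indep_set_if_commute ClB_commute) (auto intro: closure_of_sf_topology_subfields)

lemma ClB_le_complement:
  assumes u: "u \<in> B" and v: "v \<in> B" and uv: "u \<inter> v = sf_zero M" "sf_join M u v = sets M"
    and y: "y \<in> ClB" "y \<inter> u = sf_zero M"
  shows "y \<subseteq> v"
proof (rule closure_element_le_complement[OF B_subfields u v y(1) _ uv(2) _ _ y(2)])
  show "indep_set u v" using u v uv(1) B_subset_ClB by (intro ClB_indep) auto
  show "op_eq M (sf_proj M z \<circ> sf_proj M u) (sf_proj M u \<circ> sf_proj M z)" if "z \<in> ClB" for z
    using that u B_subset_ClB by (intro ClB_commute) auto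
  show "z = sf_join M (z \<inter> u) (z \<inter> v)" if z: "z \<in> B" for z
  proof -
    have "z \<inter> sf_join M u v = sf_join M (z \<inter> u) (z \<inter> v)"
      using noise z u v by (simp add: noise_boolean_algebra_def)
    moreover have "z \<subseteq> sets M" using z B_subfields subfieldsD(2) by blast
    ultimately show ?thesis using uv(2) by (simp add: Int_absorb2)
  qed
qed

text \<open>The relation \<open>Q_z Q_x = Q_x\<close> becomes the value 1 of the image of
  \<open>Q_z\<close> on \<open>Sp x\<close>. The conclusion is about \<alpha> because
  \<open>z\<close> is a closure element, whereas \<open>Sp\<close> is tied to projections only on
  \<open>B\<close>.\<close>

lemma spectral_set_le:
  assumes x: "x \<in> B" and z: "z \<in> ClB" and xz: "x \<subseteq> z"
  shows "AE s in N. s \<in> Sp x \<longrightarrow> \<alpha> (sf_proj M z) s = 1"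
proof -
  have xT: "x \<in> subfields M" and xC: "x \<in> ClB" using x B_subfields B_subset_ClB by auto
  have zT: "z \<in> subfields M" using z by (rule closure_of_sf_topology_subfields)
  let ?Qx = "sf_proj M x" and ?Qz = "sf_proj M z"
  have Q: "?Qx \<in> \<A>" "?Qz \<in> \<A>" using xC z by (auto intro: ClB_proj_in_\<A>)
  then have c: "?Qz \<circ> ?Qx \<in> \<A>" using vn_\<A> by (auto intro: von_neumann_algebraD)
  have "op_eq M (?Qz \<circ> ?Qx) ?Qx"
    using sf_proj_tower[OF xT zT xz] by (simp add: op_eq_def)
  then have "AE s in N. \<alpha> (?Qz \<circ> ?Qx) s = \<alpha> ?Qx s" using alpha_op_eq[OF c Q(1)] by simp
  with alpha_comp[OF Q(2,1)] alpha_proj[OF x] show ?thesis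
    by eventually_elim auto
qed

lemma spectral_set_mono:
  assumes x: "x \<in> B" and z: "z \<in> B" and xz: "x \<subseteq> z"
  shows "AE s in N. s \<in> Sp x \<longrightarrow> s \<in> Sp z"
proof -
  have "z \<in> ClB" using z B_subset_ClB by blast
  from spectral_set_le[OF x this xz] alpha_proj[OF z] show ?thesis
    by eventually_elim (auto simp: indicator_def split: if_splits)
qed

text \<open>Directedness puts the supremum into the closure, so its projection lies in the algebra.
  Its image under \<alpha> is 1 on each covering set, thus almost everywhere by countability, and
  injectivity identifies the projection with the identity.\<close>

lemma Sup_eq_sets_if_spectral_cover:
  assumes D: "D \<subseteq> B" and dir: "\<And>x y. x \<in> D \<Longrightarrow> y \<in> D \<Longrightarrow> \<exists>z\<in>D. x \<subseteq> z \<and> y \<subseteq> z"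
    and D0: "D0 \<subseteq> D" "countable D0" "D \<noteq> {}" and cover: "AE s in N. \<exists>x\<in>D0. s \<in> Sp x"
  shows "sf_Sup M D = sets M"
proof (rule subfield_eq_sets_if_proj_id)
  let ?z = "sf_Sup M D"
  have z: "?z \<in> ClB" using B_subfields D0(3) D dir by (rule directed_Sup_in_closure)
  then show "?z \<in> subfields M" by (rule closure_of_sf_topology_subfields)
  have "AE s in N. \<forall>x\<in>D0. s \<in> Sp x \<longrightarrow> \<alpha> (sf_proj M ?z) s = 1"
    using D D0 z sf_Sup_upper[of _ D M]
    by (subst AE_ball_countable) (auto intro!: spectral_set_le)
  with cover alpha_id have "AE s in N. \<alpha> (sf_proj M ?z) s = \<alpha> id s"
    by eventually_elim auto
  then have "op_eq M (sf_proj M ?z) id"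
    using alpha_op_eq[OF ClB_proj_in_\<A>[OF z] von_neumann_algebraD(2)[OF vn_\<A>]] by simp
  then show "AE w in M. sf_proj M ?z f w = f w" if "f \<in> L2 M" for f
    using that by (simp add: op_eq_def)
qed

text \<open>An essential union obtained by exhaustion. The measures of \<open>Sp (c n)\<close>
  approach the supremum \<open>m\<close>; if some \<open>Sp x\<close> stuck out of the union by a
  positive amount, an upper bound of \<open>x\<close> and a suitable \<open>c n\<close> would have a
  spectral set of measure above \<open>m\<close>.\<close>

lemma spectral_sets_countable_union:
  assumes D: "D \<subseteq> B" "D \<noteq> {}" and dir: "\<And>x y. x \<in> D \<Longrightarrow> y \<in> D \<Longrightarrow> \<exists>z\<in>D. x \<subseteq> z \<and> y \<subseteq> z"
  shows "\<exists>c :: nat \<Rightarrow> _. range c \<subseteq> D \<and> (\<forall>x\<in>D. AE s in N. s \<in> Sp x \<longrightarrow> s \<in> (\<Union>n. Sp (c n)))"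
proof -
  interpret N: finite_measure N using spectral by (simp add: spectral_space_def)
  define m where "m = (SUP x\<in>D. measure N (Sp x))"
  have bdd: "bdd_above ((\<lambda>x. measure N (Sp x)) ` D)"
    by (intro bdd_aboveI[of _ "measure N (space N)"]) (auto simp: N.bounded_measure)
  have "\<exists>x\<in>D. m - 1 / Suc n < measure N (Sp x)" for n
    using less_cSUP_iff[OF D(2) bdd, of "m - 1 / Suc n"] by (simp add: m_def)
  then obtain c where c: "\<And>n. c n \<in> D" "\<And>n. m - 1 / Suc n < measure N (Sp (c n))"
    by metis
  let ?U = "\<Union>n. Sp (c n)"
  have meas: "Sp x \<in> sets N" if "x \<in> D" for x using that D Sp_sets by blast
  have U: "?U \<in> sets N" using meas c(1) by blast
  have "AE s in N. s \<in> Sp x \<longrightarrow> s \<in> ?U" if x: "x \<in> D" for x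
  proof -
    have bound: "measure N (Sp x - ?U) \<le> 1 / Suc n" for n
    proof -
      obtain w where w: "w \<in> D" "x \<subseteq> w" "c n \<subseteq> w" using dir x c(1) by blast
      have S: "Sp x \<in> sets N" "Sp w \<in> sets N" "Sp (c n) \<in> sets N" using meas x w(1) c(1) by auto
      have "measure N (Sp x - ?U) \<le> measure N (Sp x - Sp (c n))"
        using S by (intro N.finite_measure_mono) auto
      moreover have "measure N (Sp x - Sp (c n)) + measure N (Sp (c n))
          = measure N ((Sp x - Sp (c n)) \<union> Sp (c n))"
        using S by (intro N.finite_measure_Union[symmetric]) auto
      moreover have "measure N ((Sp x - Sp (c n)) \<union> Sp (c n)) \<le> measure N (Sp w)"
      proof (rule N.finite_measure_mono_AE)
        show "AE s in N. s \<in> (Sp x - Sp (c n)) \<union> Sp (c n) \<longrightarrow> s \<in> Sp w"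
          using spectral_set_mono[OF subsetD[OF D(1) x] subsetD[OF D(1) w(1)] w(2)]
            spectral_set_mono[OF subsetD[OF D(1) c(1)] subsetD[OF D(1) w(1)] w(3)]
          by eventually_elim blast
      qed (rule S)
      moreover have "measure N (Sp w) \<le> m"
        unfolding m_def using bdd w(1) by (rule cSUP_upper2) simp
      ultimately show ?thesis using c(2)[of n] by linarith
    qed
    have "(\<lambda>n. 1 / real (Suc n)) \<longlonglongrightarrow> 0"
      using LIMSEQ_inverse_real_of_nat by (simp add: inverse_eq_divide)
    then have "measure N (Sp x - ?U) \<le> 0" using bound by (intro LIMSEQ_le_const) auto
    then have "measure N (Sp x - ?U) = 0" by (simp add: measure_le_0_iff)
    then have "Sp x - ?U \<in> null_sets N"
      using meas[OF x] U by (auto simp: null_sets_def N.emeasure_eq_measure)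
    then have "AE s in N. s \<notin> Sp x - ?U" by (rule AE_not_in)
    then show ?thesis by eventually_elim blast
  qed
  then show ?thesis using c(1) by blast
qed

text \<open>Let \<open>p\<close> correspond to the indicator of the part left uncovered. Every
  \<open>Q_x p\<close> with \<open>x\<close> in \<open>D\<close> vanishes, while these
  \<open>Q_x\<close> converge strongly to the identity. So \<open>p\<close> is zero and the
  uncovered part is null.\<close>

lemma spectral_cover_if_Sup_eq_sets:
  assumes D: "D \<subseteq> B" "D \<noteq> {}" and dir: "\<And>x y. x \<in> D \<Longrightarrow> y \<in> D \<Longrightarrow> \<exists>z\<in>D. x \<subseteq> z \<and> y \<subseteq> z"
    and Sup: "sf_Sup M D = sets M"
  shows "\<exists>D0\<subseteq>D. countable D0 \<and> (AE s in N. \<exists>x\<in>D0. s \<in> Sp x)"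
proof -
  have DT: "x \<in> subfields M" if "x \<in> D" for x using that D B_subfields by blast
  obtain c :: "nat \<Rightarrow> _" where c: "range c \<subseteq> D"
    and cU: "\<And>x. x \<in> D \<Longrightarrow> AE s in N. s \<in> Sp x \<longrightarrow> s \<in> (\<Union>n. Sp (c n))"
    using spectral_sets_countable_union[OF D dir] by blast
  \<comment> \<open>The zero operator is written as a multiple of the identity, so that its
    membership in the algebra and its image follow from the scaling clauses.\<close>
  let ?U = "\<Union>n. Sp (c n)" let ?Z = "\<lambda>f w. 0 * id f w :: complex"
  have U: "?U \<in> sets N" using c D Sp_sets by blast
  have "indicator (space N - ?U) \<in> L_infinity N"
    using U by (auto simp: L_infinity_def indicator_def intro!: exI[of _ 1])
  then obtain p where p: "p \<in> \<A>" "AE s in N. \<alpha> p s = indicator (space N - ?U) s"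
    using alpha_surj by blast
  have Z: "?Z \<in> \<A>" by (intro von_neumann_algebraD(4)[OF vn_\<A>] von_neumann_algebraD(2)[OF vn_\<A>])
  have \<alpha>Z: "AE s in N. \<alpha> ?Z s = 0"
    using alpha_scale[OF von_neumann_algebraD(2)[OF vn_\<A>], of 0] by simp
  have zero: "AE w in M. sf_proj M x (p f) w = 0" if x: "x \<in> D" and f: "f \<in> L2 M" for x f
  proof -
    have xB: "x \<in> B" using x D by blast
    have Q: "sf_proj M x \<in> \<A>" using xB B_subset_ClB by (intro ClB_proj_in_\<A>) blast
    have c: "sf_proj M x \<circ> p \<in> \<A>" using Q p(1) by (rule von_neumann_algebraD(5)[OF vn_\<A>])
    have "AE s in N. \<alpha> (sf_proj M x \<circ> p) s = \<alpha> ?Z s"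
      using alpha_comp[OF Q p(1)] alpha_proj[OF xB] p(2) cU[OF x] \<alpha>Z
      by eventually_elim (auto simp: indicator_def)
    then have "op_eq M (sf_proj M x \<circ> p) ?Z" using alpha_op_eq[OF c Z] by simp
    then show ?thesis using f by (simp add: op_eq_def)
  qed
  have "AE w in M. p f w = 0" if f: "f \<in> L2 M" for f
  proof -
    have pf: "p f \<in> L2 M"
      using p(1) von_neumann_algebraD(1)[OF vn_\<A>] f bounded_opsD(1) by blast
    have id: "AE w in M. sf_proj M (sets M) (p f) w = p f w"
      using pf by (intro sf_proj_id subfields_sets) simp
    have "l2_norm M (p f) \<le> 0 + e" if e: "e > 0" for e :: real
    proof -
      obtain x where x: "x \<in> D"
        and less: "l2_norm M (\<lambda>w. sf_proj M x (p f) w - sf_proj M (sets M) (p f) w) < e"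
        using directed_Sup_sf_proj_limit[OF D(2) DT dir, of "{p f}" e] pf e Sup by auto
      have "l2_norm M (p f) = l2_norm M (\<lambda>w. - 1 * p f w)" by (subst l2_norm_scale) simp
      also have "\<dots> = l2_norm M (\<lambda>w. sf_proj M x (p f) w - sf_proj M (sets M) (p f) w)"
      proof (rule l2_norm_cong_AE)
        show "AE w in M. - 1 * p f w = sf_proj M x (p f) w - sf_proj M (sets M) (p f) w"
          using id zero[OF x f] by eventually_elim simp
      qed (use L2_measurable[OF pf] L2_measurable[OF sf_proj_L2[OF DT[OF x] pf]]
            L2_measurable[OF sf_proj_L2[OF subfields_sets pf]] in auto)
      finally show ?thesis using less by simp
    qed
    then have "l2_norm M (p f) \<le> 0" by (rule field_le_epsilon)
    then have "l2_norm M (p f) = 0" using l2_norm_nonneg[of M "p f"] by simp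
    then show ?thesis using l2_norm_eq_0_iff[OF pf] by simp
  qed
  then have "op_eq M p ?Z" by (simp add: op_eq_def)
  then have "AE s in N. \<alpha> p s = \<alpha> ?Z s" using alpha_op_eq[OF p(1) Z] by simp
  with p(2) \<alpha>Z AE_space[of N] have "AE s in N. \<exists>x\<in>range c. s \<in> Sp x"
    by eventually_elim (auto simp: indicator_def split: if_splits)
  then show ?thesis using c by (intro exI[of _ "range c"]) auto
qed

text \<open>The infimum of the complements dominates every complement of the supremum, is
  independent of the supremum, and hence equals any of its complements in the closure.\<close>

lemma complement_of_Sup_unique:
  assumes I: "I \<noteq> {}" "\<And>i. i \<in> I \<Longrightarrow> u i \<in> B" "\<And>i. i \<in> I \<Longrightarrow> v i \<in> B"
    and uv: "\<And>i. i \<in> I \<Longrightarrow> u i \<inter> v i = sf_zero M" "\<And>i. i \<in> I \<Longrightarrow> sf_join M (u i) (v i) = sets M"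
    and dir: "\<And>i j. i \<in> I \<Longrightarrow> j \<in> I \<Longrightarrow> \<exists>k\<in>I. u i \<subseteq> u k \<and> u j \<subseteq> u k"
  shows "x = sf_Sup M (u ` I) \<Longrightarrow> y \<in> subfields M \<Longrightarrow> (\<And>i. i \<in> I \<Longrightarrow> y \<subseteq> v i) \<Longrightarrow> x \<inter> y = sf_zero M"
    and "x = sf_Sup M (u ` I) \<Longrightarrow> y \<in> subfields M \<Longrightarrow> (\<And>i. i \<in> I \<Longrightarrow> y \<subseteq> v i) \<Longrightarrow>
      sf_join M x y = sets M \<Longrightarrow> y = (\<Inter>i\<in>I. v i)"
    and "x = sf_Sup M (u ` I) \<Longrightarrow> y \<in> ClB \<Longrightarrow> x \<inter> y = sf_zero M \<Longrightarrow> i \<in> I \<Longrightarrow> y \<subseteq> v i"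
proof -
  have uT: "z \<in> subfields M" if "z \<in> u ` I" for z using that I B_subfields by auto
  have vT: "z \<in> subfields M" if "z \<in> v ` I" for z using that I B_subfields by auto
  let ?x = "sf_Sup M (u ` I)" let ?w = "\<Inter>(v ` I)"
  have xT: "?x \<in> subfields M" using uT by (rule sf_Sup_subfields)
  have wT: "?w \<in> subfields M" using I(1) vT by (intro subfields_Inter) auto
  interpret w: sigma_algebra "space M" ?w using wT by (rule subfieldsD)
  have x_gen: "?x = sigma_sets (space M) (\<Union>(u ` I))"
    using I(1) uT by (intro sf_Sup_nonempty) auto
  \<comment> \<open>Independence is checked first on the union, an intersection-stable generator: a
    given pair of events involves a single index \<open>i\<close>, and \<open>u i\<close> is
    independent of \<open>v i\<close>.\<close>
  have "indep_set (\<Union>(u ` I)) ?w"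
  proof (rule indep_setI)
    show "\<Union>(u ` I) \<subseteq> events" "?w \<subseteq> events" using uT wT subfieldsD(2) by blast+
    fix a b assume a: "a \<in> \<Union>(u ` I)" and b: "b \<in> ?w"
    then obtain i where i: "i \<in> I" "a \<in> u i" "b \<in> v i" by blast
    have "indep_set (u i) (v i)"
      using subsetD[OF B_subset_ClB I(2)[OF i(1)]] subsetD[OF B_subset_ClB I(3)[OF i(1)]] uv(1)[OF i(1)]
      by (rule ClB_indep)
    then show "prob (a \<inter> b) = prob a * prob b" using i by (auto dest: indep_setD)
  qed
  moreover have "Int_stable (\<Union>(u ` I))" using uT dir by (intro Int_stable_directed_Union) auto
  moreover have "Int_stable ?w" by (rule Int_stableI) (rule w.Int)
  ultimately have indep: "indep_set ?x ?w"
    using indep_set_sigma_sets[of "\<Union>(u ` I)" ?w] by (simp add: x_gen w.sigma_sets_eq)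
  show "x \<inter> y = sf_zero M"
    if x: "x = ?x" and y: "y \<in> subfields M" and yv: "\<And>i. i \<in> I \<Longrightarrow> y \<subseteq> v i"
  proof
    show "sf_zero M \<subseteq> x \<inter> y" using sf_zero_least xT y x by auto
    show "x \<inter> y \<subseteq> sf_zero M"
    proof
      fix E assume E: "E \<in> x \<inter> y"
      then have "prob (E \<inter> E) = prob E * prob E" using x yv by (intro indep_setD[OF indep]) auto
      then have "prob E = 0 \<or> prob E = 1" by simp
      then show "E \<in> sf_zero M" using E subfieldsD(2)[OF y] by (auto simp: sf_zero_def)
    qed
  qed
  show "y = (\<Inter>i\<in>I. v i)"
    if x: "x = ?x" and y: "y \<in> subfields M" and yv: "\<And>i. i \<in> I \<Longrightarrow> y \<subseteq> v i"
      and join: "sf_join M x y = sets M"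
  proof -
    have "y \<subseteq> ?w" using yv by blast
    then show ?thesis
      using subfield_eq_if_join_indep[OF xT y wT _ indep] join x by simp
  qed
  show "y \<subseteq> v i" if x: "x = ?x" and y: "y \<in> ClB" and xy: "x \<inter> y = sf_zero M" and i: "i \<in> I"
  proof (rule ClB_le_complement[OF I(2)[OF i] I(3)[OF i] uv(1)[OF i] uv(2)[OF i] y])
    have "u i \<subseteq> x" unfolding x using i by (intro sf_Sup_upper imageI)
    moreover have "sf_zero M \<subseteq> y \<inter> u i"
      using sf_zero_least[OF closure_of_sf_topology_subfields[OF y]] sf_zero_least[OF uT[of "u i"]] i
      by auto
    ultimately show "y \<inter> u i = sf_zero M" using xy by blast
  qed
qed

end

section \<open>Regular open sets\<close>

lemma RegD:
  assumes "a \<in> Reg X"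
  shows "openin X (fst a)" "closedin X (snd a)" "fst a \<subseteq> snd a" "snd a \<subseteq> topspace X"
    "snd a = X closure_of (fst a)"
proof -
  have *: "fst a = X interior_of (snd a)" "snd a = X closure_of (fst a)"
    using assms by (auto simp: Reg_def)
  show "openin X (fst a)" by (subst *(1)) simp
  show "closedin X (snd a)" by (subst *(2)) simp
  show "fst a \<subseteq> snd a" by (subst *(1)) (rule interior_of_subset)
  show "snd a \<subseteq> topspace X" "snd a = X closure_of (fst a)" using assms by (auto simp: Reg_def)
qed

lemma reg_meet_compl:
  assumes "a \<in> Reg X"
  shows "reg_meet X a (reg_compl X a) = reg_zero"
proof -
  have "fst a \<inter> (topspace X - snd a) = {}" using RegD(3)[OF assms] by blast
  then show ?thesis by (simp add: reg_meet_def reg_compl_def reg_zero_def)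
qed

lemma reg_join_compl:
  assumes "a \<in> Reg X"
  shows "reg_join X a (reg_compl X a) = reg_one X"
proof -
  have "snd a \<union> (topspace X - fst a) = topspace X" using RegD(3,4)[OF assms] by blast
  then show ?thesis by (simp add: reg_join_def reg_compl_def reg_one_def)
qed

lemma reg_meet_absorb:
  assumes "a \<in> Reg X" "fst a \<subseteq> fst b"
  shows "reg_meet X a b = a"
proof -
  have "fst a \<inter> fst b = fst a" using assms(2) by blast
  then show ?thesis using RegD(5)[OF assms(1)] by (simp add: reg_meet_def prod_eq_iff)
qed

text \<open>Regularity provides a closed neighbourhood \<open>V\<close> within \<open>W\<close>; a
  base element inside its open part has its closure within \<open>V\<close>.\<close>

lemma regular_base_closure_nbhd:
  assumes reg: "regular_space X" and A: "A0 \<subseteq> Reg X"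
    and base: "openin X = arbitrary union_of (\<lambda>G. G \<in> fst ` A0)"
    and W: "openin X W" "p \<in> W"
  shows "\<exists>a\<in>A0. p \<in> fst a \<and> snd a \<subseteq> W"
proof -
  have "neighbourhood_base_of (closedin X) X" using reg by (simp add: neighbourhood_base_of_closedin)
  then obtain U V where U: "openin X U" "p \<in> U" "U \<subseteq> V" and V: "closedin X V" "V \<subseteq> W"
    using W unfolding neighbourhood_base_of by meson
  obtain \<U> where "\<U> \<subseteq> fst ` A0" "\<Union>\<U> = U"
    using U(1) unfolding base by (auto simp: union_of_def arbitrary_def)
  then obtain a where a: "a \<in> A0" "p \<in> fst a" "fst a \<subseteq> U" using U(2) by blast
  have "X closure_of (fst a) \<subseteq> V" using a(3) U(3) V(1) by (intro closure_of_minimal) auto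
  then have "snd a \<subseteq> W" using a(1) V(2) A RegD(5)[of a X] by auto
  then show ?thesis using a by blast
qed

lemma finite_join_cover:
  assumes J: "finite J" "J \<subseteq> P" and zero: "reg_zero \<in> P"
    and join: "\<And>a b. a \<in> P \<Longrightarrow> b \<in> P \<Longrightarrow> reg_join X a b \<in> P"
  shows "\<exists>a\<in>P. (\<Union>j\<in>J. snd j) \<subseteq> snd a"
  using J
proof (induction J)
  case empty
  show ?case using zero by (intro bexI[of _ reg_zero]) simp_all
next
  case (insert j J)
  then obtain a where "a \<in> P" "(\<Union>j\<in>J. snd j) \<subseteq> snd a" by auto
  then show ?case
    using join[of j a] insert.prems by (intro bexI[of _ "reg_join X j a"]) (auto simp: reg_join_def)
qed

text \<open>One upper bound is chosen for each finite subset of \<open>Q\<close>. There are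
  countably many of these, so null sets can be united although the finite subcover of
  \<open>F s\<close> varies with \<open>s\<close>.\<close>

lemma countable_join_cover:
  assumes Q: "countable Q" "Q \<subseteq> P" and zero: "reg_zero \<in> P"
    and join: "\<And>a b. a \<in> P \<Longrightarrow> b \<in> P \<Longrightarrow> reg_join X a b \<in> P"
  shows "\<exists>C. countable C \<and> C \<subseteq> P \<and> (\<forall>J. finite J \<and> J \<subseteq> Q \<longrightarrow> (\<exists>c\<in>C. (\<Union>j\<in>J. snd j) \<subseteq> snd c))"
proof -
  let ?F = "{J. J \<subseteq> Q \<and> finite J}"
  have "\<forall>J\<in>?F. \<exists>c. c \<in> P \<and> (\<Union>j\<in>J. snd j) \<subseteq> snd c"
  proof
    fix J assume J: "J \<in> ?F"
    have "\<exists>c\<in>P. (\<Union>j\<in>J. snd j) \<subseteq> snd c"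
      by (rule finite_join_cover[where X = X]) (use J Q(2) zero join in auto)
    then show "\<exists>c. c \<in> P \<and> (\<Union>j\<in>J. snd j) \<subseteq> snd c" by blast
  qed
  then obtain g where g: "\<forall>J\<in>?F. g J \<in> P \<and> (\<Union>j\<in>J. snd j) \<subseteq> snd (g J)"
    using bchoice by meson
  have "countable (g ` ?F)" using countable_Collect_finite_subset[OF Q(1)] by (simp add: conj_commute)
  then show ?thesis using g by (intro exI[of _ "g ` ?F"]) blast
qed

section \<open>Boundary avoidance and the complement of \<open>h_minus\<close>\<close>

theorem proposition3p2p9:
  fixes M :: "'a measure" and B :: "'a set set set"
    and N :: "'s measure" and \<alpha> :: "'a operator \<Rightarrow> 's \<Rightarrow> complex" and Sp :: "'a set set \<Rightarrow> 's set"
    and X :: "'x topology" and A :: "'x regpair set" and h :: "'x regpair \<Rightarrow> 'a set set"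
    and F :: "'s \<Rightarrow> 'x set" and r :: "'x regpair"
  assumes "prob_space M" and "complete_measure M" and "separable_L2 M"
    and "noise_boolean_algebra M B"
    and "spectral_space M B N \<alpha> Sp"
    and "reg_subalgebra X A"
    and "boolean_hom X A M B h"
    and A1: "\<exists>A0\<subseteq>A. countable A0 \<and> openin X = arbitrary union_of (\<lambda>G. G \<in> fst ` A0)"
    and A2: "\<And>a. a \<in> A \<Longrightarrow> \<exists>b :: nat \<Rightarrow> 'x regpair.
       (\<forall>n. b n \<in> A \<and> reg_le (b n) (b (Suc n)) \<and> compactin X (snd (b n)) \<and> snd (b n) \<subseteq> fst a) \<and>
       decseq (\<lambda>n. h (reg_compl X (b n))) \<and>
       (\<Inter>n. h (reg_compl X (b n))) = h (reg_compl X a)"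
    and "\<And>s. s \<in> space N \<Longrightarrow> closedin X (F s)"
    and "\<And>a. a \<in> A \<Longrightarrow> AE s in N. s \<in> Sp (h a) \<longleftrightarrow> F s \<subseteq> snd a"
    and "r \<in> Reg X" and "r \<notin> A"
  shows "(sf_join M (h_minus M A h r) (h_minus M A h (reg_compl X r)) = sets M \<longrightarrow>
            (AE s in N. F s \<inter> reg_bd r = {})) \<and>
         ((AE s in N. F s \<inter> reg_bd r = {}) \<and> (AE s in N. compactin X (F s)) \<and> regular_space X \<longrightarrow>
            sf_join M (h_minus M A h r) (h_minus M A h (reg_compl X r)) = sets M \<and>
            h_minus M A h r \<in> noise_completion M B \<and>
            (\<forall>y. sf_complement M (noise_completion M B) (h_minus M A h r) y \<longleftrightarrow>
                 y = h_minus M A h (reg_compl X r)))"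
proof -
  interpret prob_space M by fact
  interpret spectral_noise_algebra M B N \<alpha> Sp
    by unfold_locales fact+
  have A_Reg: "A \<subseteq> Reg X" and zero: "reg_zero \<in> A"
    and compl: "\<And>a. a \<in> A \<Longrightarrow> reg_compl X a \<in> A"
    and join: "\<And>a b. a \<in> A \<Longrightarrow> b \<in> A \<Longrightarrow> reg_join X a b \<in> A"
    using \<open>reg_subalgebra X A\<close> by (auto simp: reg_subalgebra_def)
  have h_B: "\<And>a. a \<in> A \<Longrightarrow> h a \<in> B" and h_zero: "h reg_zero = sf_zero M"
    and h_one: "h (reg_one X) = sets M"
    and h_meet: "\<And>a b. a \<in> A \<Longrightarrow> b \<in> A \<Longrightarrow> h (reg_meet X a b) = h a \<inter> h b"
    and h_join: "\<And>a b. a \<in> A \<Longrightarrow> b \<in> A \<Longrightarrow> h (reg_join X a b) = sf_join M (h a) (h b)"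
    using \<open>boolean_hom X A M B h\<close> by (auto simp: boolean_hom_def)
  note F_Sp = \<open>\<And>a. a \<in> A \<Longrightarrow> AE s in N. s \<in> Sp (h a) \<longleftrightarrow> F s \<subseteq> snd a\<close>
  note r = RegD[OF \<open>r \<in> Reg X\<close>]
  let ?r' = "reg_compl X r"
  \<comment> \<open>\<open>P t\<close> contains \<open>reg_zero\<close> and is closed under joins,
    which makes its image under \<open>h\<close> nonempty and directed.\<close>
  define P where "P t = {a \<in> A. snd a \<subseteq> fst t}" for t :: "'x regpair"
  have P_A: "a \<in> P t \<Longrightarrow> a \<in> A" and P_zero: "reg_zero \<in> P t"
    and P_join: "a \<in> P t \<Longrightarrow> b \<in> P t \<Longrightarrow> reg_join X a b \<in> P t" for t a b
    using zero join by (auto simp: P_def reg_zero_def reg_join_def)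
  have h_minus_eq: "h_minus M A h t = sf_Sup M (h ` P t)" for t
    unfolding h_minus_def P_def by (rule arg_cong[of _ _ "sf_Sup M"]) blast
  have hP_B: "h ` P t \<subseteq> B" and hP_ne: "h ` P t \<noteq> {}" for t
    using P_A P_zero h_B by blast+
  have hP_T: "x \<in> subfields M" if "x \<in> h ` P t" for x t
    using that hP_B B_subfields by blast
  have P_dir: "\<exists>k\<in>P t. h a \<subseteq> h k \<and> h b \<subseteq> h k" if "a \<in> P t" "b \<in> P t" for a b t
  proof (intro bexI conjI)
    have "h (reg_join X a b) = sf_join M (h a) (h b)"
      using that by (intro h_join P_A)
    then show "h a \<subseteq> h (reg_join X a b)" "h b \<subseteq> h (reg_join X a b)" by (simp_all add: sf_join_upper)
  qed (rule P_join[OF that])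
  have hP_dir: "\<exists>z\<in>h ` P t. x \<subseteq> z \<and> y \<subseteq> z" if xy: "x \<in> h ` P t" "y \<in> h ` P t" for x y t
  proof -
    obtain a b where "a \<in> P t" "b \<in> P t" "x = h a" "y = h b" using xy by blast
    then show ?thesis using P_dir[of a t b] by auto
  qed
  let ?x = "h_minus M A h r" and ?y = "h_minus M A h ?r'"
  \<comment> \<open>Each member is \<open>h (reg_join X a b)\<close> with \<open>a\<close> below
    \<open>r\<close> and \<open>b\<close> below its complement, so its spectral set consists, up to
    a null set, of the \<open>s\<close> with
    \<open>F s \<subseteq> snd a \<union> snd b\<close>.\<close>
  define D where "D = (\<lambda>(x, y). sf_join M x y) ` (h ` P r \<times> h ` P ?r')"
  have D_Sup: "sf_join M ?x ?y = sf_Sup M D"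
    unfolding h_minus_eq D_def by (rule sf_join_sf_Sup[OF hP_ne hP_T hP_ne hP_T])
  have h_join_P: "h (reg_join X a b) = sf_join M (h a) (h b)" if "a \<in> P r" "b \<in> P ?r'" for a b
    using that by (intro h_join P_A)
  have D_h: "\<exists>a\<in>P r. \<exists>b\<in>P ?r'. d = h (reg_join X a b)" if d: "d \<in> D" for d
  proof -
    obtain a b where "a \<in> P r" "b \<in> P ?r'" "d = sf_join M (h a) (h b)" using d unfolding D_def by blast
    then show ?thesis using h_join_P by (intro bexI[of _ a] bexI[of _ b]) simp_all
  qed
  have h_D: "h (reg_join X a b) \<in> D" if "a \<in> P r" "b \<in> P ?r'" for a b
    unfolding D_def h_join_P[OF that] using that by (intro image_eqI[of _ _ "(h a, h b)"]) auto
  have D_B: "D \<subseteq> B"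
  proof
    fix d assume "d \<in> D"
    then obtain a b where "a \<in> P r" "b \<in> P ?r'" "d = h (reg_join X a b)" using D_h by blast
    then show "d \<in> B" by (simp add: h_B join P_A)
  qed
  have D_ne: "D \<noteq> {}" using h_D P_zero by blast
  have D_dir: "\<exists>z\<in>D. x \<subseteq> z \<and> y \<subseteq> z" if xy: "x \<in> D" "y \<in> D" for x y
  proof -
    obtain a b where ab: "a \<in> h ` P r" "b \<in> h ` P ?r'" and x: "x = sf_join M a b"
      using xy(1) unfolding D_def by blast
    obtain a' b' where ab': "a' \<in> h ` P r" "b' \<in> h ` P ?r'" and y: "y = sf_join M a' b'"
      using xy(2) unfolding D_def by blast
    obtain a'' where a'': "a'' \<in> h ` P r" "a \<subseteq> a''" "a' \<subseteq> a''"
      using hP_dir[OF ab(1) ab'(1)] by blast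
    obtain b'' where b'': "b'' \<in> h ` P ?r'" "b \<subseteq> b''" "b' \<subseteq> b''"
      using hP_dir[OF ab(2) ab'(2)] by blast
    have "sf_join M a'' b'' \<in> D"
      unfolding D_def using a''(1) b''(1) by (intro image_eqI[of _ _ "(a'', b'')"]) auto
    moreover have "x \<subseteq> sf_join M a'' b''" "y \<subseteq> sf_join M a'' b''"
      using a''(2,3) b''(2,3) by (simp_all add: x y sf_join_mono)
    ultimately show ?thesis by (intro bexI[of _ "sf_join M a'' b''"] conjI)
  qed
  \<comment> \<open>The space splits into the boundary and two open sets. Disjointness serves (a);
    exhaustion of the space serves (b).\<close>
  have bd: "reg_bd r \<inter> (fst r \<union> fst ?r') = {}" "topspace X \<subseteq> reg_bd r \<union> (fst r \<union> fst ?r')"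
    using r by (auto simp: reg_bd_def reg_compl_def)

  have part_a: "AE s in N. F s \<inter> reg_bd r = {}" if "sf_join M ?x ?y = sets M"
  proof -
    have "sf_Sup M D = sets M" using that D_Sup by simp
    then obtain D0 where D0: "D0 \<subseteq> D" "countable D0" "AE s in N. \<exists>d\<in>D0. s \<in> Sp d"
      using spectral_cover_if_Sup_eq_sets[OF D_B D_ne D_dir] by blast
    \<comment> \<open>The closures of \<open>a\<close> and \<open>b\<close> lie in the two open sets
      and so miss the boundary. The exceptional set depends on \<open>d\<close>, which is why a
      countable \<open>D0\<close> was extracted.\<close>
    have "AE s in N. s \<in> Sp d \<longrightarrow> F s \<inter> reg_bd r = {}" if d: "d \<in> D0" for d
    proof -
      obtain a b where ab: "a \<in> P r" "b \<in> P ?r'" "d = h (reg_join X a b)"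
        using D_h d D0(1) by blast
      then have "snd (reg_join X a b) \<subseteq> fst r \<union> fst ?r'" by (auto simp: P_def reg_join_def)
      moreover have "AE s in N. s \<in> Sp d \<longleftrightarrow> F s \<subseteq> snd (reg_join X a b)"
        unfolding ab(3) using ab(1,2) P_A by (intro F_Sp join) auto
      ultimately show ?thesis using bd(1) by (auto elim!: eventually_mono)
    qed
    then have "AE s in N. \<forall>d\<in>D0. s \<in> Sp d \<longrightarrow> F s \<inter> reg_bd r = {}"
      by (subst AE_ball_countable[OF D0(2)]) blast
    with D0(3) show ?thesis by eventually_elim blast
  qed

  have part_b: "sf_join M ?x ?y = sets M"
    if disj: "AE s in N. F s \<inter> reg_bd r = {}" and comp: "AE s in N. compactin X (F s)"
      and reg: "regular_space X"
  proof -
    obtain A0 where A0: "A0 \<subseteq> A" "countable A0" "openin X = arbitrary union_of (\<lambda>G. G \<in> fst ` A0)"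
      using A1 by blast
    \<comment> \<open>Needed for \<open>r\<close> and for its complement separately: a finite
      subcover of \<open>F s\<close> is split into two parts, each dominated by one member of its
      own countable family.\<close>
    have cover: "\<exists>C. countable C \<and> C \<subseteq> P t \<and>
        (\<forall>J. finite J \<and> J \<subseteq> A0 \<inter> P t \<longrightarrow> (\<exists>c\<in>C. (\<Union>j\<in>J. snd j) \<subseteq> snd c))" for t
      by (rule countable_join_cover[where X = X]) (use A0(2) P_zero P_join in auto)
    obtain C where C: "countable C" "C \<subseteq> P r"
      "\<forall>J. finite J \<and> J \<subseteq> A0 \<inter> P r \<longrightarrow> (\<exists>c\<in>C. (\<Union>j\<in>J. snd j) \<subseteq> snd c)"
      using cover[of r] by (elim exE conjE)
    obtain C' where C': "countable C'" "C' \<subseteq> P ?r'"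
      "\<forall>J. finite J \<and> J \<subseteq> A0 \<inter> P ?r' \<longrightarrow> (\<exists>c\<in>C'. (\<Union>j\<in>J. snd j) \<subseteq> snd c)"
      using cover[of ?r'] by (elim exE conjE)
    let ?K = "(\<lambda>(c, c'). reg_join X c c') ` (C \<times> C')"
    have KE: "\<exists>c\<in>P r. \<exists>c'\<in>P ?r'. k = reg_join X c c'" if k: "k \<in> ?K" for k
    proof -
      obtain p where p: "p \<in> C \<times> C'" "k = (\<lambda>(c, c'). reg_join X c c') p" using k by (rule imageE)
      then show ?thesis
        using C(2) C'(2) by (intro bexI[of _ "fst p"] bexI[of _ "snd p"]) (auto simp: case_prod_unfold)
    qed
    have K: "countable ?K" "k \<in> ?K \<Longrightarrow> k \<in> A" "h ` ?K \<subseteq> D" for k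
    proof -
      show "countable ?K" using C(1) C'(1) by simp
      show "k \<in> A" if "k \<in> ?K"
      proof -
        from KE[OF that] obtain c c' where "c \<in> P r" "c' \<in> P ?r'" "k = reg_join X c c'" by (elim bexE)
        then show ?thesis using P_A join by simp
      qed
      show "h ` ?K \<subseteq> D"
      proof (rule image_subsetI)
        fix k assume "k \<in> ?K"
        from KE[OF this] obtain c c' where "c \<in> P r" "c' \<in> P ?r'" "k = reg_join X c c'" by (elim bexE)
        then show "h k \<in> D" using h_D by simp
      qed
    qed
    have nbhd: "\<exists>a\<in>A0 \<inter> P t. p \<in> fst a" if "openin X (fst t)" "p \<in> fst t" for t p
      using regular_base_closure_nbhd[OF reg _ A0(3) that] A0(1) A_Reg by (auto simp: P_def)
    have open': "openin X (fst ?r')" using r(2) by (simp add: reg_compl_def openin_diff)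
    have K_cover: "\<exists>k\<in>?K. F s \<subseteq> snd k" if s: "F s \<inter> reg_bd r = {}" "compactin X (F s)" for s
    proof -
      let ?Q = "A0 \<inter> (P r \<union> P ?r')"
      have "F s \<subseteq> \<Union>(fst ` ?Q)"
      proof
        fix p assume p: "p \<in> F s"
        then have "p \<in> fst r \<union> fst ?r'" using s compactin_subset_topspace[OF s(2)] bd(2) by blast
        then show "p \<in> \<Union>(fst ` ?Q)" using nbhd[OF r(1)] nbhd[OF open'] by blast
      qed
      moreover have "openin X G" if "G \<in> fst ` ?Q" for G
        using that A0(1) A_Reg RegD(1) by blast
      ultimately obtain \<V> where \<V>: "finite \<V>" "\<V> \<subseteq> fst ` ?Q" "F s \<subseteq> \<Union>\<V>"
        using compactinD[OF s(2), of "fst ` ?Q"] by blast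
      obtain J where J: "finite J" "J \<subseteq> ?Q" "\<V> = fst ` J"
        using finite_subset_image[OF \<V>(1,2)] by blast
      obtain c where c: "c \<in> C" "(\<Union>j\<in>J \<inter> P r. snd j) \<subseteq> snd c"
        using C(3)[rule_format, of "J \<inter> P r"] J(1,2) by blast
      obtain c' where c': "c' \<in> C'" "(\<Union>j\<in>J \<inter> P ?r'. snd j) \<subseteq> snd c'"
        using C'(3)[rule_format, of "J \<inter> P ?r'"] J(1,2) by blast
      have "F s \<subseteq> snd (reg_join X c c')"
      proof
        fix p assume "p \<in> F s"
        then obtain j where j: "j \<in> J" "p \<in> fst j" using \<V>(3) J(3) by blast
        then have "j \<in> Reg X" using J(2) A0(1) A_Reg by blast
        then have p: "p \<in> snd j" using RegD(3) j(2) by blast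
        have "j \<in> P r \<or> j \<in> P ?r'" using j(1) J(2) by blast
        then have "p \<in> snd c \<union> snd c'" using p j(1) c(2) c'(2) by blast
        then show "p \<in> snd (reg_join X c c')" by (simp add: reg_join_def)
      qed
      moreover have "reg_join X c c' \<in> ?K"
        using c(1) c'(1) by (intro image_eqI[of _ _ "(c, c')"]) auto
      ultimately show ?thesis by (rule bexI)
    qed
    \<comment> \<open>Countability of \<open>?K\<close> yields one null set good for all
      \<open>k\<close>, as the \<open>k\<close> that covers \<open>F s\<close> depends on
      \<open>s\<close>.\<close>
    have "AE s in N. \<forall>k\<in>?K. s \<in> Sp (h k) \<longleftrightarrow> F s \<subseteq> snd k"
      by (subst AE_ball_countable[OF K(1)]) (intro ballI F_Sp K(2))
    with disj comp have "AE s in N. \<exists>d\<in>h ` ?K. s \<in> Sp d"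
    proof eventually_elim
      case (elim s)
      from K_cover[OF elim(1,2)] obtain k where k: "k \<in> ?K" "F s \<subseteq> snd k" by (elim bexE)
      from bspec[OF elim(3) k(1)] k(2) have "s \<in> Sp (h k)" by (rule iffD2)
      then show ?case using k(1) by (intro bexI[OF _ imageI])
    qed
    then have "sf_Sup M D = sets M"
      using Sup_eq_sets_if_spectral_cover[OF D_B D_dir K(3) countable_image[OF K(1)] D_ne] by blast
    then show ?thesis using D_Sup by simp
  qed

  have clB: "h_minus M A h t \<in> ClB" for t
    unfolding h_minus_eq by (rule directed_Sup_in_closure[OF B_subfields hP_ne hP_B hP_dir])
  have uv: "h a \<in> B" "h (reg_compl X a) \<in> B" "h a \<inter> h (reg_compl X a) = sf_zero M"
    "sf_join M (h a) (h (reg_compl X a)) = sets M" if "a \<in> P r" for a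
  proof -
    have a: "a \<in> A" "reg_compl X a \<in> A" "a \<in> Reg X"
      using P_A[OF that] compl[OF P_A[OF that]] A_Reg by auto
    show "h a \<in> B" "h (reg_compl X a) \<in> B" using a h_B by auto
    show "h a \<inter> h (reg_compl X a) = sf_zero M"
      using h_meet[OF a(1,2)] reg_meet_compl[OF a(3)] h_zero by simp
    show "sf_join M (h a) (h (reg_compl X a)) = sets M"
      using h_join[OF a(1,2)] reg_join_compl[OF a(3)] h_one by simp
  qed
  have P_ne: "P r \<noteq> {}" using P_zero by blast
  note compl_unique = complement_of_Sup_unique[where I = "P r" and u = h and v = "\<lambda>a. h (reg_compl X a)"]
  note P_facts = P_ne uv P_dir h_minus_eq
  have x_disjoint: "?x \<inter> y = sf_zero M"
    if "y \<in> subfields M" "\<And>a. a \<in> P r \<Longrightarrow> y \<subseteq> h (reg_compl X a)" for y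
    by (rule compl_unique(1); fact P_facts that)
  have x_compl_unique: "y = (\<Inter>a\<in>P r. h (reg_compl X a))"
    if "y \<in> subfields M" "\<And>a. a \<in> P r \<Longrightarrow> y \<subseteq> h (reg_compl X a)" "sf_join M ?x y = sets M" for y
    by (rule compl_unique(2); fact P_facts that)
  have x_compl_le: "y \<subseteq> h (reg_compl X a)" if "y \<in> ClB" "?x \<inter> y = sf_zero M" "a \<in> P r" for y a
    by (rule compl_unique(3); fact P_facts that)
  have y_T: "?y \<in> subfields M" using clB by (rule closure_of_sf_topology_subfields)
  have y_le: "?y \<subseteq> h (reg_compl X a)" if a: "a \<in> P r" for a
  proof -
    have aA: "reg_compl X a \<in> A" "a \<in> Reg X" using compl[OF P_A[OF a]] P_A[OF a] A_Reg by auto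
    have "h b \<subseteq> h (reg_compl X a)" if b: "b \<in> P ?r'" for b
    proof -
      have bA: "b \<in> A" "b \<in> Reg X" using P_A[OF b] A_Reg by auto
      \<comment> \<open>The set \<open>snd b\<close> avoids \<open>snd r\<close>, which contains
        \<open>snd a\<close>. Monotonicity of \<open>h\<close> then comes from preservation of
        meets.\<close>
      have "fst b \<subseteq> fst (reg_compl X a)"
        using RegD(3,4)[OF bA(2)] a b r(3) unfolding P_def reg_compl_def fst_conv by blast
      then have "h b = h b \<inter> h (reg_compl X a)"
        using h_meet[OF bA(1) aA(1)] reg_meet_absorb[OF bA(2)] by simp
      then show ?thesis by blast
    qed
    moreover have "h (reg_compl X a) \<in> subfields M" using uv(2)[OF a] B_subfields by blast
    ultimately show ?thesis unfolding h_minus_eq by (intro sf_Sup_least) auto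
  qed
  have xy: "?x \<inter> ?y = sf_zero M" using y_T y_le by (rule x_disjoint)
  have completion: "?x \<in> noise_completion M B \<and>
      (\<forall>y. sf_complement M (noise_completion M B) ?x y \<longleftrightarrow> y = ?y)"
    if top: "sf_join M ?x ?y = sets M"
  proof (intro conjI allI)
    show x_c: "?x \<in> noise_completion M B"
      unfolding noise_completion_def sf_complement_def using clB[of r] clB[of ?r'] xy top by blast
    have y_c: "?y \<in> noise_completion M B"
      unfolding noise_completion_def sf_complement_def
      using clB[of r] clB[of ?r'] xy[unfolded Int_commute[of ?x]] top[unfolded sf_join_commute[of M ?x]]
      by blast
    fix y show "sf_complement M (noise_completion M B) ?x y \<longleftrightarrow> y = ?y"
    proof
      assume "sf_complement M (noise_completion M B) ?x y"
      then have y: "y \<in> ClB" "?x \<inter> y = sf_zero M" "sf_join M ?x y = sets M"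
        by (auto simp: sf_complement_def noise_completion_def)
      \<comment> \<open>This intersection does not depend on \<open>y\<close>, and \<open>?y\<close>
        equals it by the same argument; hence the complement is unique.\<close>
      have "y = (\<Inter>a\<in>P r. h (reg_compl X a))"
        using closure_of_sf_topology_subfields[OF y(1)] x_compl_le[OF y(1,2)] y(3)
        by (rule x_compl_unique)
      also have "\<dots> = ?y" using x_compl_unique[OF y_T y_le top] by simp
      finally show "y = ?y" .
    qed (use y_c xy top in \<open>auto simp: sf_complement_def\<close>)
  qed
  show ?thesis using part_a part_b completion by blast
qed

end
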